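(* Let $n\geq 2$ and $m\geq 1$ be integers, let $\varphi_1,\varphi_2\in\mathcal{C}(\mathbb{S}^{n-1},\mathbb{R}^m)$ and $g\in\mathcal{C}(\overline{\mathbb{B}^n},\mathbb{R}^m)$. If $f$ is a solution to the inhomogeneous biharmonic Dirichlet problem $$\Delta(\Delta f)=g \text{ in } \mathbb{B}^n,\qquad f=\varphi_1 \text{ on } \mathbb{S}^{n-1},\qquad \frac{\partial f}{\partial\mathbf{n}}=\varphi_2 \text{ on } \mathbb{S}^{n-1},$$ then, for all $x\in\overline{\mathbb{B}^n}$, $$\big|f(x)-\delta_1(|x|)K[\varphi_1](0)-\delta_2(|x|)H[\varphi_2](0)\big|\leq \frac{|n-4|}{4}\|\varphi_1\|_\infty(1-|x|^2)U(|x|e_n)+\frac{n}{4}\|\varphi_1\|_\infty U^{\ast}(|x|e_n)+\frac{\|\varphi_2\|_\infty}{2}(1-|x|^2)U(|x|e_n)+\frac{\|g\|_\infty}{8n(n+2)}(1-|x|^2)^2,$$ where $$\delta_1(|x|)=\frac{n}{4}\frac{(1-|x|^2)^3}{(1+|x|^2)^{\frac{n+2}{2}}}-\frac{n-4}{4}\frac{(1-|x|^2)^2}{(1+|x|^2)^{\frac n2}},\qquad \delta_2(|x|)=\frac{(1-|x|^2)^2}{(1+|x|^2)^{\frac n2}}.$$ Moreover, the estimate is sharp in $\overline{\mathbb{B}^n}$: for a constant $M$, if $g=(8n(n+2)M,0,\ldots,0)\in\mathbb{R}^m$ in $\mathbb{B}^n$ and $\varphi_1=\varphi_2=(0,\ldots,0)\in\mathbb{R}^m$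 on $\mathbb{S}^{n-1}$, then $f(x)=(M(1-|x|^2)^2,0,\ldots,0)\in\mathbb{R}^m$ is a solution of the problem for which equality holds in the estimate at every $x\in\overline{\mathbb{B}^n}$.
   Context: $\mathbb{B}^n$ is the open unit ball of $\mathbb{R}^n$, $\overline{\mathbb{B}^n}$ its closure, $\mathbb{S}^{n-1}$ the unit sphere, $|\cdot|$ the Euclidean norm, $d\sigma$ the normalized Lebesgue surface measure on $\mathbb{S}^{n-1}$ (total mass $1$), $\mathcal{C}(A,B)$ the set of continuous functions from $A$ to $B$, $e_n=(0,\ldots,0,1)\in\mathbb{R}^n$, and $\Delta=\sum_{j=1}^n\partial^2/\partial x_j^2$ is the Laplacian (acting componentwise). $\partial f/\partial\mathbf{n}=(\partial f_1/\partial\mathbf{n},\ldots,\partial f_m/\partial\mathbf{n})$ denotes differentiation in the inward normal direction. The boundary conditions are interpreted in the following distributional sense. For $r\in(0,1)$ put $f_r(\zeta)=f(r\zeta)$ for $\zeta\in\mathbb{S}^{n-1}$, and let $r\,\partial f_r/\partial\mathbf{n}$ be the inward normal derivative on $\mathbb{S}^{n-1}$ of $F(x)=f(rx)$ (that is, $-\frac{d}{dt}F(t\zeta)|_{t=1}$ at $\zeta$). Then, as $r\to1^-$, $f_r\to\varphi_1$ and $r(\partial f_r/\partial\mathbf{n})\to\varphi_2$. For $x\in\mathbb{B}^n$ and $\zeta\in\mathbb{S}^{n-1}$, $$H_n(x,\zeta)=\frac12\frac{(1-|x|^2)^2}{|x-\zeta|^n},\qquad K_n(x,\zeta)=\frac14\frac{(1-|x|^2)^2}{|x-\zeta|^{n+2}}\big(n(1-|x|^2)-(n-4)|x-\zeta|^2\big),$$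 $$K[\varphi_1](x)=\int_{\mathbb{S}^{n-1}}K_n(x,\zeta)\varphi_1(\zeta)\,d\sigma(\zeta),\qquad H[\varphi_2](x)=\int_{\mathbb{S}^{n-1}}H_n(x,\zeta)\varphi_2(\zeta)\,d\sigma(\zeta).$$ Norms: $\|\varphi_k\|_\infty=\sup_{\zeta\in\mathbb{S}^{n-1}}|\varphi_k(\zeta)|$ for $k=1,2$, and $\|g\|_\infty=\sup_{x\in\mathbb{B}^n}|g(x)|$. With $\mathbb{S}^{n-1}_+=\{x\in\mathbb{S}^{n-1}:x_n\geq0\}$, $\mathbb{S}^{n-1}_-=\{x\in\mathbb{S}^{n-1}:x_n\leq0\}$ and $\chi$ denoting indicator functions, $$U(x)=\int_{\mathbb{S}^{n-1}}\frac{1-|x|^2}{|x-\zeta|^n}\big(\chi_{\mathbb{S}^{n-1}_+}(\zeta)-\chi_{\mathbb{S}^{n-1}_-}(\zeta)\big)\,d\sigma(\zeta),$$ $$U^{\ast}(x)=\int_{\mathbb{S}^{n-1}}\frac{(1-|x|^2)^3}{|x-\zeta|^{n+2}}\big(\chi_{\mathbb{S}^{n-1}_+}(\zeta)-\chi_{\mathbb{S}^{n-1}_-}(\zeta)\big)\,d\sigma(\zeta)$$ for $x\in\mathbb{B}^n$. When $|x|=1$, $f(x)$ means $\varphi_1(x)$, and $U(|x|e_n)$, $U^{\ast}(|x|e_n)$ mean the limits of $U(re_n)$, $U^{\ast}(re_n)$ as $r\to1^-$. *)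

theory Defs
  imports "HOL-Analysis.Analysis"
begin

text \<open>
  The dimensions $n$ and $m$ are \<open>CARD('n)\<close> and \<open>CARD('m)\<close>.  Finite index types carry no order, so
  the distinguished coordinate (the $n$-th one of $\mathbb{R}^n$, the first one of $\mathbb{R}^m$)
  is a parameter; \<open>axis k 1\<close> is the corresponding standard unit vector.
\<close>

subsection \<open>Partial derivatives, $C^k$ functions, the Laplacian\<close>

definition partial :: "'n \<Rightarrow> (real^'n \<Rightarrow> 'b) \<Rightarrow> real^'n \<Rightarrow> 'b::real_normed_vector"
  where "partial j f x = vector_derivative (\<lambda>t. f (x + t *\<^sub>R axis j 1)) (at 0)"

text \<open>
  To be used on open sets \<open>S\<close>.  Frechet differentiability makes the value of \<open>partial\<close> meaningful; it
  is automatic for functions with continuous partial derivatives, so this is the usual class $C^k(S)$.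
\<close>
primrec Ck_on :: "nat \<Rightarrow> (real^'n) set \<Rightarrow> (real^'n \<Rightarrow> 'b::real_normed_vector) \<Rightarrow> bool"
  where
    "Ck_on 0 S f \<longleftrightarrow> continuous_on S f"
  | "Ck_on (Suc k) S f \<longleftrightarrow> (\<forall>x\<in>S. f differentiable (at x)) \<and> (\<forall>j. Ck_on k S (partial j f))"

definition laplacian :: "(real^'n \<Rightarrow> 'b) \<Rightarrow> real^'n \<Rightarrow> 'b::real_normed_vector"
  where "laplacian f x = (\<Sum>j\<in>UNIV. partial j (partial j f) x)"

subsection \<open>The unit sphere\<close>

text \<open>
  Normalized surface measure: the measure of $A \subseteq S^{n-1}$ is
  $\lambda\{x \in B^n : x/|x| \in A\} / \lambda(B^n)$, the normalized volume of the cone over $A$.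
  The measure space is the sphere itself, so functions need only be well-behaved there.
\<close>
definition sphere_measure :: "(real^'n) measure"
  where "sphere_measure =
    restrict_space (distr (uniform_measure lborel (ball 0 1)) borel sgn) (sphere 0 1)"

text \<open>
  Test functions in $C^\infty(S^{n-1})$: smooth in some neighbourhood of the sphere (only the values
  on the sphere are ever used).
\<close>
definition smooth_on_sphere :: "(real^'n \<Rightarrow> real) \<Rightarrow> bool"
  where "smooth_on_sphere \<psi> \<longleftrightarrow> (\<exists>W. open W \<and> sphere 0 1 \<subseteq> W \<and> (\<forall>k. Ck_on k W \<psi>))"

definition tendsto_distr_sphere ::
    "(real \<Rightarrow> real^'n \<Rightarrow> real^'m) \<Rightarrow> (real^'n \<Rightarrow> real^'m) \<Rightarrow> real filter \<Rightarrow> bool"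
  where "tendsto_distr_sphere h \<phi> F \<longleftrightarrow>
    (\<forall>\<psi>. smooth_on_sphere \<psi> \<longrightarrow>
      ((\<lambda>r. integral\<^sup>L sphere_measure (\<lambda>\<zeta>. \<psi> \<zeta> *\<^sub>R h r \<zeta>)) \<longlongrightarrow>
        integral\<^sup>L sphere_measure (\<lambda>\<zeta>. \<psi> \<zeta> *\<^sub>R \<phi> \<zeta>)) F)"

definition inward_normal_derivative :: "(real^'n \<Rightarrow> real^'m) \<Rightarrow> real^'n \<Rightarrow> real^'m"
  where "inward_normal_derivative G \<zeta> = - vector_derivative (\<lambda>t. G (t *\<^sub>R \<zeta>)) (at 1)"

subsection \<open>The biharmonic Dirichlet problem\<close>

text \<open>
  Classical solutions, with just the regularity needed to read $\Delta(\Delta f)$ pointwise.  The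
  inward normal derivative of \<open>\<lambda>x. f (r *\<^sub>R x)\<close> already contains the factor \<open>r\<close> of
  $r\,\partial f_r/\partial\mathbf{n}$.
\<close>
definition biharmonic_dirichlet_solution ::
    "(real^'n \<Rightarrow> real^'m) \<Rightarrow> (real^'n \<Rightarrow> real^'m) \<Rightarrow> (real^'n \<Rightarrow> real^'m) \<Rightarrow> (real^'n \<Rightarrow> real^'m) \<Rightarrow> bool"
  where "biharmonic_dirichlet_solution g \<phi>1 \<phi>2 f \<longleftrightarrow>
    Ck_on 2 (ball 0 1) f \<and> Ck_on 2 (ball 0 1) (laplacian f) \<and>
    (\<forall>x\<in>ball 0 1. laplacian (laplacian f) x = g x) \<and>
    tendsto_distr_sphere (\<lambda>r \<zeta>. f (r *\<^sub>R \<zeta>)) \<phi>1 (at_left 1) \<and>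
    tendsto_distr_sphere (\<lambda>r. inward_normal_derivative (\<lambda>x. f (r *\<^sub>R x))) \<phi>2 (at_left 1)"

definition H_kernel :: "real^'n \<Rightarrow> real^'n \<Rightarrow> real"
  where "H_kernel x \<zeta> = 1/2 * ((1 - (norm x)\<^sup>2)\<^sup>2 / norm (x - \<zeta>) ^ CARD('n))"

definition K_kernel :: "real^'n \<Rightarrow> real^'n \<Rightarrow> real"
  where "K_kernel x \<zeta> = 1/4 * ((1 - (norm x)\<^sup>2)\<^sup>2 / norm (x - \<zeta>) ^ (CARD('n) + 2)) *
    (real CARD('n) * (1 - (norm x)\<^sup>2) - (real CARD('n) - 4) * (norm (x - \<zeta>))\<^sup>2)"

definition H_op :: "(real^'n \<Rightarrow> real^'m) \<Rightarrow> real^'n \<Rightarrow> real^'m"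
  where "H_op \<phi> x = integral\<^sup>L sphere_measure (\<lambda>\<zeta>. H_kernel x \<zeta> *\<^sub>R \<phi> \<zeta>)"

definition K_op :: "(real^'n \<Rightarrow> real^'m) \<Rightarrow> real^'n \<Rightarrow> real^'m"
  where "K_op \<phi> x = integral\<^sup>L sphere_measure (\<lambda>\<zeta>. K_kernel x \<zeta> *\<^sub>R \<phi> \<zeta>)"

subsection \<open>The extremal functions and the two sides of the estimate\<close>

definition hemisphere_sign :: "'n \<Rightarrow> real^'n \<Rightarrow> real"
  where "hemisphere_sign k \<zeta> =
    indicator {x \<in> sphere 0 1. x $ k \<ge> 0} \<zeta> - indicator {x \<in> sphere 0 1. x $ k \<le> 0} \<zeta>"

definition U :: "'n \<Rightarrow> real^'n \<Rightarrow> real"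
  where "U k x = integral\<^sup>L sphere_measure
    (\<lambda>\<zeta>. (1 - (norm x)\<^sup>2) / norm (x - \<zeta>) ^ CARD('n) * hemisphere_sign k \<zeta>)"

definition U_star :: "'n \<Rightarrow> real^'n \<Rightarrow> real"
  where "U_star k x = integral\<^sup>L sphere_measure
    (\<lambda>\<zeta>. (1 - (norm x)\<^sup>2) ^ 3 / norm (x - \<zeta>) ^ (CARD('n) + 2) * hemisphere_sign k \<zeta>)"

text \<open>$V(t e_k)$ for $0 \le t < 1$, and the radial limit for $t = 1$.\<close>
definition radial_value :: "'n \<Rightarrow> (real^'n \<Rightarrow> real) \<Rightarrow> real \<Rightarrow> real"
  where "radial_value k V t =
    (if t = 1 then Lim (at_left 1) (\<lambda>r. V (r *\<^sub>R axis k 1)) else V (t *\<^sub>R axis k 1))"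

definition extended_value :: "(real^'n \<Rightarrow> real^'m) \<Rightarrow> (real^'n \<Rightarrow> real^'m) \<Rightarrow> real^'n \<Rightarrow> real^'m"
  where "extended_value f \<phi>1 x = (if norm x = 1 then \<phi>1 x else f x)"

definition sup_norm_on :: "'a set \<Rightarrow> ('a \<Rightarrow> 'b::real_normed_vector) \<Rightarrow> real"
  where "sup_norm_on S h = (SUP x\<in>S. norm (h x))"

definition delta1 :: "nat \<Rightarrow> real \<Rightarrow> real"
  where "delta1 n t =
    real n / 4 * ((1 - t\<^sup>2) ^ 3 / (1 + t\<^sup>2) powr ((real n + 2) / 2))
    - (real n - 4) / 4 * ((1 - t\<^sup>2)\<^sup>2 / (1 + t\<^sup>2) powr (real n / 2))"

definition delta2 :: "nat \<Rightarrow> real \<Rightarrow> real"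
  where "delta2 n t = (1 - t\<^sup>2)\<^sup>2 / (1 + t\<^sup>2) powr (real n / 2)"

definition estimate_lhs ::
    "(real^'n \<Rightarrow> real^'m) \<Rightarrow> (real^'n \<Rightarrow> real^'m) \<Rightarrow> (real^'n \<Rightarrow> real^'m) \<Rightarrow> real^'n \<Rightarrow> real"
  where "estimate_lhs \<phi>1 \<phi>2 f x =
    norm (extended_value f \<phi>1 x
      - delta1 CARD('n) (norm x) *\<^sub>R K_op \<phi>1 0
      - delta2 CARD('n) (norm x) *\<^sub>R H_op \<phi>2 0)"

definition estimate_rhs ::
    "'n \<Rightarrow> (real^'n \<Rightarrow> real^'m) \<Rightarrow> (real^'n \<Rightarrow> real^'m) \<Rightarrow> (real^'n \<Rightarrow> real^'m) \<Rightarrow> real^'n \<Rightarrow> real"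
  where "estimate_rhs k g \<phi>1 \<phi>2 x =
    \<bar>real CARD('n) - 4\<bar> / 4 * sup_norm_on (sphere 0 1) \<phi>1 * (1 - (norm x)\<^sup>2) * radial_value k (U k) (norm x)
    + real CARD('n) / 4 * sup_norm_on (sphere 0 1) \<phi>1 * radial_value k (U_star k) (norm x)
    + sup_norm_on (sphere 0 1) \<phi>2 / 2 * (1 - (norm x)\<^sup>2) * radial_value k (U k) (norm x)
    + sup_norm_on (ball 0 1) g / (8 * real CARD('n) * (real CARD('n) + 2)) * (1 - (norm x)\<^sup>2)\<^sup>2"

end

theory Submission
  imports Defs
begin

text \<open>
  Write \<open>\<rho> = 1 - |x|\<^sup>2\<close> and \<open>Z f = (8 - 2 n) f - 4 x \<bullet> \<nabla>f - \<rho> \<Delta>f\<close>.  The biharmonic operator on the ball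
  factors through two second-order operators that obey a minimum principle: \<open>\<Delta> (Z f) = - \<rho> \<Delta>\<^sup>2 f\<close>,
  and \<open>Z f = 8 q - \<rho>\<^sup>2 \<Delta>q\<close> for \<open>q = f / \<rho>\<close>.  On the boundary \<open>Z f\<close> is \<open>(8 - 2 n) \<phi>\<^sub>1 + 4 \<phi>\<^sub>2\<close>, and \<open>Z\<close> maps
  \<open>K[\<phi>\<^sub>1] + H[\<phi>\<^sub>2]\<close> to the Poisson integral of that function.  Comparing \<open>f - K[\<phi>\<^sub>1] - H[\<phi>\<^sub>2]\<close> with
  multiples of \<open>\<rho>\<^sup>2\<close> by means of both minimum principles bounds it by
  \<open>\<parallel>g\<parallel> \<rho>\<^sup>2 / (8 n (n + 2))\<close> without recourse to the biharmonic Green function.  This is done for \<open>f (r x)\<close> with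
  \<open>r < 1\<close>; since \<open>K\<close> and \<open>H\<close> are smooth in \<open>\<zeta>\<close>, the distributional boundary conditions allow \<open>r \<rightarrow> 1\<close>.
  Finally, \<open>|x - \<zeta>|\<^sup>2 \<le> 1 + |x|\<^sup>2\<close> exactly when \<open>x \<bullet> \<zeta> \<ge> 0\<close>, so that the \<open>L\<^sup>1\<close> deviation of each kernel from its
  value on the equator is an integral against the sign of a hemisphere.
\<close>

subsection \<open>The sphere measure\<close>

text \<open>A fourth-order operator has no maximum principle of its own; this is why it is split.
  The coefficients of \<open>Z\<close> are forced. Let L be the Laplacian of f and w that of L. The
  Laplacian of x . grad f is 2 L + x . grad L, and that of \<open>rho\<close> L is
  \<open>rho\<close> w - 2 n L - 4 x . grad L; the factors 4 and 8 - 2 n are exactly those for which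
  all terms in L and x . grad L cancel. In the substitution f = \<open>rho\<close> q the first-order
  terms of q cancel too, so a negative interior minimum of q forces Z f < 0 there. The constant 8 n
  (n + 2) is the bilaplacian of \<open>rho\<close>^2. Regularity is the obstacle. Distributional
  data give no pointwise control of f near the sphere, whereas the comparison needs continuity of f,
  its gradient and its Laplacian up to the sphere; a dilation has it, being regular on a ball of
  radius 1 / r > 1. Moreover only C^2 is given for f and for its Laplacian, and elliptic regularity
  is not invoked, so the Laplacian of x . grad f has to be approached through difference
  quotients.\<close>

lemma emeasure_lborel_unit_ball:
  "0 < emeasure lborel (ball 0 1 :: 'a::euclidean_space set)"
  "emeasure lborel (ball 0 1 :: 'a::euclidean_space set) < \<infinity>"
  using content_ball_pos[of 1 "0::'a"] emeasure_lborel_ball_finite[of "0::'a" 1]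
  by (auto simp: measure_def enn2real_positive_iff)

text \<open>Source of the rotation invariance of the surface measure. The image measure inherits
  translation invariance because T is additive and onto, and it agrees with Lebesgue measure on
  balls about 0, which fixes the factor of proportionality at 1.\<close>

lemma lborel_distr_isometry:
  fixes T :: "'a::euclidean_space \<Rightarrow> 'a"
  assumes T: "orthogonal_transformation T"
  shows "distr lborel borel T = lborel"
proof (rule measure_eqI)
  have contT: "continuous_on UNIV T"
    using T linear_continuous_on linear_conv_bounded_linear orthogonal_transformation_linear by blast
  then have meas[measurable]: "T \<in> borel \<rightarrow>\<^sub>M borel"
    by (rule borel_measurable_continuous_onI)
  have addT: "T (x + y) = T x + T y" for x y
    using T by (simp add: linear_add orthogonal_transformation_linear)
  have normT: "norm (T x) = norm x" for x
    using T by (rule orthogonal_transformation_norm)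
  \<comment> \<open>A right inverse of T: a translation by y after T is a translation by
    \<open>z y\<close> before T.\<close>
  obtain z where z: "T (z y) = y" for y
    using orthogonal_transformation_surj[OF T] by (metis surjD)
  define \<mu> where "\<mu> = distr lborel borel T"
  have sets\<mu>[simp, measurable_cong]: "sets \<mu> = sets borel" and space\<mu>[simp]: "space \<mu> = UNIV"
    by (simp_all add: \<mu>_def)
  define B :: "'a set" where "B = ball 0 1"
  have B[measurable]: "B \<in> sets borel" by (simp add: B_def)
  have \<mu>ball: "emeasure \<mu> (ball 0 r) = emeasure lborel (ball 0 r :: 'a set)" for r
  proof -
    have "T -` ball 0 r = ball 0 r" by (auto simp: normT)
    then show ?thesis by (simp add: \<mu>_def emeasure_distr)
  qed
  have fin: "emeasure lborel (ball 0 r :: 'a set) < \<infinity>" for r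
    using emeasure_bounded_finite bounded_ball by blast
  have \<mu>sf: "sigma_finite_measure \<mu>"
  proof (rule sigma_finite_measure.intro, intro exI conjI)
    show "countable (range (\<lambda>i::nat. ball (0::'a) (real i)))" by simp
    show "\<Union> (range (\<lambda>i::nat. ball (0::'a) (real i))) = space \<mu>"
      by (auto simp: reals_Archimedean2)
    show "\<forall>a\<in>range (\<lambda>i::nat. ball (0::'a) (real i)). emeasure \<mu> a \<noteq> \<infinity>"
      using fin by (auto simp: \<mu>ball less_top)
  qed auto
  interpret \<mu>: sigma_finite_measure \<mu> by (rule \<mu>sf)
  interpret P: pair_sigma_finite \<mu> lborel by unfold_locales
  have transl: "(\<integral>\<^sup>+x. f (y + x) \<partial>\<mu>) = (\<integral>\<^sup>+x. f x \<partial>\<mu>)" if [measurable]: "f \<in> borel_measurable borel"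
    for f :: "'a \<Rightarrow> ennreal" and y
  proof -
    have "(\<integral>\<^sup>+x. f (y + x) \<partial>\<mu>) = (\<integral>\<^sup>+x. f (T (z y + x)) \<partial>lborel)"
      by (simp add: \<mu>_def nn_integral_distr addT z)
    also have "\<dots> = (\<integral>\<^sup>+x. f (T x) \<partial>distr lborel borel ((+) (z y)))"
      by (simp add: nn_integral_distr)
    also have "\<dots> = (\<integral>\<^sup>+x. f x \<partial>\<mu>)"
      by (simp add: lborel_distr_plus \<mu>_def nn_integral_distr)
    finally show ?thesis .
  qed
  have translL: "(\<integral>\<^sup>+x. f (y + x) \<partial>lborel) = (\<integral>\<^sup>+x. f x \<partial>lborel)" if [measurable]: "f \<in> borel_measurable borel"
    for f :: "'a \<Rightarrow> ennreal" and y
  proof -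
    have "(\<integral>\<^sup>+x. f (y + x) \<partial>lborel) = (\<integral>\<^sup>+x. f x \<partial>distr lborel borel ((+) y))"
      by (simp add: nn_integral_distr)
    then show ?thesis by (simp add: lborel_distr_plus)
  qed
  have reflL: "(\<integral>\<^sup>+x. f (y - x) \<partial>lborel) = (\<integral>\<^sup>+x. f x \<partial>lborel)" if [measurable]: "f \<in> borel_measurable borel"
    for f :: "'a \<Rightarrow> ennreal" and y
  proof -
    have neg: "distr lborel borel uminus = (lborel :: 'a measure)"
      using lborel_affine[of "-1" "0::'a"] by (simp add: density_1)
    have "(\<integral>\<^sup>+x. f (y - x) \<partial>lborel) = (\<integral>\<^sup>+x. f (y + x) \<partial>distr lborel borel uminus)"
      by (simp add: nn_integral_distr)
    also have "\<dots> = (\<integral>\<^sup>+x. f x \<partial>lborel)"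
      unfolding neg by (rule translL) fact
    finally show ?thesis .
  qed
  fix A assume "A \<in> sets (distr lborel borel T)"
  then have A[measurable]: "A \<in> sets borel" by simp
  \<comment> \<open>Two translation invariant measures are proportional: compute
      \<open>\<integral>\<integral> 1\<^sub>A(x) 1\<^sub>B(x + y) d\<mu>(x) dy\<close> in both orders.\<close>
  have "emeasure \<mu> A * emeasure lborel B = (\<integral>\<^sup>+x. indicator A x * emeasure lborel B \<partial>\<mu>)"
    by (simp add: nn_integral_multc)
  also have "\<dots> = (\<integral>\<^sup>+x. indicator A x * (\<integral>\<^sup>+y. indicator B (x + y) \<partial>lborel) \<partial>\<mu>)"
    by (subst translL) auto
  also have "\<dots> = (\<integral>\<^sup>+x. \<integral>\<^sup>+y. indicator A x * indicator B (x + y) \<partial>lborel \<partial>\<mu>)"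
    by (simp add: nn_integral_cmult)
  also have "\<dots> = (\<integral>\<^sup>+y. \<integral>\<^sup>+x. indicator A x * indicator B (x + y) \<partial>\<mu> \<partial>lborel)"
    by (rule P.Fubini'[symmetric]) measurable
  also have "\<dots> = (\<integral>\<^sup>+y. \<integral>\<^sup>+x. indicator A (x - y) * indicator B x \<partial>\<mu> \<partial>lborel)"
  proof (rule nn_integral_cong)
    fix y :: 'a
    show "(\<integral>\<^sup>+x. indicator A x * indicator B (x + y) \<partial>\<mu>)
        = (\<integral>\<^sup>+x. indicator A (x - y) * (indicator B x :: ennreal) \<partial>\<mu>)"
      using transl[of "\<lambda>x. indicator A x * indicator B (x + y)" "- y"] by simp
  qed
  also have "\<dots> = (\<integral>\<^sup>+x. \<integral>\<^sup>+y. indicator A (x - y) * indicator B x \<partial>lborel \<partial>\<mu>)"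
    by (rule P.Fubini') measurable
  also have "\<dots> = (\<integral>\<^sup>+x. indicator B x * emeasure lborel A \<partial>\<mu>)"
  proof (rule nn_integral_cong)
    fix x :: 'a
    have "(\<integral>\<^sup>+y. indicator A (x - y) * (indicator B x :: ennreal) \<partial>lborel)
        = (\<integral>\<^sup>+y. indicator A (x - y) \<partial>lborel) * indicator B x"
      by (intro nn_integral_multc) measurable
    also have "(\<integral>\<^sup>+y. indicator A (x - y) \<partial>lborel) = emeasure lborel A"
      using reflL[of "indicator A" x] by simp
    finally show "(\<integral>\<^sup>+y. indicator A (x - y) * indicator B x \<partial>lborel) = indicator B x * emeasure lborel A"
      by (simp add: mult.commute)
  qed
  also have "\<dots> = emeasure lborel A * emeasure lborel B"
    using \<mu>ball[of 1] by (subst nn_integral_multc) (measurable, auto simp: B_def mult.commute)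
  finally have "emeasure \<mu> A * emeasure lborel B = emeasure lborel A * emeasure lborel B" .
  moreover have "emeasure lborel B \<noteq> 0" "emeasure lborel B \<noteq> \<infinity>"
    using emeasure_lborel_unit_ball[where 'a='a] by (auto simp: B_def less_top)
  ultimately show "emeasure (distr lborel borel T) A = emeasure lborel A"
    unfolding \<mu>_def[symmetric] by (metis infinity_ennreal_def mult_divide_eq_ennreal)
qed simp

lemma space_sphere_measure [simp]: "space sphere_measure = sphere 0 1"
  by (simp add: sphere_measure_def space_restrict_space)

lemma sets_sphere_measure [measurable_cong]:
  "sets (sphere_measure :: (real^'n) measure) = sets (restrict_space borel (sphere 0 1))"
  by (simp add: sphere_measure_def sets_restrict_space)

lemma sgn_orthogonal_transformation:
  "orthogonal_transformation T \<Longrightarrow> sgn (T x) = T (sgn x)"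
  by (simp add: sgn_div_norm linear_scale orthogonal_transformation_linear orthogonal_transformation_norm)


lemma emeasure_sphere_measure_space:
  "emeasure (sphere_measure :: (real^'n) measure) (sphere 0 1) = 1"
proof -
  let ?B = "ball 0 1 :: (real^'n) set"
  note pos = emeasure_lborel_unit_ball(1)[where 'a="real^'n"] and fin = emeasure_lborel_unit_ball(2)[where 'a="real^'n"]
  have "emeasure sphere_measure (sphere 0 1 :: (real^'n) set)
      = emeasure (distr (uniform_measure lborel ?B) borel sgn) (sphere 0 1)"
    unfolding sphere_measure_def by (subst emeasure_restrict_space) auto
  also have "\<dots> = emeasure (uniform_measure lborel ?B) (sgn -` sphere 0 1)"
    by (subst emeasure_distr) (auto intro!: borel_measurable_sgn)
  also have "\<dots> = emeasure lborel (?B \<inter> sgn -` sphere 0 1) / emeasure lborel ?B"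
    using measurable_sets[of sgn borel borel "sphere 0 1 :: (real^'n) set"]
    by (subst emeasure_uniform_measure) auto
  \<comment> \<open>Since \<open>sgn 0 = 0\<close> is not on the sphere, the origin is lost; it is a
    null set.\<close>
  also have "?B \<inter> sgn -` sphere 0 1 = ?B - {0}"
    by (auto simp: norm_sgn)
  also have "emeasure lborel (?B - {0}) = emeasure lborel ?B"
    by (rule emeasure_Diff_null_set) (auto simp: null_sets_def)
  finally show ?thesis using pos fin by (simp add: ennreal_divide_self less_top)
qed

lemma finite_measure_sphere_measure: "finite_measure (sphere_measure :: (real^'n) measure)"
  by (rule finite_measureI) (simp add: emeasure_sphere_measure_space)

lemma measure_sphere_measure_space [simp]:
  "measure (sphere_measure :: (real^'n) measure) (sphere 0 1) = 1"
  by (simp add: measure_def emeasure_sphere_measure_space)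

lemma measurable_sphere_measureI:
  assumes "continuous_on (sphere 0 1) f"
  shows "f \<in> borel_measurable (sphere_measure :: (real^'n) measure)"
  using borel_measurable_continuous_on_restrict[OF assms] measurable_cong_sets sets_sphere_measure by blast

lemma integrable_sphere_measure_bounded:
  fixes f :: "real^'n \<Rightarrow> 'b::{banach, second_countable_topology}"
  assumes "f \<in> borel_measurable sphere_measure" and "\<And>\<zeta>. \<zeta> \<in> sphere 0 1 \<Longrightarrow> norm (f \<zeta>) \<le> B"
  shows "integrable sphere_measure f"
proof (rule finite_measure.integrable_const_bound[OF finite_measure_sphere_measure _ assms(1)])
  show "AE x in sphere_measure. norm (f x) \<le> B"
    using assms(2) by (intro AE_I2) simp
qed

lemma integrable_sphere_measure_continuous:
  fixes f :: "real^'n \<Rightarrow> 'b::{banach, second_countable_topology}"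
  assumes "continuous_on (sphere 0 1) f"
  shows "integrable sphere_measure f"
proof -
  have "bounded (f ` sphere 0 1)"
    using compact_continuous_image[OF assms compact_sphere] compact_imp_bounded by blast
  then obtain B where "\<And>\<zeta>. \<zeta> \<in> sphere 0 1 \<Longrightarrow> norm (f \<zeta>) \<le> B"
    by (metis bounded_iff imageI)
  then show ?thesis
    using integrable_sphere_measure_bounded measurable_sphere_measureI[OF assms] by blast
qed

lemma integral_sphere_measure_norm_le:
  fixes f :: "real^'n \<Rightarrow> 'b::{banach, second_countable_topology}"
  assumes "\<And>\<zeta>. \<zeta> \<in> sphere 0 1 \<Longrightarrow> norm (f \<zeta>) \<le> B" "B \<ge> 0"
  shows "norm (\<integral>\<zeta>. f \<zeta> \<partial>sphere_measure) \<le> B"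
proof (cases "integrable sphere_measure f")
  case True
  have "norm (\<integral>\<zeta>. f \<zeta> \<partial>sphere_measure) \<le> (\<integral>\<zeta>. norm (f \<zeta>) \<partial>sphere_measure)"
    by simp
  also have "\<dots> \<le> (\<integral>\<zeta>. B \<partial>(sphere_measure :: (real^'n) measure))"
    using True assms(1)
    by (intro integral_mono) (auto simp: finite_measure.integrable_const finite_measure_sphere_measure)
  finally show ?thesis by simp
\<comment> \<open>The integral of a non-integrable function is 0 by convention, which is where
  \<open>B \<ge> 0\<close> enters.\<close>
qed (simp add: not_integrable_integral_eq assms(2))

text \<open>The integral is lifted to the unit ball along \<open>sgn\<close>, which commutes with T;
  there the invariance of Lebesgue measure and of the ball applies. As f is measurable on the sphere
  only, the lifted integrand carries the indicator of the sphere.\<close>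

lemma integral_sphere_measure_orthogonal:
  fixes T :: "real^'n \<Rightarrow> real^'n" and f :: "real^'n \<Rightarrow> 'b::{banach, second_countable_topology}"
  assumes T: "orthogonal_transformation T" and f: "f \<in> borel_measurable sphere_measure"
  shows "(\<integral>\<zeta>. f (T \<zeta>) \<partial>sphere_measure) = (\<integral>\<zeta>. f \<zeta> \<partial>sphere_measure)"
proof -
  let ?B = "ball 0 1 :: (real^'n) set"
  let ?D = "distr (uniform_measure lborel ?B) borel (sgn :: real^'n \<Rightarrow> _)"
  let ?S = "sphere 0 1 :: (real^'n) set"
  have contT: "continuous_on UNIV T"
    using T linear_continuous_on linear_conv_bounded_linear orthogonal_transformation_linear by blast
  then have T_meas[measurable]: "T \<in> borel \<rightarrow>\<^sub>M borel"
    by (rule borel_measurable_continuous_onI)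
  have sgn_meas[measurable]: "sgn \<in> borel_measurable (borel :: (real^'n) measure)"
    by simp
  have normT: "norm (T x) = norm x" for x
    using T by (rule orthogonal_transformation_norm)
  have fm: "(\<lambda>x. indicator ?S x *\<^sub>R f x) \<in> borel_measurable borel"
    using f measurable_cong_sets[OF sets_sphere_measure refl]
    by (subst borel_measurable_restrict_space_iff[symmetric]) auto
  note [measurable] = fm
  have lift: "(\<integral>\<zeta>. g \<zeta> \<partial>sphere_measure) = (\<integral>x. indicator ?S (sgn x) *\<^sub>R g (sgn x) \<partial>uniform_measure lborel ?B)"
    if [measurable]: "(\<lambda>x. indicator ?S x *\<^sub>R g x) \<in> borel_measurable borel" for g :: "real^'n \<Rightarrow> 'b"
    unfolding sphere_measure_def by (subst integral_restrict_space) (auto simp: integral_distr)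
  have unif: "distr (uniform_measure lborel ?B) borel T = uniform_measure lborel ?B"
  proof (rule measure_eqI)
    fix A assume "A \<in> sets (distr (uniform_measure lborel ?B) borel T)"
    then have A[measurable]: "A \<in> sets borel" by simp
    have "?B \<inter> T -` A = T -` (?B \<inter> A)" by (auto simp: normT)
    then have "emeasure lborel (?B \<inter> T -` A) = emeasure (distr lborel borel T) (?B \<inter> A)"
      by (simp add: emeasure_distr)
    then show "emeasure (distr (uniform_measure lborel ?B) borel T) A = emeasure (uniform_measure lborel ?B) A"
      using measurable_sets[OF T_meas A]
      by (simp add: emeasure_distr lborel_distr_isometry[OF T])
  qed simp
  have gm: "(\<lambda>x. indicator ?S x *\<^sub>R f (T x)) \<in> borel_measurable borel"
  proof -
    have "(\<lambda>x. indicator ?S (T x) *\<^sub>R f (T x)) \<in> borel_measurable borel" by measurable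
    then show ?thesis by (simp add: indicator_def normT)
  qed
  have "(\<integral>\<zeta>. f (T \<zeta>) \<partial>sphere_measure)
      = (\<integral>x. indicator ?S (sgn (T x)) *\<^sub>R f (sgn (T x)) \<partial>uniform_measure lborel ?B)"
    by (subst lift[OF gm]) (simp add: indicator_def sgn_orthogonal_transformation[OF T] normT)
  also have "\<dots> = (\<integral>x. indicator ?S (sgn x) *\<^sub>R f (sgn x) \<partial>distr (uniform_measure lborel ?B) borel T)"
    by (subst integral_distr) auto
  also have "\<dots> = (\<integral>\<zeta>. f \<zeta> \<partial>sphere_measure)"
    by (simp add: unif lift[OF fm])
  finally show ?thesis .
qed

subsection \<open>Gradients, Laplacians and the minimum principle\<close>

text \<open>
  \<open>L\<close> is the Laplacian of \<open>f\<close>; carrying it along with the gradient \<open>G\<close> turns Laplacians of products and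
  compositions into rules instead of computations with iterated partial derivatives.
\<close>
definition glap :: "(real^'n) set \<Rightarrow> (real^'n \<Rightarrow> real) \<Rightarrow> (real^'n \<Rightarrow> real^'n) \<Rightarrow> (real^'n \<Rightarrow> real) \<Rightarrow> bool"
  where "glap S f G L \<longleftrightarrow> (\<forall>x\<in>S. (f has_derivative (\<lambda>h. G x \<bullet> h)) (at x) \<and>
    (\<exists>D. (G has_derivative D) (at x) \<and> (\<Sum>j\<in>UNIV. D (axis j 1) $ j) = L x))"

lemma glapI:
  assumes "\<And>x. x \<in> S \<Longrightarrow> (f has_derivative (\<lambda>h. G x \<bullet> h)) (at x)"
    and "\<And>x. x \<in> S \<Longrightarrow> (G has_derivative D x) (at x)"
    and "\<And>x. x \<in> S \<Longrightarrow> (\<Sum>j\<in>UNIV. D x (axis j 1) $ j) = L x"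
  shows "glap S f G L"
  using assms unfolding glap_def by blast

lemma glapD:
  assumes "glap S f G L" "x \<in> S"
  obtains D where "(f has_derivative (\<lambda>h. G x \<bullet> h)) (at x)" "(G has_derivative D) (at x)"
    "(\<Sum>j\<in>UNIV. D (axis j 1) $ j) = L x"
  using assms unfolding glap_def by blast

lemma glap_deriv: "glap S f G L \<Longrightarrow> x \<in> S \<Longrightarrow> (f has_derivative (\<lambda>h. G x \<bullet> h)) (at x)"
  unfolding glap_def by blast

lemma glap_continuous:
  assumes "glap S f G L"
  shows "continuous_on S f" "continuous_on S G"
proof -
  show "continuous_on S f"
    using glap_deriv[OF assms] by (meson continuous_at_imp_continuous_on has_derivative_continuous)
  show "continuous_on S G"
    using assms unfolding glap_def
    by (meson continuous_at_imp_continuous_on has_derivative_continuous)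
qed

lemma glap_subset: "glap S f G L \<Longrightarrow> T \<subseteq> S \<Longrightarrow> glap T f G L"
  unfolding glap_def by blast

lemma glap_eq:
  "glap S f G L \<Longrightarrow> (\<And>x. f x = f' x) \<Longrightarrow> (\<And>x. G x = G' x) \<Longrightarrow> (\<And>x. x \<in> S \<Longrightarrow> L x = L' x) \<Longrightarrow> glap S f' G' L'"
proof -
  assume a: "glap S f G L" "\<And>x. f x = f' x" "\<And>x. G x = G' x" "\<And>x. x \<in> S \<Longrightarrow> L x = L' x"
  have "f' = f" using a(2) by (simp add: fun_eq_iff)
  moreover have "G' = G" using a(3) by (simp add: fun_eq_iff)
  ultimately show ?thesis using a(1,4) by (simp add: glap_def)
qed

text \<open>The trace of the rank-one map that sends h to (a . h) b; it yields the cross term in the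
  product rule for Laplacians.\<close>

lemma sum_axis_component: "(\<Sum>j\<in>UNIV. (a \<bullet> axis j 1) * (b $ j)) = a \<bullet> (b :: real^'n)"
  by (simp add: inner_axis inner_vec_def[of a])

lemma glap_const: "glap S (\<lambda>x. c) (\<lambda>x. 0) (\<lambda>x. 0)"
  by (rule glapI[where D="\<lambda>_ _. 0"]) auto

lemma glap_add:
  assumes "glap S f G L" "glap S f' G' L'"
  shows "glap S (\<lambda>x. f x + f' x) (\<lambda>x. G x + G' x) (\<lambda>x. L x + L' x)"
  unfolding glap_def
proof (intro ballI conjI)
  fix x assume x: "x \<in> S"
  obtain D where D: "(f has_derivative (\<lambda>h. G x \<bullet> h)) (at x)" "(G has_derivative D) (at x)"
    "(\<Sum>j\<in>UNIV. D (axis j 1) $ j) = L x" using glapD[OF assms(1) x] .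
  obtain D' where D': "(f' has_derivative (\<lambda>h. G' x \<bullet> h)) (at x)" "(G' has_derivative D') (at x)"
    "(\<Sum>j\<in>UNIV. D' (axis j 1) $ j) = L' x" using glapD[OF assms(2) x] .
  show "((\<lambda>x. f x + f' x) has_derivative (\<lambda>h. (G x + G' x) \<bullet> h)) (at x)"
    using has_derivative_add[OF D(1) D'(1)] by (simp add: inner_add_left)
  show "\<exists>D. ((\<lambda>x. G x + G' x) has_derivative D) (at x) \<and> (\<Sum>j\<in>UNIV. D (axis j 1) $ j) = L x + L' x"
    using has_derivative_add[OF D(2) D'(2)] D(3) D'(3)
    by (intro exI[of _ "\<lambda>h. D h + D' h"]) (simp add: sum.distrib)
qed

lemma glap_mult:
  assumes "glap S f G L" "glap S f' G' L'"
  shows "glap S (\<lambda>x. f x * f' x) (\<lambda>x. f x *\<^sub>R G' x + f' x *\<^sub>R G x)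
    (\<lambda>x. f x * L' x + f' x * L x + 2 * (G x \<bullet> G' x))"
  unfolding glap_def
proof (intro ballI conjI)
  fix x assume x: "x \<in> S"
  obtain D where D: "(f has_derivative (\<lambda>h. G x \<bullet> h)) (at x)" "(G has_derivative D) (at x)"
    "(\<Sum>j\<in>UNIV. D (axis j 1) $ j) = L x" using glapD[OF assms(1) x] .
  obtain D' where D': "(f' has_derivative (\<lambda>h. G' x \<bullet> h)) (at x)" "(G' has_derivative D') (at x)"
    "(\<Sum>j\<in>UNIV. D' (axis j 1) $ j) = L' x" using glapD[OF assms(2) x] .
  show "((\<lambda>x. f x * f' x) has_derivative (\<lambda>h. (f x *\<^sub>R G' x + f' x *\<^sub>R G x) \<bullet> h)) (at x)"
    using has_derivative_mult[OF D(1) D'(1)] by (simp add: inner_add_left mult.commute)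
  define E where "E h = (f x *\<^sub>R D' h + (G x \<bullet> h) *\<^sub>R G' x) + (f' x *\<^sub>R D h + (G' x \<bullet> h) *\<^sub>R G x)" for h
  have "((\<lambda>x. f x *\<^sub>R G' x + f' x *\<^sub>R G x) has_derivative E) (at x)"
    unfolding E_def by (rule derivative_eq_intros D D' refl)+
  moreover have "(\<Sum>j\<in>UNIV. E (axis j 1) $ j) = f x * L' x + f' x * L x + 2 * (G x \<bullet> G' x)"
    by (simp add: E_def sum.distrib D(3)[symmetric] D'(3)[symmetric] sum_distrib_left[symmetric]
        sum_axis_component inner_commute)
  ultimately show "\<exists>E. ((\<lambda>x. f x *\<^sub>R G' x + f' x *\<^sub>R G x) has_derivative E) (at x) \<and>
      (\<Sum>j\<in>UNIV. E (axis j 1) $ j) = f x * L' x + f' x * L x + 2 * (G x \<bullet> G' x)" by blast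
qed

lemma glap_cmult:
  assumes "glap S f G L"
  shows "glap S (\<lambda>x. c * f x) (\<lambda>x. c *\<^sub>R G x) (\<lambda>x. c * L x)"
  using glap_mult[OF glap_const[of S c] assms] by simp

lemma glap_diff:
  assumes "glap S f G L" "glap S f' G' L'"
  shows "glap S (\<lambda>x. f x - f' x) (\<lambda>x. G x - G' x) (\<lambda>x. L x - L' x)"
  using glap_add[OF assms(1) glap_cmult[OF assms(2), of "-1"]] by simp

lemma glap_compose_scaleR:
  assumes "glap S f G L" "\<And>x. x \<in> T \<Longrightarrow> r *\<^sub>R x \<in> S"
  shows "glap T (\<lambda>x. f (r *\<^sub>R x)) (\<lambda>x. r *\<^sub>R G (r *\<^sub>R x)) (\<lambda>x. r\<^sup>2 * L (r *\<^sub>R x))"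
  unfolding glap_def
proof (intro ballI conjI)
  fix x assume x: "x \<in> T"
  obtain D where D: "(f has_derivative (\<lambda>h. G (r *\<^sub>R x) \<bullet> h)) (at (r *\<^sub>R x))" "(G has_derivative D) (at (r *\<^sub>R x))"
    "(\<Sum>j\<in>UNIV. D (axis j 1) $ j) = L (r *\<^sub>R x)" using glapD[OF assms(1) assms(2)[OF x]] .
  have s: "((\<lambda>x. r *\<^sub>R x) has_derivative (\<lambda>h. r *\<^sub>R h)) (at x)"
    by (auto intro: derivative_eq_intros)
  show "((\<lambda>x. f (r *\<^sub>R x)) has_derivative (\<lambda>h. (r *\<^sub>R G (r *\<^sub>R x)) \<bullet> h)) (at x)"
    using has_derivative_compose[OF s D(1)] by simp
  have lin: "linear D" using D(2) has_derivative_linear by blast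
  have "((\<lambda>x. r *\<^sub>R G (r *\<^sub>R x)) has_derivative (\<lambda>h. r *\<^sub>R D (r *\<^sub>R h))) (at x)"
    using has_derivative_scaleR_right[OF has_derivative_compose[OF s D(2)]] by simp
  moreover have "(\<Sum>j\<in>UNIV. (r *\<^sub>R D (r *\<^sub>R axis j 1)) $ j) = r\<^sup>2 * L (r *\<^sub>R x)"
    by (simp add: linear_scale[OF lin] D(3)[symmetric] sum_distrib_left power2_eq_square mult.assoc)
  ultimately show "\<exists>D. ((\<lambda>x. r *\<^sub>R G (r *\<^sub>R x)) has_derivative D) (at x)
      \<and> (\<Sum>j\<in>UNIV. D (axis j 1) $ j) = r\<^sup>2 * L (r *\<^sub>R x)" by blast
qed

abbreviation rho :: "real^'n \<Rightarrow> real"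
  where "rho x \<equiv> 1 - (norm x)\<^sup>2"

lemma glap_rho: "glap S rho (\<lambda>x :: real^'n. (-2) *\<^sub>R x) (\<lambda>x. - 2 * real CARD('n))"
proof (rule glapI[where D="\<lambda>x h. (-2) *\<^sub>R h"])
  fix x :: "real^'n"
  show "(rho has_derivative (\<lambda>h. ((-2) *\<^sub>R x) \<bullet> h)) (at x)"
    unfolding power2_norm_eq_inner
    by (rule derivative_eq_intros refl)+ (simp add: inner_commute)
  show "((\<lambda>x. (-2) *\<^sub>R x) has_derivative (\<lambda>h. (-2) *\<^sub>R h)) (at x)"
    using bounded_linear.has_derivative[OF bounded_linear_scaleR_right[of "-2"] has_derivative_ident] by simp
qed simp

text \<open>By |x|^2 = 1 - \<open>rho\<close> the Laplacians of powers of \<open>rho\<close> become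
  polynomials in \<open>rho\<close> alone, which keeps the later identities within reach of
  polynomial algebra.\<close>

lemma glap_rho2: "glap S (\<lambda>x::real^'n. (rho x)\<^sup>2) (\<lambda>x. (-4 * rho x) *\<^sub>R x)
   (\<lambda>x. 8 - (4 * real CARD('n) + 8) * rho x)"
  by (rule glap_eq[OF glap_mult[OF glap_rho glap_rho]])
    (simp_all add: power2_eq_square vec_eq_iff algebra_simps dot_square_norm)

lemma glap_rho3: "glap S (\<lambda>x::real^'n. (rho x)^3) (\<lambda>x. (-6 * (rho x)\<^sup>2) *\<^sub>R x)
   (\<lambda>x. 24 * rho x - (6 * real CARD('n) + 24) * (rho x)\<^sup>2)"
  by (rule glap_eq[OF glap_mult[OF glap_rho glap_rho2]])
    (simp_all add: power2_eq_square power3_eq_cube vec_eq_iff algebra_simps dot_square_norm)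

text \<open>If a diagonal entry of the derivative of G were negative at x, then the j-th component
  of G, which vanishes at x, would be negative just beyond x in direction j, and the mean value
  theorem would give a smaller value of f. This asks for differentiability of G at x only, not for a
  second-order Taylor expansion.\<close>

lemma glap_local_min:
  assumes gl: "glap S f G L" and S: "open S" "x \<in> S" and min: "\<And>y. y \<in> S \<Longrightarrow> f x \<le> f y"
  shows "G x = 0" "L x \<ge> 0"
proof -
  obtain D where D: "(f has_derivative (\<lambda>h. G x \<bullet> h)) (at x)" "(G has_derivative D) (at x)"
    "(\<Sum>j\<in>UNIV. D (axis j 1) $ j) = L x" using glapD[OF gl S(2)] .
  have "(\<lambda>h. G x \<bullet> h) = (\<lambda>h. 0)"
    using differential_zero_maxmin[OF S(2,1) D(1)] min by blast
  then show Gx: "G x = 0" by (metis inner_eq_zero_iff)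
  obtain e where e: "e > 0" "ball x e \<subseteq> S" using S openE by blast
  have "D (axis j 1) $ j \<ge> 0" for j
  proof (rule ccontr)
    assume neg: "\<not> D (axis j 1) $ j \<ge> 0"
    define \<phi> where "\<phi> t = G (x + t *\<^sub>R axis j 1) $ j" for t
    have \<phi>0: "\<phi> 0 = 0" using Gx by (simp add: \<phi>_def)
    have lin: "linear D" using D(2) has_derivative_linear by blast
    have path: "((\<lambda>t. x + t *\<^sub>R axis j 1) has_derivative (\<lambda>t. t *\<^sub>R axis j 1)) (at t)" for t :: real
      by (auto intro!: derivative_eq_intros)
    have "((\<lambda>t. G (x + t *\<^sub>R axis j 1)) has_derivative (\<lambda>t. D (t *\<^sub>R axis j 1))) (at 0)"
      using has_derivative_compose[OF path[of 0], of G D] D(2) by simp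
    then have "(\<phi> has_derivative (\<lambda>t. D (t *\<^sub>R axis j 1) $ j)) (at 0)"
      unfolding \<phi>_def by (rule bounded_linear.has_derivative[OF bounded_linear_vec_nth])
    then have "(\<phi> has_real_derivative D (axis j 1) $ j) (at 0)"
      by (simp add: has_field_derivative_def linear_scale[OF lin] mult_commute_abs)
    then obtain d where d: "d > 0" "\<And>h. 0 < h \<Longrightarrow> h < d \<Longrightarrow> \<phi> (0 + h) < \<phi> 0"
      using DERIV_neg_dec_right[of \<phi> "D (axis j 1) $ j" 0] neg by force
    define \<tau> where "\<tau> = min d e / 2"
    have \<tau>: "0 < \<tau>" "\<tau> < d" "\<tau> < e" using d(1) e(1) by (auto simp: \<tau>_def)
    have inS: "x + t *\<^sub>R axis j 1 \<in> S" if "0 \<le> t" "t \<le> \<tau>" for t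
      using that \<tau> e(2) by (intro subsetD[OF e(2)]) (auto simp: dist_norm)
    have der: "((\<lambda>t. f (x + t *\<^sub>R axis j 1)) has_real_derivative \<phi> t) (at t)" if "0 \<le> t" "t \<le> \<tau>" for t
      using has_derivative_compose[OF path glap_deriv[OF gl inS[OF that]]]
      by (simp add: has_field_derivative_def \<phi>_def inner_axis mult_commute_abs)
    obtain \<xi> where \<xi>: "0 < \<xi>" "\<xi> < \<tau>"
      and eq: "f (x + \<tau> *\<^sub>R axis j 1) - f (x + 0 *\<^sub>R axis j 1) = (\<tau> - 0) * \<phi> \<xi>"
      using MVT2[OF \<tau>(1), of "\<lambda>t. f (x + t *\<^sub>R axis j 1)" \<phi>] der by blast
    have "\<phi> \<xi> < 0" using d(2)[of \<xi>] \<xi> \<tau> \<phi>0 by simp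
    then have "\<tau> * \<phi> \<xi> < 0" using \<tau>(1) by (simp add: mult_pos_neg)
    then show False using eq min[OF inS[of \<tau>]] \<tau>(1) by simp
  qed
  then show "L x \<ge> 0" unfolding D(3)[symmetric] by (rule sum_nonneg)
qed

lemma superharmonic_min_strict:
  assumes gl: "glap (ball 0 s) f G L" and c: "continuous_on (cball 0 s) f"
    and neg: "\<And>x. x \<in> ball 0 s \<Longrightarrow> L x < 0" and bd: "\<And>x. norm x = s \<Longrightarrow> f x \<ge> B"
    and x: "x \<in> cball 0 s"
  shows "f x \<ge> B"
proof -
  obtain y where y: "y \<in> cball 0 s" "\<And>z. z \<in> cball 0 s \<Longrightarrow> f y \<le> f z"
    using continuous_attains_inf[OF compact_cball _ c] x by blast
  have "norm y = s"
  proof (rule ccontr)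
    assume "norm y \<noteq> s"
    then have "y \<in> ball 0 s" using y(1) by auto
    then show False using glap_local_min(2)[OF gl open_ball] y(2) neg
      by (meson ball_subset_cball linorder_not_less subsetD)
  qed
  then show ?thesis using bd[of y] y(2)[OF x] by linarith
qed

text \<open>Adding (d + e) \<open>rho\<close> makes the Laplacian strictly negative, since that of
  \<open>rho\<close> is -2 n. As \<open>rho\<close> lies between 0 and 1 on the closed unit ball,
  this does not lower the boundary values and costs at most d + e inside. The tolerance d serves
  difference quotients, whose Laplacians are nonpositive only up to an error.\<close>

lemma superharmonic_min:
  fixes f :: "real^'n \<Rightarrow> real"
  assumes gl: "glap (ball 0 s) f G L" and c: "continuous_on (cball 0 s) f" and s: "0 \<le> s" "s \<le> 1"
    and neg: "\<And>x. x \<in> ball 0 s \<Longrightarrow> L x \<le> d" and d: "d \<ge> 0"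
    and bd: "\<And>x. norm x = s \<Longrightarrow> f x \<ge> B"
    and x: "x \<in> cball 0 s"
  shows "f x \<ge> B - d"
proof (rule field_le_epsilon)
  fix e :: real assume e: "e > 0"
  let ?N = "real CARD('n)"
  have N: "?N \<ge> 1" by (simp add: Suc_leI)
  let ?f = "\<lambda>x. f x + (d + e) * rho x"
  have "?f x \<ge> B"
  proof (rule superharmonic_min_strict[OF glap_add[OF gl glap_cmult[OF glap_rho]] _ _ _ x])
    show "continuous_on (cball 0 s) ?f" using c by (intro continuous_intros)
    fix y :: "real^'n" assume y: "y \<in> ball 0 s"
    have "(d + e) * 2 \<le> (d + e) * (2 * ?N)" using d e N by (intro mult_left_mono) auto
    then show "L y + (d + e) * (- 2 * ?N) < 0" using neg[OF y] d e by simp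
  next
    fix y :: "real^'n" assume y: "norm y = s"
    have "s\<^sup>2 \<le> 1" using s by (simp add: power_le_one)
    then show "B \<le> f y + (d + e) * rho y"
      using bd[OF y] y d e by (simp add: add_increasing2)
  qed
  moreover have "(d + e) * rho x \<le> (d + e) * 1"
    using d e by (intro mult_left_mono) auto
  ultimately show "B - d \<le> f x + e" by simp
qed

subsection \<open>Potentials of the sphere\<close>

lemma gradient_mvt:
  fixes f :: "'a::real_inner \<Rightarrow> real"
  assumes "\<And>z. z \<in> closed_segment x y \<Longrightarrow> (f has_derivative (\<lambda>h. G z \<bullet> h)) (at z)"
  obtains z where "z \<in> closed_segment x y" "f y - f x = G z \<bullet> (y - x)"
proof -
  have seg: "x + t *\<^sub>R (y - x) \<in> closed_segment x y" if "0 \<le> t" "t \<le> 1" for t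
    unfolding in_segment using that by (intro exI[of _ t]) (simp add: algebra_simps)
  have path: "((\<lambda>t. x + t *\<^sub>R (y - x)) has_derivative (\<lambda>t. t *\<^sub>R (y - x))) (at t)" for t :: real
    by (auto intro!: derivative_eq_intros)
  have "((\<lambda>t. f (x + t *\<^sub>R (y - x))) has_real_derivative G (x + t *\<^sub>R (y - x)) \<bullet> (y - x)) (at t)"
    if "0 \<le> t" "t \<le> 1" for t
    using has_derivative_compose[OF path assms[OF seg[OF that]]]
    by (simp add: has_field_derivative_def mult_commute_abs)
  then obtain t where t: "0 < t" "t < 1"
    and eq: "f (x + 1 *\<^sub>R (y - x)) - f (x + 0 *\<^sub>R (y - x)) = (1 - 0) * (G (x + t *\<^sub>R (y - x)) \<bullet> (y - x))"
    using MVT2[of 0 1 "\<lambda>t. f (x + t *\<^sub>R (y - x))" "\<lambda>t. G (x + t *\<^sub>R (y - x)) \<bullet> (y - x)"] by auto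
  then show thesis using that[OF seg[of t]] by simp
qed

text \<open>The mean value theorem writes the remainder at each point of the sphere as
  (\<open>kG z \<zeta>\<close> - \<open>kG x \<zeta>\<close>) . (y - x) with z between x and y;
  uniform continuity of \<open>kG\<close> on a compact ball times the sphere makes the first factor
  small uniformly in the integration variable.\<close>

lemma has_derivative_sphere_integral:
  fixes k :: "real^'n \<Rightarrow> real^'n \<Rightarrow> real"
  assumes S: "open S" "x \<in> S"
    and der: "\<And>y \<zeta>. y \<in> S \<Longrightarrow> \<zeta> \<in> sphere 0 1 \<Longrightarrow> ((\<lambda>y. k y \<zeta>) has_derivative (\<lambda>h. kG y \<zeta> \<bullet> h)) (at y)"
    and cG: "continuous_on (S \<times> sphere 0 1) (\<lambda>(y, \<zeta>). kG y \<zeta>)"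
    and c: "\<And>y. y \<in> S \<Longrightarrow> continuous_on (sphere 0 1) (k y)"
  shows "((\<lambda>x. \<integral>\<zeta>. k x \<zeta> \<partial>sphere_measure) has_derivative (\<lambda>h. (\<integral>\<zeta>. kG x \<zeta> \<partial>sphere_measure) \<bullet> h)) (at x)"
  unfolding has_derivative_at_alt
proof (intro conjI allI impI)
  show "bounded_linear (\<lambda>h. (\<integral>\<zeta>. kG x \<zeta> \<partial>sphere_measure) \<bullet> h)" by (rule bounded_linear_inner_right)
  fix e :: real assume e: "0 < e"
  obtain r where r: "r > 0" "cball x r \<subseteq> S" using S open_contains_cball by blast
  have cGy: "continuous_on (sphere 0 1) (kG y)" if "y \<in> S" for y
  proof -
    have "continuous_on (sphere 0 1) ((\<lambda>(y, \<zeta>). kG y \<zeta>) \<circ> (\<lambda>\<zeta>. (y, \<zeta>)))"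
      by (intro continuous_on_compose continuous_intros continuous_on_subset[OF cG]) (use that in auto)
    then show ?thesis by (simp add: o_def)
  qed
  have "uniformly_continuous_on (cball x r \<times> sphere 0 1) (\<lambda>(y, \<zeta>). kG y \<zeta>)"
    by (intro compact_uniformly_continuous continuous_on_subset[OF cG] compact_Times) (use r in auto)
  from uniformly_continuous_onE[OF this e] obtain d where d: "d > 0"
    and ud: "\<And>u v. u \<in> cball x r \<times> sphere 0 1 \<Longrightarrow> v \<in> cball x r \<times> sphere 0 1 \<Longrightarrow> dist v u < d \<Longrightarrow>
      dist ((\<lambda>(y, \<zeta>). kG y \<zeta>) v) ((\<lambda>(y, \<zeta>). kG y \<zeta>) u) < e"
    by metis
  show "\<exists>d>0. \<forall>y. norm (y - x) < d \<longrightarrow>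
      norm ((\<integral>\<zeta>. k y \<zeta> \<partial>sphere_measure) - (\<integral>\<zeta>. k x \<zeta> \<partial>sphere_measure) - (\<integral>\<zeta>. kG x \<zeta> \<partial>sphere_measure) \<bullet> (y - x))
      \<le> e * norm (y - x)"
  proof (intro exI conjI allI impI)
    show "0 < min d r" using d r by simp
    fix y assume y: "norm (y - x) < min d r"
    have seg: "closed_segment x y \<subseteq> cball x (norm (y - x))"
      by (intro closed_segment_subset convex_cball) (auto simp: dist_norm norm_minus_commute)
    have yS: "y \<in> S" "x \<in> S" using r y by (auto simp: dist_norm norm_minus_commute subset_iff)
    have ints: "integrable sphere_measure (k y)" "integrable sphere_measure (k x)" "integrable sphere_measure (kG x)"
      using c cGy yS by (auto intro: integrable_sphere_measure_continuous)
    have "norm (k y \<zeta> - k x \<zeta> - kG x \<zeta> \<bullet> (y - x)) \<le> e * norm (y - x)" if \<zeta>: "\<zeta> \<in> sphere 0 1" for \<zeta>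
    proof -
      have "\<And>z. z \<in> closed_segment x y \<Longrightarrow> ((\<lambda>y. k y \<zeta>) has_derivative (\<lambda>h. kG z \<zeta> \<bullet> h)) (at z)"
        using der \<zeta> seg r y by (meson cball_subset_cball_iff less_imp_le min_less_iff_conj order.trans subset_cball subset_iff)
      then obtain z where z: "z \<in> closed_segment x y" "k y \<zeta> - k x \<zeta> = kG z \<zeta> \<bullet> (y - x)"
        using gradient_mvt[of x y "\<lambda>y. k y \<zeta>" "\<lambda>z. kG z \<zeta>"] by blast
      have zx: "dist z x \<le> norm (y - x)" using seg z(1) by (auto simp: dist_commute)
      have "dist (z, \<zeta>) (x, \<zeta>) < d" using zx y by (simp add: dist_Pair_Pair)
      then have "dist (kG z \<zeta>) (kG x \<zeta>) < e"
        using ud[of "(x, \<zeta>)" "(z, \<zeta>)"] \<zeta> zx y r(1) by (auto simp: dist_commute)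
      moreover have "norm (k y \<zeta> - k x \<zeta> - kG x \<zeta> \<bullet> (y - x)) = \<bar>(kG z \<zeta> - kG x \<zeta>) \<bullet> (y - x)\<bar>"
        by (simp add: z(2) inner_diff_left)
      moreover have "\<bar>(kG z \<zeta> - kG x \<zeta>) \<bullet> (y - x)\<bar> \<le> norm (kG z \<zeta> - kG x \<zeta>) * norm (y - x)"
        by (rule Cauchy_Schwarz_ineq2)
      ultimately show ?thesis
        by (smt (verit) dist_norm mult_right_mono norm_ge_zero)
    qed
    then have "norm (\<integral>\<zeta>. k y \<zeta> - k x \<zeta> - kG x \<zeta> \<bullet> (y - x) \<partial>sphere_measure) \<le> e * norm (y - x)"
      using e by (intro integral_sphere_measure_norm_le) auto
    moreover have "(\<integral>\<zeta>. k y \<zeta> - k x \<zeta> - kG x \<zeta> \<bullet> (y - x) \<partial>sphere_measure)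
      = (\<integral>\<zeta>. k y \<zeta> \<partial>sphere_measure) - (\<integral>\<zeta>. k x \<zeta> \<partial>sphere_measure) - (\<integral>\<zeta>. kG x \<zeta> \<partial>sphere_measure) \<bullet> (y - x)"
      using ints by simp
    ultimately show "norm ((\<integral>\<zeta>. k y \<zeta> \<partial>sphere_measure) - (\<integral>\<zeta>. k x \<zeta> \<partial>sphere_measure)
        - (\<integral>\<zeta>. kG x \<zeta> \<partial>sphere_measure) \<bullet> (y - x)) \<le> e * norm (y - x)" by simp
  qed
qed

text \<open>Every kernel of the problem is a combination of a power of \<open>rho\<close> times |x -
  z|^(-p), z on the sphere and p = n or n + 2. Keeping p and the density free makes the family
  closed under differentiation.\<close>

definition pot :: "nat \<Rightarrow> (real^'n \<Rightarrow> real) \<Rightarrow> real^'n \<Rightarrow> real"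
  where "pot p \<tau> x = (\<integral>\<zeta>. \<tau> \<zeta> / norm (x - \<zeta>) ^ p \<partial>sphere_measure)"

definition pot_grad :: "nat \<Rightarrow> (real^'n \<Rightarrow> real) \<Rightarrow> real^'n \<Rightarrow> real^'n"
  where "pot_grad p \<tau> x = (\<integral>\<zeta>. (- real p * \<tau> \<zeta> / norm (x - \<zeta>) ^ (p + 2)) *\<^sub>R (x - \<zeta>) \<partial>sphere_measure)"

lemma pot_integrand_continuous:
  assumes "continuous_on (sphere 0 1) \<tau>" "norm x < 1"
  shows "continuous_on (sphere 0 1) (\<lambda>\<zeta>. \<tau> \<zeta> / norm (x - \<zeta> :: real^'n) ^ p)"
  using assms by (intro continuous_intros) auto

lemma has_derivative_norm_diff_power:
  fixes x \<zeta> :: "real^'n"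
  assumes "x \<noteq> \<zeta>"
  shows "((\<lambda>x. c / norm (x - \<zeta>) ^ p) has_derivative
    (\<lambda>h. ((- real p * c / norm (x - \<zeta>) ^ (p + 2)) *\<^sub>R (x - \<zeta>)) \<bullet> h)) (at x)"
proof -
  let ?s = "norm (x - \<zeta>)"
  have s: "?s > 0" using assms by simp
  have "((\<lambda>x. x - \<zeta>) has_derivative (\<lambda>h. h)) (at x)"
    by (auto intro!: derivative_eq_intros)
  moreover have "(norm has_derivative (\<lambda>h. h \<bullet> sgn (x - \<zeta>))) (at (x - \<zeta>))"
    using has_derivative_norm[of "x - \<zeta>"] assms by (simp add: inner_commute)
  ultimately have nd: "((\<lambda>x. norm (x - \<zeta>)) has_derivative (\<lambda>h. h \<bullet> sgn (x - \<zeta>))) (at x)"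
    by (rule has_derivative_compose)
  have "((\<lambda>s. c / s ^ p) has_real_derivative (- real p * c / ?s ^ (p + 1))) (at ?s)"
  \<comment> \<open>The split avoids the truncated exponent p - 1 of the power rule at p =
    0.\<close>
  proof (cases p)
    case (Suc q)
    have "((\<lambda>s. c / s ^ Suc q) has_real_derivative (- real (Suc q) * c / ?s ^ (Suc q + 1))) (at ?s)"
      by (rule derivative_eq_intros refl)+ (use s in \<open>auto simp: field_simps\<close>)
    then show ?thesis by (simp only: Suc)
  qed simp
  from DERIV_compose_FDERIV[OF this nd]
  have "((\<lambda>x. c / norm (x - \<zeta>) ^ p) has_derivative
    (\<lambda>h. (h \<bullet> sgn (x - \<zeta>)) * (- real p * c / ?s ^ (p + 1)))) (at x)" .
  moreover have "(\<lambda>h. (h \<bullet> sgn (x - \<zeta>)) * (- real p * c / ?s ^ (p + 1)))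
    = (\<lambda>h. ((- real p * c / norm (x - \<zeta>) ^ (p + 2)) *\<^sub>R (x - \<zeta>)) \<bullet> h)"
  proof
    fix h
    have "h \<bullet> sgn (x - \<zeta>) = ((x - \<zeta>) \<bullet> h) / ?s"
      by (simp add: sgn_div_norm inner_commute divide_inverse mult.commute)
    then show "(h \<bullet> sgn (x - \<zeta>)) * (- real p * c / ?s ^ (p + 1))
      = ((- real p * c / norm (x - \<zeta>) ^ (p + 2)) *\<^sub>R (x - \<zeta>)) \<bullet> h"
      unfolding inner_scaleR_left using s by (simp add: field_simps)
  qed
  ultimately show ?thesis by simp
qed

lemma pot_has_derivative:
  fixes x :: "real^'n"
  assumes "continuous_on (sphere 0 1) \<tau>" "norm x < 1"
  shows "(pot p \<tau> has_derivative (\<lambda>h. pot_grad p \<tau> x \<bullet> h)) (at x)"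
  unfolding pot_def[abs_def] pot_grad_def
proof (rule has_derivative_sphere_integral[where S="ball 0 1"])
  show "continuous_on (ball 0 1 \<times> sphere 0 1)
     (\<lambda>(y, \<zeta>). (- real p * \<tau> \<zeta> / norm (y - \<zeta> :: real^'n) ^ (p + 2)) *\<^sub>R (y - \<zeta>))"
    unfolding case_prod_beta
    by (intro continuous_intros continuous_on_compose2[OF assms(1) continuous_on_snd[OF continuous_on_id]]) auto
  fix y \<zeta> :: "real^'n" assume "y \<in> ball 0 1" "\<zeta> \<in> sphere 0 1"
  then have "y \<noteq> \<zeta>" by auto
  then show "((\<lambda>y. \<tau> \<zeta> / norm (y - \<zeta>) ^ p) has_derivative
      (\<lambda>h. ((- real p * \<tau> \<zeta> / norm (y - \<zeta>) ^ (p + 2)) *\<^sub>R (y - \<zeta>)) \<bullet> h)) (at y)"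
    by (rule has_derivative_norm_diff_power)
qed (use assms in \<open>auto intro!: pot_integrand_continuous\<close>)

text \<open>Components of the gradient are again built from potentials, of order p + 2 and with the
  extra density factor \<open>\<zeta> $ j\<close>. Second derivatives therefore need no further
  differentiation under the integral sign.\<close>

lemma pot_grad_component:
  fixes x :: "real^'n"
  assumes c: "continuous_on (sphere 0 1) \<tau>" "norm x < 1"
  shows "pot_grad p \<tau> x $ j = - real p * (x $ j * pot (p + 2) \<tau> x - pot (p + 2) (\<lambda>\<zeta>. \<zeta> $ j * \<tau> \<zeta>) x)"
proof -
  have i1: "integrable sphere_measure (\<lambda>\<zeta>. (- real p * \<tau> \<zeta> / norm (x - \<zeta>) ^ (p + 2)) *\<^sub>R (x - \<zeta>))"
    using c by (intro integrable_sphere_measure_continuous continuous_intros) auto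
  have i2: "integrable sphere_measure (\<lambda>\<zeta>. \<tau> \<zeta> / norm (x - \<zeta>) ^ (p + 2))"
    using c by (intro integrable_sphere_measure_continuous pot_integrand_continuous)
  have i3: "integrable sphere_measure (\<lambda>\<zeta>. \<zeta> $ j * \<tau> \<zeta> / norm (x - \<zeta>) ^ (p + 2))"
    using c by (intro integrable_sphere_measure_continuous pot_integrand_continuous continuous_intros)
  have "pot_grad p \<tau> x $ j = (\<integral>\<zeta>. ((- real p * \<tau> \<zeta> / norm (x - \<zeta>) ^ (p + 2)) *\<^sub>R (x - \<zeta>)) $ j \<partial>sphere_measure)"
    unfolding pot_grad_def by (rule integral_bounded_linear[OF bounded_linear_vec_nth i1, symmetric])
  also have "\<dots> = (\<integral>\<zeta>. - real p * (x $ j * (\<tau> \<zeta> / norm (x - \<zeta>) ^ (p + 2)) - \<zeta> $ j * \<tau> \<zeta> / norm (x - \<zeta>) ^ (p + 2)) \<partial>sphere_measure)"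
    by (rule Bochner_Integration.integral_cong) (auto simp: field_simps)
  also have "\<dots> = - real p * (x $ j * pot (p + 2) \<tau> x - pot (p + 2) (\<lambda>\<zeta>. \<zeta> $ j * \<tau> \<zeta>) x)"
    unfolding pot_def using i2 i3 by (simp del: add_2_eq_Suc' times_divide_eq_right)
  finally show ?thesis .
qed

text \<open>For z on the unit sphere, 2 x . (x - z) = |x - z|^2 - \<open>rho x\<close>. Radial
  derivatives thus reduce to the potentials of orders p and p + 2, the only unknowns in the
  identities for Z.\<close>

lemma pot_euler:
  fixes x :: "real^'n"
  assumes c: "continuous_on (sphere 0 1) \<tau>" "norm x < 1"
  shows "x \<bullet> pot_grad p \<tau> x = - (real p / 2) * (pot p \<tau> x - rho x * pot (p + 2) \<tau> x)"
proof -
  have i1: "integrable sphere_measure (\<lambda>\<zeta>. (- real p * \<tau> \<zeta> / norm (x - \<zeta>) ^ (p + 2)) *\<^sub>R (x - \<zeta>))"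
    using c by (intro integrable_sphere_measure_continuous continuous_intros) auto
  have i2: "integrable sphere_measure (\<lambda>\<zeta>. \<tau> \<zeta> / norm (x - \<zeta>) ^ q)" for q
    using c by (intro integrable_sphere_measure_continuous pot_integrand_continuous)
  have "x \<bullet> pot_grad p \<tau> x = (\<integral>\<zeta>. x \<bullet> ((- real p * \<tau> \<zeta> / norm (x - \<zeta>) ^ (p + 2)) *\<^sub>R (x - \<zeta>)) \<partial>sphere_measure)"
    unfolding pot_grad_def using i1 by (simp del: add_2_eq_Suc' inner_scaleR_right)
  also have "\<dots> = (\<integral>\<zeta>. - (real p / 2) * (\<tau> \<zeta> / norm (x - \<zeta>) ^ p - rho x * (\<tau> \<zeta> / norm (x - \<zeta>) ^ (p + 2))) \<partial>sphere_measure)"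
  proof (rule Bochner_Integration.integral_cong)
    fix \<zeta> :: "real^'n" assume "\<zeta> \<in> space sphere_measure"
    then have z: "norm \<zeta> = 1" "x \<noteq> \<zeta>" using c(2) by auto
    define d where "d = norm (x - \<zeta>)"
    have d: "d > 0" using z by (simp add: d_def)
    have "2 * (x \<bullet> (x - \<zeta>)) = d\<^sup>2 - rho x"
      using z(1) dot_square_norm[of \<zeta>]
      by (simp add: d_def power2_norm_eq_inner inner_diff_left inner_diff_right inner_commute)
    then have e: "x \<bullet> (x - \<zeta>) = (d\<^sup>2 - rho x) / 2" by simp
    show "x \<bullet> ((- real p * \<tau> \<zeta> / norm (x - \<zeta>) ^ (p + 2)) *\<^sub>R (x - \<zeta>))
      = - (real p / 2) * (\<tau> \<zeta> / norm (x - \<zeta>) ^ p - rho x * (\<tau> \<zeta> / norm (x - \<zeta>) ^ (p + 2)))"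
      unfolding inner_scaleR_right e d_def[symmetric] using d
      by (simp add: power_add power2_eq_square field_simps)
  qed simp
  also have "\<dots> = - (real p / 2) * (pot p \<tau> x - rho x * pot (p + 2) \<tau> x)"
    unfolding pot_def using i2[of p] i2[of "p + 2"] by (simp del: add_2_eq_Suc' times_divide_eq_right)
  finally show ?thesis .
qed

text \<open>The pointwise fact is that |x - z|^(-p) has Laplacian p (p + 2 - n) |x - z|^(-p-2). The
  diagonal second derivatives contain (x_j - z_j)^2 over the power p + 4; their sum over j is |x -
  z|^2, which brings the order back to p + 2.\<close>

lemma glap_pot:
  fixes \<tau> :: "real^'n \<Rightarrow> real"
  assumes c: "continuous_on (sphere 0 1) \<tau>"
  shows "glap (ball 0 1) (pot p \<tau>) (pot_grad p \<tau>)
    (\<lambda>x. real p * (real p + 2 - real CARD('n)) * pot (p + 2) \<tau> x)"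
proof (rule glapI[where D="\<lambda>x h. \<chi> j. - real p * ((h $ j) * pot (p + 2) \<tau> x + x $ j * (pot_grad (p + 2) \<tau> x \<bullet> h)
      - pot_grad (p + 2) (\<lambda>\<zeta>. \<zeta> $ j * \<tau> \<zeta>) x \<bullet> h)"])
  fix x :: "real^'n" assume "x \<in> ball 0 1"
  then have x: "norm x < 1" by simp
  have cj: "continuous_on (sphere 0 1) (\<lambda>\<zeta>. \<zeta> $ j * \<tau> \<zeta>)" for j
    using c by (intro continuous_intros)
  show "(pot p \<tau> has_derivative (\<bullet>) (pot_grad p \<tau> x)) (at x)"
    using pot_has_derivative[OF c x] .
  let ?D = "\<lambda>h. \<chi> j. - real p * ((h $ j) * pot (p + 2) \<tau> x + x $ j * (pot_grad (p + 2) \<tau> x \<bullet> h)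
      - pot_grad (p + 2) (\<lambda>\<zeta>. \<zeta> $ j * \<tau> \<zeta>) x \<bullet> h)"
  show "(pot_grad p \<tau> has_derivative ?D) (at x)"
  proof (rule iffD2[OF has_derivative_componentwise_within], rule ballI)
    fix i :: "real^'n" assume "i \<in> Basis"
    then obtain j where i: "i = axis j 1" by (auto simp: Basis_vec_def)
    have comp: "((\<lambda>y. - real p * (y $ j * pot (p + 2) \<tau> y - pot (p + 2) (\<lambda>\<zeta>. \<zeta> $ j * \<tau> \<zeta>) y)) has_derivative
       (\<lambda>h. - real p * ((h $ j) * pot (p + 2) \<tau> x + x $ j * (pot_grad (p + 2) \<tau> x \<bullet> h)
      - pot_grad (p + 2) (\<lambda>\<zeta>. \<zeta> $ j * \<tau> \<zeta>) x \<bullet> h))) (at x)"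
      by (rule derivative_eq_intros pot_has_derivative[OF c x] pot_has_derivative[OF cj x]
          bounded_linear.has_derivative[OF bounded_linear_vec_nth] has_derivative_ident refl)+
        (simp add: algebra_simps)
    have "((\<lambda>y. pot_grad p \<tau> y $ j) has_derivative
       (\<lambda>h. - real p * ((h $ j) * pot (p + 2) \<tau> x + x $ j * (pot_grad (p + 2) \<tau> x \<bullet> h)
      - pot_grad (p + 2) (\<lambda>\<zeta>. \<zeta> $ j * \<tau> \<zeta>) x \<bullet> h))) (at x)"
      by (rule has_derivative_transform_within_open[OF comp open_ball[of 0 1]])
        (use x in \<open>auto simp: pot_grad_component[OF c]\<close>)
    then show "((\<lambda>y. pot_grad p \<tau> y \<bullet> i) has_derivative (\<lambda>h. ?D h \<bullet> i)) (at x)"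
      by (simp add: i inner_axis)
  qed
  have i1: "integrable sphere_measure (\<lambda>\<zeta>. \<tau> \<zeta> * (x $ j - \<zeta> $ j)\<^sup>2 / norm (x - \<zeta>) ^ (p + 4))" for j
    using c x by (intro integrable_sphere_measure_continuous continuous_intros) auto
  have diag: "x $ j * pot_grad (p + 2) \<tau> x $ j - pot_grad (p + 2) (\<lambda>\<zeta>. \<zeta> $ j * \<tau> \<zeta>) x $ j
     = - (real p + 2) * (\<integral>\<zeta>. \<tau> \<zeta> * (x $ j - \<zeta> $ j)\<^sup>2 / norm (x - \<zeta>) ^ (p + 4) \<partial>sphere_measure)" for j
  proof -
    have i2: "integrable sphere_measure (\<lambda>\<zeta>. \<sigma> \<zeta> / norm (x - \<zeta>) ^ (p + 4))"
      if "continuous_on (sphere 0 1) \<sigma>" for \<sigma> :: "real^'n \<Rightarrow> real"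
      using that x by (intro integrable_sphere_measure_continuous pot_integrand_continuous)
    have cjj: "continuous_on (sphere 0 1) (\<lambda>\<zeta>. \<zeta> $ j * (\<zeta> $ j * \<tau> \<zeta>))"
      using c by (intro continuous_intros)
    have "x $ j * pot_grad (p + 2) \<tau> x $ j - pot_grad (p + 2) (\<lambda>\<zeta>. \<zeta> $ j * \<tau> \<zeta>) x $ j
       = - (real p + 2) * (x $ j * (x $ j * pot (p + 4) \<tau> x - pot (p + 4) (\<lambda>\<zeta>. \<zeta> $ j * \<tau> \<zeta>) x)
         - (x $ j * pot (p + 4) (\<lambda>\<zeta>. \<zeta> $ j * \<tau> \<zeta>) x - pot (p + 4) (\<lambda>\<zeta>. \<zeta> $ j * (\<zeta> $ j * \<tau> \<zeta>)) x))"
      unfolding pot_grad_component[OF c x] pot_grad_component[OF cj x] by (simp add: numeral_eq_Suc algebra_simps)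
    also have "\<dots> = - (real p + 2) * (\<integral>\<zeta>. x $ j * (x $ j * (\<tau> \<zeta> / norm (x - \<zeta>) ^ (p + 4)) - \<zeta> $ j * \<tau> \<zeta> / norm (x - \<zeta>) ^ (p + 4))
        - (x $ j * (\<zeta> $ j * \<tau> \<zeta> / norm (x - \<zeta>) ^ (p + 4)) - \<zeta> $ j * (\<zeta> $ j * \<tau> \<zeta>) / norm (x - \<zeta>) ^ (p + 4)) \<partial>sphere_measure)"
      unfolding pot_def using i2[OF c] i2[OF cj[of j]] i2[OF cjj] by (simp del: times_divide_eq_right)
    also have "\<dots> = - (real p + 2) * (\<integral>\<zeta>. \<tau> \<zeta> * (x $ j - \<zeta> $ j)\<^sup>2 / norm (x - \<zeta>) ^ (p + 4) \<partial>sphere_measure)"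
      by (rule arg_cong[where f="\<lambda>t. - (real p + 2) * t"], rule Bochner_Integration.integral_cong)
        (auto simp: power2_eq_square algebra_simps add_divide_distrib diff_divide_distrib)
    finally show ?thesis .
  qed
  have "(\<Sum>j\<in>UNIV. \<integral>\<zeta>. \<tau> \<zeta> * (x $ j - \<zeta> $ j)\<^sup>2 / norm (x - \<zeta>) ^ (p + 4) \<partial>sphere_measure)
      = (\<integral>\<zeta>. (\<Sum>j\<in>UNIV. \<tau> \<zeta> * (x $ j - \<zeta> $ j)\<^sup>2 / norm (x - \<zeta>) ^ (p + 4)) \<partial>sphere_measure)"
    using i1 by (intro Bochner_Integration.integral_sum[symmetric])
  also have "\<dots> = pot (p + 2) \<tau> x"
    unfolding pot_def
  proof (rule Bochner_Integration.integral_cong)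
    fix \<zeta> :: "real^'n" assume "\<zeta> \<in> space sphere_measure"
    then have z: "norm (x - \<zeta>) > 0" using x by auto
    have "(\<Sum>j\<in>UNIV. \<tau> \<zeta> * (x $ j - \<zeta> $ j)\<^sup>2 / norm (x - \<zeta>) ^ (p + 4))
       = \<tau> \<zeta> * (\<Sum>j\<in>UNIV. (x $ j - \<zeta> $ j)\<^sup>2) / norm (x - \<zeta>) ^ (p + 4)"
      by (simp add: sum_distrib_left sum_divide_distrib)
    also have "(\<Sum>j\<in>UNIV. (x $ j - \<zeta> $ j)\<^sup>2) = (norm (x - \<zeta>))\<^sup>2"
      by (simp add: norm_vec_def L2_set_def sum_nonneg)
    finally show "(\<Sum>j\<in>UNIV. \<tau> \<zeta> * (x $ j - \<zeta> $ j)\<^sup>2 / norm (x - \<zeta>) ^ (p + 4)) = \<tau> \<zeta> / norm (x - \<zeta>) ^ (p + 2)"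
      using z by (simp add: numeral_eq_Suc field_simps)
  qed simp
  finally have tr: "(\<Sum>j\<in>UNIV. x $ j * pot_grad (p + 2) \<tau> x $ j - pot_grad (p + 2) (\<lambda>\<zeta>. \<zeta> $ j * \<tau> \<zeta>) x $ j)
      = - (real p + 2) * pot (p + 2) \<tau> x"
    unfolding diag by (simp add: sum_distrib_left[symmetric])
  have "(\<Sum>j\<in>UNIV. ?D (axis j 1) $ j)
     = (\<Sum>j\<in>(UNIV::'n set). - real p * (pot (p + 2) \<tau> x + (x $ j * pot_grad (p + 2) \<tau> x $ j - pot_grad (p + 2) (\<lambda>\<zeta>. \<zeta> $ j * \<tau> \<zeta>) x $ j)))"
    by (rule sum.cong) (auto simp: inner_axis)
  also have "\<dots> = - real p * (real CARD('n) * pot (p + 2) \<tau> x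
      + (\<Sum>j\<in>UNIV. x $ j * pot_grad (p + 2) \<tau> x $ j - pot_grad (p + 2) (\<lambda>\<zeta>. \<zeta> $ j * \<tau> \<zeta>) x $ j))"
    unfolding sum_distrib_left[symmetric] sum.distrib by simp
  also have "\<dots> = real p * (real p + 2 - real CARD('n)) * pot (p + 2) \<tau> x"
    unfolding tr by (simp add: algebra_simps)
  finally show "(\<Sum>j\<in>UNIV. ?D (axis j 1) $ j) = real p * (real p + 2 - real CARD('n)) * pot (p + 2) \<tau> x" .
qed

subsection \<open>Boundary behaviour of the biharmonic extension\<close>

lemma pot_linear:
  fixes x :: "real^'n"
  assumes "continuous_on (sphere 0 1) \<tau>" "continuous_on (sphere 0 1) \<sigma>" "norm x < 1"
  shows "pot p (\<lambda>\<zeta>. a * \<tau> \<zeta> + b * \<sigma> \<zeta>) x = a * pot p \<tau> x + b * pot p \<sigma> x"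
proof -
  have "integrable sphere_measure (\<lambda>\<zeta>. \<tau> \<zeta> / norm (x - \<zeta>) ^ p)" "integrable sphere_measure (\<lambda>\<zeta>. \<sigma> \<zeta> / norm (x - \<zeta>) ^ p)"
    using assms by (auto intro!: integrable_sphere_measure_continuous pot_integrand_continuous)
  moreover have "pot p (\<lambda>\<zeta>. a * \<tau> \<zeta> + b * \<sigma> \<zeta>) x
      = (\<integral>\<zeta>. a * (\<tau> \<zeta> / norm (x - \<zeta>) ^ p) + b * (\<sigma> \<zeta> / norm (x - \<zeta>) ^ p) \<partial>sphere_measure)"
    by (simp add: pot_def add_divide_distrib)
  ultimately show ?thesis by (simp add: pot_def del: times_divide_eq_right)
qed

lemma pot_at_0: "pot p (\<tau> :: real^'n \<Rightarrow> real) 0 = (\<integral>\<zeta>. \<tau> \<zeta> \<partial>sphere_measure)"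
  unfolding pot_def by (rule Bochner_Integration.integral_cong) auto

section \<open>Harmonicity of the Poisson integral and total masses of the two kernels\<close>

lemma pot_const_orthogonal:
  fixes T :: "real^'n \<Rightarrow> real^'n"
  assumes T: "orthogonal_transformation T" and x: "norm x < 1"
  shows "pot p (\<lambda>_. c) (T x) = pot p (\<lambda>_. c) x"
proof -
  have Tx: "norm (T x) < 1" using x orthogonal_transformation_norm[OF T] by simp
  have d: "norm (T x - T \<zeta>) = norm (x - \<zeta>)" for \<zeta>
    by (metis T linear_diff orthogonal_transformation_linear orthogonal_transformation_norm)
  have "(\<lambda>\<zeta>. c / norm (T x - \<zeta>) ^ p) \<in> borel_measurable sphere_measure"
    using Tx by (intro measurable_sphere_measureI pot_integrand_continuous) auto
  from integral_sphere_measure_orthogonal[OF T this] show ?thesis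
    by (simp add: pot_def d)
qed

text \<open>For the order p = n the Euler identity turns the cross term of the product rule into
  exactly the negative of the other two terms.\<close>

lemma glap_poisson:
  fixes \<tau> :: "real^'n \<Rightarrow> real"
  assumes c: "continuous_on (sphere 0 1) \<tau>"
  shows "glap (ball 0 1) (\<lambda>x. rho x * pot CARD('n) \<tau> x)
    (\<lambda>x. rho x *\<^sub>R pot_grad CARD('n) \<tau> x + pot CARD('n) \<tau> x *\<^sub>R ((-2) *\<^sub>R x)) (\<lambda>x. 0)"
proof (rule glap_eq[OF glap_mult[OF glap_rho glap_pot[OF c]] refl refl])
  fix x :: "real^'n" assume "x \<in> ball 0 1"
  then have x: "norm x < 1" by simp
  show "rho x * (real CARD('n) * (real CARD('n) + 2 - real CARD('n)) * pot (CARD('n) + 2) \<tau> x) +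
      pot CARD('n) \<tau> x * (- 2 * real CARD('n)) + 2 * ((-2) *\<^sub>R x \<bullet> pot_grad CARD('n) \<tau> x) = 0"
    unfolding inner_scaleR_left pot_euler[OF c x] by (simp add: algebra_simps)
qed

text \<open>The mass h is harmonic and rotation invariant, so it takes the single value h(x) on the
  sphere through x. The minimum principle on that ball, for h and for -h, gives h(x) = h(0) =
  1.\<close>

lemma poisson_mass:
  fixes x :: "real^'n"
  assumes x: "norm x < 1"
  shows "rho x * pot CARD('n) (\<lambda>_. 1) x = 1"
proof -
  define h where "h x = rho x * pot CARD('n) (\<lambda>_. 1) x" for x :: "real^'n"
  have "continuous_on (sphere 0 1) (\<lambda>_::real^'n. 1 :: real)" by simp
  note gl = glap_poisson[OF this, folded h_def]
  let ?s = "norm x"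
  have sub: "ball 0 ?s \<subseteq> ball (0::real^'n) 1" and sub': "cball 0 ?s \<subseteq> ball (0::real^'n) 1" using x by auto
  have ch: "continuous_on (cball 0 ?s) h"
    using glap_continuous(1)[OF gl] sub' continuous_on_subset by blast
  have hs: "h y = h x" if y: "norm y = ?s" for y
  proof -
    obtain T where T: "orthogonal_transformation T" "T x = y"
      by (rule orthogonal_transformation_exists[of x y]) (use y in auto)
    then show ?thesis using pot_const_orthogonal[OF T(1) x] y by (auto simp: h_def)
  qed
  have h0: "h 0 = 1" by (simp add: h_def pot_at_0)
  have "h 0 \<ge> h x - 0"
  proof (rule superharmonic_min[OF glap_subset[OF gl sub] ch])
    show "h y \<ge> h x" if "norm y = ?s" for y using hs[OF that] by simp
  qed (use x in auto)
  moreover have "- 1 * h 0 \<ge> - h x - 0"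
  proof (rule superharmonic_min[OF glap_cmult[OF glap_subset[OF gl sub]]])
    show "continuous_on (cball 0 ?s) (\<lambda>y. - 1 * h y)" using ch by (intro continuous_intros)
    show "- 1 * h y \<ge> - h x" if "norm y = ?s" for y using hs[OF that] by simp
  qed (use x in auto)
  ultimately show ?thesis using h0 by (simp add: h_def)
qed

text \<open>Since the Poisson kernel has total mass one, its Euler derivative integrates to zero.\<close>
lemma cubic_mass:
  fixes x :: "real^'n"
  assumes x: "norm x < 1"
  shows "(rho x)^3 * pot (CARD('n) + 2) (\<lambda>_. 1) x = 4 / real CARD('n) + (1 - 4 / real CARD('n)) * rho x"
proof -
  let ?N = "real CARD('n)" and ?p = "pot CARD('n) (\<lambda>_. 1) x" and ?q = "pot (CARD('n) + 2) (\<lambda>_. 1) x"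
  have N: "?N > 0" by simp
  have c: "continuous_on (sphere 0 1) (\<lambda>_::real^'n. 1 :: real)" by simp
  define G where "G = rho x *\<^sub>R pot_grad CARD('n) (\<lambda>_. 1) x + ?p *\<^sub>R ((-2) *\<^sub>R x)"
  have "((\<lambda>x::real^'n. rho x * pot CARD('n) (\<lambda>_. 1) x) has_derivative (\<lambda>h. G \<bullet> h)) (at x)"
    using glap_deriv[OF glap_poisson[OF c]] x unfolding G_def by simp
  moreover have "((\<lambda>x::real^'n. rho x * pot CARD('n) (\<lambda>_. 1) x) has_derivative (\<lambda>h. 0)) (at x)"
    by (rule has_derivative_transform_within_open[OF has_derivative_const[of 1] open_ball[of 0 1]])
      (use x poisson_mass in auto)
  ultimately have "(\<lambda>h. G \<bullet> h) = (\<lambda>h. 0)" by (rule has_derivative_unique)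
  then have "G \<bullet> x = 0" by (rule fun_cong)
  then have "rho x * (x \<bullet> pot_grad CARD('n) (\<lambda>_. 1) x) - 2 * ?p * (1 - rho x) = 0"
    unfolding G_def inner_add_left inner_scaleR_left inner_commute[of "pot_grad _ _ x" x] dot_square_norm
    by simp
  moreover have "2 * (x \<bullet> pot_grad CARD('n) (\<lambda>_. 1) x) = - (?N * (?p - rho x * ?q))"
    unfolding pot_euler[OF c x] by simp
  \<comment> \<open>Eliminates the Euler derivative e and the Poisson potential p, leaving the
    potential q of order n + 2.\<close>
  moreover have "r * e - 2 * p * (1 - r) = 0 \<Longrightarrow> 2 * e = - (?N * (p - r * q)) \<Longrightarrow> r * p = 1 \<Longrightarrow>
      ?N * (r ^ 3 * q) = 4 + (?N - 4) * r" for r p q e :: real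
    by algebra
  ultimately have "?N * (rho x ^ 3 * ?q) = 4 + (?N - 4) * rho x" using poisson_mass[OF x] by blast
  then show ?thesis using N by (simp add: field_simps)
qed

section \<open>Limits at the sphere, uniform in the direction\<close>

lemma continuous_on_sphere_bounded:
  fixes f :: "real^'n \<Rightarrow> 'b::real_normed_vector"
  assumes "continuous_on (sphere 0 1) f"
  obtains B where "B > 0" "\<And>\<zeta>. \<zeta> \<in> sphere 0 1 \<Longrightarrow> norm (f \<zeta>) \<le> B"
  using compact_imp_bounded[OF compact_continuous_image[OF assms compact_sphere]]
  unfolding bounded_pos by (metis imageI)

lemma dist_sgn:
  fixes x :: "'a::real_normed_vector"
  assumes "x \<noteq> 0"
  shows "dist x (sgn x) = \<bar>1 - norm x\<bar>"
proof -
  have "norm x *\<^sub>R sgn x = x" using assms by (simp add: sgn_div_norm)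
  then have "x - sgn x = (norm x - 1) *\<^sub>R sgn x"
    by (simp add: scaleR_left_diff_distrib)
  then show ?thesis using assms by (simp add: dist_norm norm_sgn abs_minus_commute)
qed

text \<open>Its neighbourhoods contain full annuli s < |x| < 1, so a limit along it is uniform over
  all directions, as a comparison on a sphere of radius close to 1 requires.\<close>

definition bdry :: "(real^'n) filter"
  where "bdry = filtercomap norm (at_left 1)"

text \<open>The bound 0 < s keeps the origin out of the annulus, so that \<open>sgn x\<close> is a
  point of the sphere there.\<close>

lemma eventually_bdry:
  "eventually P (bdry :: (real^'n) filter) \<longleftrightarrow> (\<exists>s. 0 < s \<and> s < 1 \<and> (\<forall>x. s < norm x \<and> norm x < 1 \<longrightarrow> P x))"
proof
  assume "eventually P bdry"
  then obtain Q b where Q: "b < 1" "\<And>y. b < y \<Longrightarrow> y < 1 \<Longrightarrow> Q y" "\<And>x. Q (norm x) \<Longrightarrow> P x"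
    unfolding bdry_def eventually_filtercomap eventually_at_left_field by blast
  then show "\<exists>s. 0 < s \<and> s < 1 \<and> (\<forall>x. s < norm x \<and> norm x < 1 \<longrightarrow> P x)"
    by (intro exI[of _ "max b (1/2)"]) auto
next
  assume "\<exists>s. 0 < s \<and> s < 1 \<and> (\<forall>x. s < norm x \<and> norm x < 1 \<longrightarrow> P x)"
  then obtain s where s: "s < 1" "\<And>x. s < norm x \<and> norm x < 1 \<Longrightarrow> P x" by blast
  show "eventually P bdry"
    unfolding bdry_def eventually_filtercomap eventually_at_left_field
    by (rule exI[of _ "\<lambda>t. s < t \<and> t < 1"]) (use s in auto)
qed

lemma rho_bdry: "(rho \<longlongrightarrow> 0) (bdry :: (real^'n) filter)"
proof -
  have "(norm \<longlongrightarrow> 1) (bdry :: (real^'n) filter)"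
    unfolding bdry_def using filterlim_filtercomap filterlim_mono[of norm "at_left 1"]
    by (metis at_le filterlim_at_withinI filterlim_def filtermap_filtercomap le_filter_def nhds_neq_bot at_within_le_nhds order_trans)
  from tendsto_diff[OF tendsto_const[of 1] tendsto_power[OF this, of 2]] show ?thesis by simp
qed

lemma uniform_boundary_limit:
  fixes f :: "real^'n \<Rightarrow> real"
  assumes "continuous_on (cball 0 1) f"
  shows "((\<lambda>x. f x - f (sgn x)) \<longlongrightarrow> 0) bdry"
proof (rule tendstoI)
  fix e :: real assume e: "e > 0"
  have "uniformly_continuous_on (cball 0 1) f"
    by (rule compact_uniformly_continuous[OF assms compact_cball])
  from uniformly_continuous_onE[OF this e] obtain d where d: "d > 0"
    "\<And>x x'. x \<in> cball 0 1 \<Longrightarrow> x' \<in> cball 0 1 \<Longrightarrow> dist x' x < d \<Longrightarrow> dist (f x') (f x) < e" by metis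
  show "\<forall>\<^sub>F x in bdry. dist (f x - f (sgn x)) 0 < e"
    unfolding eventually_bdry
  proof (intro exI[of _ "max (1/2) (1 - d)"] conjI allI impI)
    fix x :: "real^'n" assume x: "max (1/2) (1 - d) < norm x \<and> norm x < 1"
    then have "dist x (sgn x) < d" by (subst dist_sgn) auto
    then show "dist (f x - f (sgn x)) 0 < e"
      using d(2)[of "sgn x" x] x by (auto simp: norm_sgn dist_real_def)
  qed (use d in auto)
qed

text \<open>An approximate identity argument. Near \<open>sgn x\<close> the oscillation of the
  density is small and the mass is at most C; away from it the distance to x is bounded below and
  \<open>a \<ge> 1\<close> gives \<open>rho x ^ a \<le> rho x\<close>, which tends to 0. The mass is
  kept as a factor because it need not be 1.\<close>

lemma pot_boundary_limit:
  fixes \<tau> :: "real^'n \<Rightarrow> real"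
  assumes \<tau>: "continuous_on (sphere 0 1) \<tau>" and a: "a \<ge> 1"
    and C: "\<And>x::real^'n. norm x < 1 \<Longrightarrow> rho x ^ a * pot p (\<lambda>_. 1) x \<le> C"
  shows "((\<lambda>x. rho x ^ a * pot p \<tau> x - rho x ^ a * pot p (\<lambda>_. 1) x * \<tau> (sgn x)) \<longlongrightarrow> 0) bdry"
proof (rule tendstoI)
  fix e :: real assume e: "e > 0"
  have C0: "C \<ge> 0"
    using C[of 0] by (simp add: pot_at_0)
  obtain B where B: "B > 0" "\<And>\<zeta>. \<zeta> \<in> sphere 0 1 \<Longrightarrow> \<bar>\<tau> \<zeta>\<bar> \<le> B"
    using continuous_on_sphere_bounded[OF \<tau>] by (metis real_norm_def)
  \<comment> \<open>The summand 1 covers C = 0 and makes the bound e' C < e / 2 strict.\<close>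
  define e' where "e' = e / (2 * (C + 1))"
  have e': "e' > 0" "e' * C < e / 2 " using e C0 by (auto simp: e'_def field_simps)
  have "uniformly_continuous_on (sphere 0 1) \<tau>"
    by (rule compact_uniformly_continuous[OF \<tau> compact_sphere])
  from uniformly_continuous_onE[OF this e'(1)] obtain d where d: "d > 0"
    "\<And>x x'. x \<in> sphere 0 1 \<Longrightarrow> x' \<in> sphere 0 1 \<Longrightarrow> dist x' x < d \<Longrightarrow> dist (\<tau> x') (\<tau> x) < e'" by metis
  \<comment> \<open>If a point is at distance at least d from \<open>sgn x\<close> and x is within d
    / 2 of \<open>sgn x\<close>, then that point is at distance at least d / 2 from x.\<close>
  define d0 where "d0 = d / 2"
  have d0: "d0 > 0" using d by (simp add: d0_def)
  have small: "\<forall>\<^sub>F x in (bdry :: (real^'n) filter). 2 * B * rho x / d0 ^ p < e / 2"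
  proof -
    have "((\<lambda>x. 2 * B * rho x / d0 ^ p) \<longlongrightarrow> 2 * B * 0 / d0 ^ p) (bdry :: (real^'n) filter)"
      using d0 by (intro tendsto_intros rho_bdry) auto
    then show ?thesis using e by (intro order_tendstoD(2)[of _ 0]) auto
  qed
  have near: "\<forall>\<^sub>F x in (bdry :: (real^'n) filter). 1 - d0 < norm x \<and> 0 < norm x \<and> norm x < 1"
    unfolding eventually_bdry using d0 by (intro exI[of _ "max (1/2) (1 - d0)"]) auto
  show "\<forall>\<^sub>F x in bdry. dist (rho x ^ a * pot p \<tau> x - rho x ^ a * pot p (\<lambda>_. 1) x * \<tau> (sgn x)) 0 < e"
    using small near
  proof eventually_elim
    case (elim x)
    then have x: "norm x < 1" "norm x > 0" and dx: "1 - norm x < d0" by auto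
    define r where "r = rho x"
    have r: "0 \<le> r" "r \<le> 1" using x by (auto simp: r_def power_le_one)
    have ra: "0 \<le> r ^ a" "r ^ a \<le> r" using r a power_decreasing[of 1 a r] by auto
    have sx: "norm (sgn x) = 1" using x by (simp add: norm_sgn)
    have i1: "integrable sphere_measure (\<lambda>\<zeta>. \<tau> \<zeta> / norm (x - \<zeta>) ^ p)"
      and i2: "integrable sphere_measure (\<lambda>\<zeta>. 1 / norm (x - \<zeta>) ^ p)"
      using \<tau> x by (auto intro!: integrable_sphere_measure_continuous pot_integrand_continuous)
    have fin: "finite_measure (sphere_measure :: (real^'n) measure)" by (rule finite_measure_sphere_measure)
    have bound: "\<bar>r ^ a * (\<tau> \<zeta> / norm (x - \<zeta>) ^ p) - r ^ a * (1 / norm (x - \<zeta>) ^ p) * \<tau> (sgn x)\<bar>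
        \<le> e' * (r ^ a * (1 / norm (x - \<zeta>) ^ p)) + 2 * B * r / d0 ^ p" if \<zeta>: "\<zeta> \<in> sphere 0 1" for \<zeta>
    proof -
      define k where "k = r ^ a * (1 / norm (x - \<zeta>) ^ p)"
      have k0: "k \<ge> 0" using ra by (simp add: k_def)
      have eq: "\<bar>r ^ a * (\<tau> \<zeta> / norm (x - \<zeta>) ^ p) - r ^ a * (1 / norm (x - \<zeta>) ^ p) * \<tau> (sgn x)\<bar>
          = k * \<bar>\<tau> \<zeta> - \<tau> (sgn x)\<bar>"
        using k0 by (subst abs_of_nonneg[OF k0, symmetric], subst abs_mult[symmetric])
          (simp add: k_def right_diff_distrib)
      have rest: "0 \<le> 2 * B * r / d0 ^ p" using B r d0 by simp
      show ?thesis
      proof (cases "dist \<zeta> (sgn x) < d")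
        case True
        then have "\<bar>\<tau> \<zeta> - \<tau> (sgn x)\<bar> \<le> e'" using d(2)[of "sgn x" \<zeta>] \<zeta> sx by (simp add: dist_real_def)
        from mult_left_mono[OF this k0] rest show ?thesis unfolding eq by (simp add: k_def mult.commute)
      next
        case False
        have "dist x (sgn x) = 1 - norm x" using x by (subst dist_sgn) auto
        then have dd: "norm (x - \<zeta>) \<ge> d0"
          using dist_triangle[of \<zeta> "sgn x" x] False dx by (simp add: d0_def dist_norm norm_minus_commute)
        then have "norm (x - \<zeta>) ^ p \<ge> d0 ^ p" using d0 by (simp add: power_mono)
        then have "k \<le> r * (1 / d0 ^ p)" unfolding k_def
          using ra r d0 dd by (intro mult_mono divide_left_mono) (auto intro!: mult_pos_pos zero_less_power)
        moreover have "\<bar>\<tau> \<zeta> - \<tau> (sgn x)\<bar> \<le> 2 * B" using B(2)[OF \<zeta>] B(2)[of "sgn x"] sx by simp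
        ultimately have "k * \<bar>\<tau> \<zeta> - \<tau> (sgn x)\<bar> \<le> r * (1 / d0 ^ p) * (2 * B)"
          using k0 B(1) r d0 by (intro mult_mono) auto
        moreover have "0 \<le> e' * k" using e' k0 by simp
        ultimately show ?thesis unfolding eq by (simp add: k_def mult_ac)
      qed
    qed
    have eq: "r ^ a * pot p \<tau> x - r ^ a * pot p (\<lambda>_. 1) x * \<tau> (sgn x)
        = (\<integral>\<zeta>. r ^ a * (\<tau> \<zeta> / norm (x - \<zeta>) ^ p) - r ^ a * (1 / norm (x - \<zeta>) ^ p) * \<tau> (sgn x) \<partial>sphere_measure)"
      using i1 i2 by (simp add: pot_def del: times_divide_eq_right)
    have "\<bar>r ^ a * pot p \<tau> x - r ^ a * pot p (\<lambda>_. 1) x * \<tau> (sgn x)\<bar> \<le> (\<integral>\<zeta>. \<bar>r ^ a * (\<tau> \<zeta> / norm (x - \<zeta>) ^ p) - r ^ a * (1 / norm (x - \<zeta>) ^ p) * \<tau> (sgn x)\<bar> \<partial>sphere_measure)"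
      unfolding eq by (rule integral_abs_bound)
    also have "\<dots> \<le> (\<integral>\<zeta>. e' * (r ^ a * (1 / norm (x - \<zeta>) ^ p)) + 2 * B * r / d0 ^ p \<partial>sphere_measure)"
      using i1 i2 bound fin
      by (intro integral_mono) (auto simp del: times_divide_eq_right simp: finite_measure.integrable_const)
    also have "\<dots> = e' * (r ^ a * pot p (\<lambda>_. 1) x) + 2 * B * r / d0 ^ p"
      using i2 fin by (simp add: pot_def finite_measure.integrable_const del: times_divide_eq_right)
    also have "\<dots> \<le> e' * C + 2 * B * r / d0 ^ p"
      using C[OF x(1)] e' by (intro add_mono mult_left_mono) (auto simp: r_def)
    also have "\<dots> < e" using e' elim by (simp add: r_def)
    finally show ?case by (simp add: r_def dist_real_def)
  qed
qed

lemma bdry_mult_bounded: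
  fixes \<phi> :: "real^'n \<Rightarrow> real"
  assumes "continuous_on (sphere 0 1) \<phi>" and "(g \<longlongrightarrow> 0) bdry"
  shows "((\<lambda>x. g x * \<phi> (sgn x)) \<longlongrightarrow> 0) bdry"
proof -
  obtain B where B: "\<And>\<zeta>. \<zeta> \<in> sphere 0 1 \<Longrightarrow> \<bar>\<phi> \<zeta>\<bar> \<le> B"
    using continuous_on_sphere_bounded[OF assms(1)] by (metis real_norm_def)
  have "\<forall>\<^sub>F x in bdry. norm (g x * \<phi> (sgn x)) \<le> \<bar>g x\<bar> * B"
    unfolding eventually_bdry
    by (intro exI[of _ "1/2"]) (auto simp: abs_mult norm_sgn intro!: mult_left_mono B)
  moreover have "((\<lambda>x. \<bar>g x\<bar> * B) \<longlongrightarrow> \<bar>0\<bar> * B) bdry" by (intro tendsto_intros assms)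
  ultimately show ?thesis by (intro Lim_null_comparison[of "\<lambda>x. g x * \<phi> (sgn x)"]) simp_all
qed

lemma poisson_boundary_limit:
  fixes \<tau> :: "real^'n \<Rightarrow> real"
  assumes \<tau>: "continuous_on (sphere 0 1) \<tau>"
  shows "((\<lambda>x. rho x * pot CARD('n) \<tau> x - \<tau> (sgn x)) \<longlongrightarrow> 0) bdry"
proof (rule Lim_transform_eventually)
  show "((\<lambda>x. rho x ^ 1 * pot CARD('n) \<tau> x - rho x ^ 1 * pot CARD('n) (\<lambda>_. 1) x * \<tau> (sgn x)) \<longlongrightarrow> 0) bdry"
  proof (rule pot_boundary_limit[OF \<tau> order_refl, where C=1])
    fix x :: "real^'n" assume "norm x < 1"
    from poisson_mass[OF this] show "rho x ^ 1 * pot CARD('n) (\<lambda>_. 1) x \<le> 1" by (simp only: power_one_right order_refl)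
  qed
  show "\<forall>\<^sub>F x in bdry. rho x ^ 1 * pot CARD('n) \<tau> x - rho x ^ 1 * pot CARD('n) (\<lambda>_. 1) x * \<tau> (sgn x)
      = rho x * pot CARD('n) \<tau> x - \<tau> (sgn x)"
    unfolding eventually_bdry by (intro exI[of _ "1/2"]) (simp add: poisson_mass)
qed

text \<open>By \<open>cubic_mass\<close> the mass of this kernel tends to 4 / n rather than 1; the
  coefficient n / 4 in the kernel K compensates for it.\<close>

lemma cubic_boundary_limit:
  fixes \<tau> :: "real^'n \<Rightarrow> real"
  assumes \<tau>: "continuous_on (sphere 0 1) \<tau>"
  shows "((\<lambda>x. rho x ^ 3 * pot (CARD('n) + 2) \<tau> x - 4 / real CARD('n) * \<tau> (sgn x)) \<longlongrightarrow> 0) bdry"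
proof (rule Lim_transform_eventually)
  let ?N = "real CARD('n)"
  have C: "rho x ^ 3 * pot (CARD('n) + 2) (\<lambda>_. 1) x \<le> 4 / ?N + \<bar>1 - 4 / ?N\<bar>" if "norm x < 1" for x :: "real^'n"
  proof -
    have "(1 - 4 / ?N) * rho x \<le> \<bar>1 - 4 / ?N\<bar> * 1"
      using that by (intro mult_mono) (auto simp: power_le_one)
    then show ?thesis using cubic_mass[OF that] by simp
  qed
  have "((\<lambda>x. (rho x ^ 3 * pot (CARD('n) + 2) \<tau> x - rho x ^ 3 * pot (CARD('n) + 2) (\<lambda>_. 1) x * \<tau> (sgn x))
        + (1 - 4 / ?N) * rho x * \<tau> (sgn x)) \<longlongrightarrow> 0 + 0) bdry"
    using tendsto_mult[OF tendsto_const[of "1 - 4 / ?N"] rho_bdry]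
    by (intro tendsto_add pot_boundary_limit[OF \<tau> _ C] bdry_mult_bounded[OF \<tau>]) auto
  then show "((\<lambda>x. (rho x ^ 3 * pot (CARD('n) + 2) \<tau> x - rho x ^ 3 * pot (CARD('n) + 2) (\<lambda>_. 1) x * \<tau> (sgn x))
        + (1 - 4 / ?N) * rho x * \<tau> (sgn x)) \<longlongrightarrow> 0) bdry" by simp
  show "\<forall>\<^sub>F x in bdry. (rho x ^ 3 * pot (CARD('n) + 2) \<tau> x - rho x ^ 3 * pot (CARD('n) + 2) (\<lambda>_. 1) x * \<tau> (sgn x))
        + (1 - 4 / ?N) * rho x * \<tau> (sgn x) = rho x ^ 3 * pot (CARD('n) + 2) \<tau> x - 4 / real CARD('n) * \<tau> (sgn x)"
    unfolding eventually_bdry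
  proof (intro exI[of _ "1/2"] conjI allI impI)
    fix x :: "real^'n" assume "1/2 < norm x \<and> norm x < 1"
    then show "(rho x ^ 3 * pot (CARD('n) + 2) \<tau> x - rho x ^ 3 * pot (CARD('n) + 2) (\<lambda>_. 1) x * \<tau> (sgn x))
        + (1 - 4 / ?N) * rho x * \<tau> (sgn x) = rho x ^ 3 * pot (CARD('n) + 2) \<tau> x - 4 / real CARD('n) * \<tau> (sgn x)"
      by (subst cubic_mass) (auto simp: ring_distribs)
  qed auto
qed

text \<open>This is K[phi1] + H[phi2] for scalar data, sorted by the powers of |x - z|;
  \<open>biext_inner\<close> makes the identification.\<close>

definition biext :: "(real^'n \<Rightarrow> real) \<Rightarrow> (real^'n \<Rightarrow> real) \<Rightarrow> real^'n \<Rightarrow> real"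
  where "biext \<phi>1 \<phi>2 x = real CARD('n) / 4 * (rho x ^ 3 * pot (CARD('n) + 2) \<phi>1 x)
    - (real CARD('n) - 4) / 4 * ((rho x)\<^sup>2 * pot CARD('n) \<phi>1 x) + 1 / 2 * ((rho x)\<^sup>2 * pot CARD('n) \<phi>2 x)"

text \<open>The normal derivative of \<open>biext\<close> is never computed: the datum
  \<open>\<phi>2\<close> is tracked through the boundary values of \<open>zop\<close>, so that only
  convergence of the function itself is required. Of the three terms only the cubic one survives at
  the sphere.\<close>

lemma biext_boundary_limit:
  fixes \<phi>1 \<phi>2 :: "real^'n \<Rightarrow> real"
  assumes c: "continuous_on (sphere 0 1) \<phi>1" "continuous_on (sphere 0 1) \<phi>2"
  shows "((\<lambda>x. biext \<phi>1 \<phi>2 x - \<phi>1 (sgn x)) \<longlongrightarrow> 0) bdry"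
proof -
  let ?N = "real CARD('n)"
  have sq: "((\<lambda>x. (rho x)\<^sup>2 * pot CARD('n) \<phi> x) \<longlongrightarrow> 0) bdry"
    if \<phi>: "continuous_on (sphere 0 1) \<phi>" for \<phi> :: "real^'n \<Rightarrow> real"
  proof -
    have "((\<lambda>x. rho x * (rho x * pot CARD('n) \<phi> x - \<phi> (sgn x)) + rho x * \<phi> (sgn x)) \<longlongrightarrow> 0 * 0 + 0) bdry"
      by (intro tendsto_add tendsto_mult rho_bdry poisson_boundary_limit \<phi> bdry_mult_bounded)
    then show ?thesis by (simp add: power2_eq_square algebra_simps)
  qed
  have "((\<lambda>x. ?N / 4 * (rho x ^ 3 * pot (CARD('n) + 2) \<phi>1 x - 4 / ?N * \<phi>1 (sgn x))
    - (?N - 4) / 4 * ((rho x)\<^sup>2 * pot CARD('n) \<phi>1 x) + 1 / 2 * ((rho x)\<^sup>2 * pot CARD('n) \<phi>2 x)) \<longlongrightarrow>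
    ?N / 4 * 0 - (?N - 4) / 4 * 0 + 1 / 2 * 0) bdry"
    by (intro tendsto_intros cubic_boundary_limit sq c)
  moreover have "?N / 4 * (rho x ^ 3 * pot (CARD('n) + 2) \<phi>1 x - 4 / ?N * \<phi>1 (sgn x))
    - (?N - 4) / 4 * ((rho x)\<^sup>2 * pot CARD('n) \<phi>1 x) + 1 / 2 * ((rho x)\<^sup>2 * pot CARD('n) \<phi>2 x)
    = biext \<phi>1 \<phi>2 x - \<phi>1 (sgn x)" for x :: "real^'n"
    unfolding biext_def right_diff_distrib by simp
  ultimately show ?thesis by simp
qed

text \<open>The operator \<open>Z\<close> above, applied to a function \<open>f\<close> with gradient \<open>G\<close> and Laplacian \<open>L\<close>.\<close>
definition zop :: "(real^'n \<Rightarrow> real) \<Rightarrow> (real^'n \<Rightarrow> real^'n) \<Rightarrow> (real^'n \<Rightarrow> real) \<Rightarrow> real^'n \<Rightarrow> real"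
  where "zop f G L x = (8 - 2 * real CARD('n)) * f x - 4 * (x \<bullet> G x) - rho x * L x"

lemma zop_linear:
  "zop (\<lambda>x. a * f x - b * g x + c * h x) (\<lambda>x. a *\<^sub>R F x - b *\<^sub>R G x + c *\<^sub>R H x) (\<lambda>x. a * F' x - b * G' x + c * H' x) x
    = a * zop f F F' x - b * zop g G G' x + c * zop h H H' x"
  unfolding zop_def by (simp add: inner_add_right inner_diff_right algebra_simps)

text \<open>Here r is \<open>rho x\<close>, P and Q are the potentials of orders n + 2 and n + 4,
  and e is the Euler derivative of P. The next lemma is the analogue for orders n and n + 2. Behind
  them: Z annihilates the cubic term and sends \<open>rho\<close>^2 times the potential of order n
  to 8 times a Poisson integral.\<close>

lemma zop_cubic_identity:
  fixes r :: real
  assumes "2 * e = - ((N + 2) * (P - r * Q))"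
  shows "(8 - 2 * N) * (r ^ 3 * P) - 4 * (r ^ 3 * e + P * (- 6 * r\<^sup>2 * (1 - r)))
    - r * (r ^ 3 * ((N + 2) * (N + 2 + 2 - N) * Q) + P * (24 * r - (6 * N + 24) * r\<^sup>2) + 2 * (- 6 * r\<^sup>2 * e)) = 0"
  using assms by algebra

lemma zop_square_identity:
  fixes r :: real
  assumes "2 * e = - (N * (P - r * Q))"
  shows "(8 - 2 * N) * (r\<^sup>2 * P) - 4 * (r\<^sup>2 * e + P * (- 4 * r * (1 - r)))
    - r * (r\<^sup>2 * (N * (N + 2 - N) * Q) + P * (8 - (4 * N + 8) * r) + 2 * (- 4 * r * e)) = 8 * (r * P)"
  using assms by algebra

text \<open>The cubic term is annihilated by Z. The quadratic terms are multiplied by 8, and 8 times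
  -(n - 4) / 4 and 8 times 1 / 2 are the weights 8 - 2 n and 4 of the density on the right.\<close>

lemma glap_biext:
  fixes \<phi>1 \<phi>2 :: "real^'n \<Rightarrow> real"
  assumes c: "continuous_on (sphere 0 1) \<phi>1" "continuous_on (sphere 0 1) \<phi>2"
  obtains G L where "glap (ball 0 1) (biext \<phi>1 \<phi>2) G L"
    "\<And>x. norm x < 1 \<Longrightarrow> zop (biext \<phi>1 \<phi>2) G L x
      = rho x * pot CARD('n) (\<lambda>\<zeta>. (8 - 2 * real CARD('n)) * \<phi>1 \<zeta> + 4 * \<phi>2 \<zeta>) x"
proof -
  let ?N = "real CARD('n)"
  have inner_x: "x \<bullet> x = 1 - rho x" for x :: "real^'n" by (simp add: dot_square_norm)
  obtain G3 L3 where g3: "glap (ball 0 1) (\<lambda>x. rho x ^ 3 * pot (CARD('n) + 2) \<phi>1 x) G3 L3"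
    and z3: "\<And>x. norm x < 1 \<Longrightarrow> zop (\<lambda>x. rho x ^ 3 * pot (CARD('n) + 2) \<phi>1 x) G3 L3 x = 0"
  proof (rule that[OF glap_mult[OF glap_rho3 glap_pot[OF c(1)]]])
    fix x :: "real^'n" assume x: "norm x < 1"
    have e: "2 * (x \<bullet> pot_grad (CARD('n) + 2) \<phi>1 x) = - ((?N + 2) * (pot (CARD('n) + 2) \<phi>1 x - rho x * pot (CARD('n) + 2 + 2) \<phi>1 x))"
      unfolding pot_euler[OF c(1) x, of "CARD('n) + 2"] by simp
    show "zop (\<lambda>x. rho x ^ 3 * pot (CARD('n) + 2) \<phi>1 x)
       (\<lambda>x. rho x ^ 3 *\<^sub>R pot_grad (CARD('n) + 2) \<phi>1 x + pot (CARD('n) + 2) \<phi>1 x *\<^sub>R ((- 6 * (rho x)\<^sup>2) *\<^sub>R x))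
       (\<lambda>x. rho x ^ 3 * (real (CARD('n) + 2) * (real (CARD('n) + 2) + 2 - real CARD('n)) * pot (CARD('n) + 2 + 2) \<phi>1 x) +
             pot (CARD('n) + 2) \<phi>1 x * (24 * rho x - (6 * real CARD('n) + 24) * (rho x)\<^sup>2) +
             2 * ((- 6 * (rho x)\<^sup>2) *\<^sub>R x \<bullet> pot_grad (CARD('n) + 2) \<phi>1 x)) x = 0"
      unfolding zop_def inner_add_right inner_scaleR_right inner_scaleR_left inner_x of_nat_add of_nat_numeral
      by (rule zop_cubic_identity[OF e])
  qed
  have quad: "\<exists>G L. glap (ball 0 1) (\<lambda>x. (rho x)\<^sup>2 * pot CARD('n) \<phi> x) G L
      \<and> (\<forall>x. norm x < 1 \<longrightarrow> zop (\<lambda>x. (rho x)\<^sup>2 * pot CARD('n) \<phi> x) G L x = 8 * (rho x * pot CARD('n) \<phi> x))"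
    if \<phi>: "continuous_on (sphere 0 1) \<phi>" for \<phi> :: "real^'n \<Rightarrow> real"
  proof (rule exI, rule exI, rule conjI[OF glap_mult[OF glap_rho2 glap_pot[OF \<phi>]]], intro allI impI)
    fix x :: "real^'n" assume x: "norm x < 1"
    have e: "2 * (x \<bullet> pot_grad CARD('n) \<phi> x) = - (?N * (pot CARD('n) \<phi> x - rho x * pot (CARD('n) + 2) \<phi> x))"
      unfolding pot_euler[OF \<phi> x, of "CARD('n)"] by simp
    show "zop (\<lambda>x. (rho x)\<^sup>2 * pot CARD('n) \<phi> x)
       (\<lambda>x. (rho x)\<^sup>2 *\<^sub>R pot_grad CARD('n) \<phi> x + pot CARD('n) \<phi> x *\<^sub>R ((- 4 * rho x) *\<^sub>R x))
       (\<lambda>x. (rho x)\<^sup>2 * (real CARD('n) * (real CARD('n) + 2 - real CARD('n)) * pot (CARD('n) + 2) \<phi> x) +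
             pot CARD('n) \<phi> x * (8 - (4 * real CARD('n) + 8) * rho x) +
             2 * ((- 4 * rho x) *\<^sub>R x \<bullet> pot_grad CARD('n) \<phi> x)) x = 8 * (rho x * pot CARD('n) \<phi> x)"
      unfolding zop_def inner_add_right inner_scaleR_right inner_scaleR_left inner_x of_nat_add of_nat_numeral
      by (rule zop_square_identity[OF e])
  qed
  obtain G1 L1 where g1: "glap (ball 0 1) (\<lambda>x. (rho x)\<^sup>2 * pot CARD('n) \<phi>1 x) G1 L1"
    and z1: "\<And>x. norm x < 1 \<Longrightarrow> zop (\<lambda>x. (rho x)\<^sup>2 * pot CARD('n) \<phi>1 x) G1 L1 x = 8 * (rho x * pot CARD('n) \<phi>1 x)"
    using quad[OF c(1)] by blast
  obtain G2 L2 where g2: "glap (ball 0 1) (\<lambda>x. (rho x)\<^sup>2 * pot CARD('n) \<phi>2 x) G2 L2"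
    and z2: "\<And>x. norm x < 1 \<Longrightarrow> zop (\<lambda>x. (rho x)\<^sup>2 * pot CARD('n) \<phi>2 x) G2 L2 x = 8 * (rho x * pot CARD('n) \<phi>2 x)"
    using quad[OF c(2)] by blast
  show thesis
  proof (rule that[OF glap_eq[OF glap_add[OF glap_diff[OF glap_cmult[OF g3, of "?N / 4"] glap_cmult[OF g1, of "(?N - 4) / 4"]] glap_cmult[OF g2, of "1 / 2"]] _ refl refl]])
    fix x :: "real^'n" assume x: "norm x < 1"
    have "zop (biext \<phi>1 \<phi>2) (\<lambda>x. (?N / 4) *\<^sub>R G3 x - ((?N - 4) / 4) *\<^sub>R G1 x + (1 / 2) *\<^sub>R G2 x)
        (\<lambda>x. ?N / 4 * L3 x - (?N - 4) / 4 * L1 x + 1 / 2 * L2 x) x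
      = ?N / 4 * zop (\<lambda>x. rho x ^ 3 * pot (CARD('n) + 2) \<phi>1 x) G3 L3 x
        - (?N - 4) / 4 * zop (\<lambda>x. (rho x)\<^sup>2 * pot CARD('n) \<phi>1 x) G1 L1 x
        + 1 / 2 * zop (\<lambda>x. (rho x)\<^sup>2 * pot CARD('n) \<phi>2 x) G2 L2 x"
      unfolding biext_def[abs_def] by (rule zop_linear)
    also have "\<dots> = (8 - 2 * ?N) * (rho x * pot CARD('n) \<phi>1 x) + 4 * (rho x * pot CARD('n) \<phi>2 x)"
      unfolding z1[OF x] z2[OF x] z3[OF x] by (simp add: field_simps)
    also have "\<dots> = rho x * pot CARD('n) (\<lambda>\<zeta>. (8 - 2 * ?N) * \<phi>1 \<zeta> + 4 * \<phi>2 \<zeta>) x"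
      unfolding pot_linear[OF c x] by algebra
    finally show "zop (biext \<phi>1 \<phi>2) (\<lambda>x. (?N / 4) *\<^sub>R G3 x - ((?N - 4) / 4) *\<^sub>R G1 x + (1 / 2) *\<^sub>R G2 x)
        (\<lambda>x. ?N / 4 * L3 x - (?N - 4) / 4 * L1 x + 1 / 2 * L2 x) x
      = rho x * pot CARD('n) (\<lambda>\<zeta>. (8 - 2 * ?N) * \<phi>1 \<zeta> + 4 * \<phi>2 \<zeta>) x" .
  qed (simp add: biext_def)
qed

subsection \<open>The estimate for functions regular up to the boundary\<close>

text \<open>
  If \<open>q = V / \<rho>\<close> had a negative interior minimum then \<open>8 q - \<rho>\<^sup>2 \<Delta>q = zop V\<close> would be negative
  there.  As \<open>V \<longlongrightarrow> 0\<close> does not bound \<open>V / \<rho>\<close>, the supersolution \<open>1 + n \<rho> / 4\<close> is added first.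
\<close>
lemma zop_minimum_principle:
  fixes V :: "real^'n \<Rightarrow> real"
  assumes gl: "glap (ball 0 1) V G L" and z: "\<And>x. norm x < 1 \<Longrightarrow> zop V G L x \<ge> 0"
    and lim: "(V \<longlongrightarrow> 0) bdry" and x0: "norm x0 < 1"
  shows "V x0 \<ge> 0"
proof (rule ccontr)
  assume neg: "\<not> V x0 \<ge> 0"
  let ?N = "real CARD('n)"
  have inner_x: "x \<bullet> x = 1 - rho x" for x :: "real^'n" by (simp add: dot_square_norm)
  \<comment> \<open>As \<open>rho\<close> is at most 1, the perturbation adds at most -V(x0) / 2 at
    x0, which leaves F(x0) negative.\<close>
  define e where "e = - V x0 / (2 * (1 + ?N / 4))"
  have e: "e > 0" using neg by (simp add: e_def divide_neg_pos add_pos_pos)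
  define F where "F x = V x + e * (1 + ?N / 4 * rho x)" for x
  define GF where "GF x = G x + e *\<^sub>R (0 + (?N / 4) *\<^sub>R (-2) *\<^sub>R x)" for x
  define LF where "LF x = L x + e * (0 + ?N / 4 * (- 2 * ?N))" for x
  have glF: "glap (ball 0 1) F GF LF"
    unfolding F_def[abs_def] GF_def[abs_def] LF_def[abs_def]
    by (intro glap_add glap_cmult glap_const glap_rho gl)
  have zF: "zop F GF LF x \<ge> 8 * e" if "norm x < 1" for x
  proof -
    \<comment> \<open>Z maps 1 + n \<open>rho\<close> / 4 to the constant 8, and this function stays
      at least 1 up to the sphere.\<close>
    have "zop F GF LF x = zop V G L x + 8 * e"
      unfolding zop_def F_def GF_def LF_def inner_add_right inner_scaleR_right inner_zero_right inner_x
      by (simp add: field_simps)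
    then show ?thesis using z[OF that] by simp
  qed
  have "\<forall>\<^sub>F x in bdry. \<bar>V x\<bar> < e" using tendstoD[OF lim e] by (simp add: dist_real_def)
  then obtain s0 where s0: "s0 < 1" "\<And>x. s0 < norm x \<Longrightarrow> norm x < 1 \<Longrightarrow> \<bar>V x\<bar> < e"
    unfolding eventually_bdry by blast
  define s where "s = (1 + max s0 (norm x0)) / 2"
  have s: "s0 < s" "norm x0 < s" "s < 1" using s0 x0 by (auto simp: s_def)
  have rho_pos: "rho x > 0" if "norm x \<le> s" for x :: "real^'n"
    using that s abs_square_less_1[of "norm x"] by simp
  have Fs: "F x > 0" if "norm x = s" for x
  proof -
    have "0 \<le> e * (?N / 4 * rho x)" using e rho_pos[of x] that by simp
    then show ?thesis using s0(2)[of x] that s by (simp add: F_def ring_distribs)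
  qed
  have Fx0: "F x0 < 0"
  proof -
    have "e * (1 + ?N / 4 * rho x0) \<le> e * (1 + ?N / 4 * 1)"
      using e by (intro mult_left_mono add_left_mono) auto
    also have "\<dots> = - V x0 / 2" by (simp add: e_def field_simps add_pos_pos)
    finally show ?thesis using neg by (simp add: F_def)
  qed
  have cq: "continuous_on (cball 0 s) (\<lambda>x. F x / rho x)"
  proof (rule continuous_on_divide)
    show "continuous_on (cball 0 s) F"
      by (rule continuous_on_subset[OF glap_continuous(1)[OF glF]]) (use s in auto)
    show "continuous_on (cball (0 :: real^'n) s) rho" by (intro continuous_intros)
    show "\<forall>x\<in>cball (0 :: real^'n) s. rho x \<noteq> 0" using rho_pos by (metis less_irrefl mem_cball_0)
  qed
  have "0 \<le> s" using s(2) norm_ge_zero[of x0] by linarith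
  then have "cball 0 s \<noteq> ({} :: (real^'n) set)" by simp
  from continuous_attains_inf[OF compact_cball this cq]
  obtain x1 where x1: "x1 \<in> cball 0 s" "\<And>x. x \<in> cball 0 s \<Longrightarrow> F x1 / rho x1 \<le> F x / rho x"
    by blast
  define q where "q = F x1 / rho x1"
  have r1: "rho x1 > 0" using rho_pos x1(1) by simp
  have Fq: "F x1 = q * rho x1" using r1 by (simp add: q_def)
  have q: "q < 0"
  proof -
    have "q \<le> F x0 / rho x0" using x1(2)[of x0] s by (simp add: q_def)
    also have "\<dots> < 0" using Fx0 rho_pos[of x0] s by (simp add: divide_neg_pos)
    finally show ?thesis .
  qed
  have "norm x1 \<noteq> s"
    using Fs[of x1] Fq q r1 by (metis mult_neg_pos order_less_asym)
  then have in1: "x1 \<in> ball 0 s" using x1(1) by auto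
  \<comment> \<open>With q frozen at the minimal quotient, F - q \<open>rho\<close> is nonnegative
    and vanishes at x1. Its minimum there gives the needed information on F without differentiating
    a quotient.\<close>
  have glm: "glap (ball 0 s) (\<lambda>x. F x - q * rho x) (\<lambda>x. GF x - q *\<^sub>R (-2) *\<^sub>R x) (\<lambda>x. LF x - q * (- 2 * ?N))"
    by (intro glap_diff glap_cmult glap_rho glap_subset[OF glF]) (use s in auto)
  have min: "F x1 - q * rho x1 \<le> F y - q * rho y" if "y \<in> ball 0 s" for y
  proof -
    have "q \<le> F y / rho y" using x1(2)[of y] that by (simp add: q_def)
    then show ?thesis using rho_pos[of y] that Fq by (simp add: pos_le_divide_eq)
  qed
  have "GF x1 - q *\<^sub>R (-2) *\<^sub>R x1 = 0" and "LF x1 - q * (- 2 * ?N) \<ge> 0"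
    using glap_local_min[OF glm open_ball in1 min] by auto
  then have GF1: "GF x1 = (-2 * q) *\<^sub>R x1" and LF1: "LF x1 \<ge> - 2 * q * ?N"
    by (auto simp: eq_neg_iff_add_eq_0 algebra_simps)
  have "zop F GF LF x1 = (8 - 2 * ?N) * (q * rho x1) + 8 * q * (1 - rho x1) - rho x1 * LF x1"
    unfolding zop_def Fq GF1 inner_scaleR_right inner_x by simp
  also have "\<dots> \<le> (8 - 2 * ?N) * (q * rho x1) + 8 * q * (1 - rho x1) - rho x1 * (- 2 * q * ?N)"
    using mult_left_mono[OF LF1 less_imp_le[OF r1]] by linarith
  also have "\<dots> = 8 * q" by (simp only: ring_distribs) (simp add: algebra_simps)
  finally show False using zF[of x1] in1 s q e by simp
qed

text \<open>The quotient is a mean value of the l-derivative of l^k f(l x), which equals k f + x . G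
  at l = 1; since R > 1 that derivative is uniformly continuous on [0, 1] times the closed unit
  ball. It is applied with k = 0 to u and with k = 2 to its Laplacian, because the Laplacian of u(l
  x) carries the factor l^2.\<close>

lemma dilation_quotient_limit:
  fixes f :: "real^'n \<Rightarrow> real"
  assumes gl: "glap (ball 0 R) f G L" and R: "R > 1" and e: "e > 0"
  shows "\<forall>\<^sub>F l in at_left 1. \<forall>x\<in>cball 0 1.
    \<bar>(l ^ k * f (l *\<^sub>R x) - f x) / (l - 1) - (real k * f x + x \<bullet> G x)\<bar> \<le> e"
proof -
  define H where "H = (\<lambda>(t, x). real k * t ^ (k - 1) * f (t *\<^sub>R x) + t ^ k * (x \<bullet> G (t *\<^sub>R x)))"
  have inR: "t *\<^sub>R x \<in> ball 0 R" if "0 \<le> t" "t \<le> 1" "norm x \<le> 1" for t :: real and x :: "real^'n"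
    using that R mult_mono[of t 1 "norm x" 1] by simp
  have "continuous_on ({0..1} \<times> cball 0 1) H"
    unfolding H_def case_prod_beta
    by (intro continuous_intros continuous_on_compose2[OF glap_continuous(1)[OF gl]]
        continuous_on_compose2[OF glap_continuous(2)[OF gl]]) (auto intro!: inR simp del: mem_ball)
  then have "uniformly_continuous_on ({0..1} \<times> cball 0 1) H"
    by (intro compact_uniformly_continuous compact_Times) auto
  from uniformly_continuous_onE[OF this e] obtain d where d: "d > 0"
    "\<And>u v. u \<in> {0..1} \<times> cball 0 1 \<Longrightarrow> v \<in> {0..1} \<times> cball 0 1 \<Longrightarrow> dist v u < d \<Longrightarrow> dist (H v) (H u) < e" by metis
  show ?thesis
    unfolding eventually_at_left_field
  proof (intro exI[of _ "max 0 (1 - d)"] conjI allI impI ballI)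
    fix l :: real and x :: "real^'n" assume l: "max 0 (1 - d) < l" "l < 1" and x: "x \<in> cball 0 1"
    have der: "((\<lambda>t. t ^ k * f (t *\<^sub>R x)) has_real_derivative H (t, x)) (at t)" if t: "l \<le> t" "t \<le> 1" for t
    proof -
      have tx: "t *\<^sub>R x \<in> ball 0 R" using inR[of t x] t l x by simp
      have path: "((\<lambda>t. t *\<^sub>R x) has_derivative (\<lambda>h. h *\<^sub>R x)) (at t)"
        by (auto intro!: derivative_eq_intros)
      have "((\<lambda>t. f (t *\<^sub>R x)) has_real_derivative x \<bullet> G (t *\<^sub>R x)) (at t)"
        using has_derivative_compose[OF path glap_deriv[OF gl tx]]
        by (simp add: has_field_derivative_def mult_commute_abs inner_commute)
      from DERIV_mult[OF DERIV_pow this] show ?thesis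
        by (simp add: H_def mult_ac)
    qed
    obtain \<xi> where \<xi>: "l < \<xi>" "\<xi> < 1" "1 ^ k * f (1 *\<^sub>R x) - l ^ k * f (l *\<^sub>R x) = (1 - l) * H (\<xi>, x)"
      using MVT2[of l 1 "\<lambda>t. t ^ k * f (t *\<^sub>R x)" "\<lambda>t. H (t, x)"] der l by auto
    then have "(l ^ k * f (l *\<^sub>R x) - f x) / (l - 1) = H (\<xi>, x)"
      using l by (simp add: divide_eq_eq algebra_simps)
    moreover have "dist (H (\<xi>, x)) (H (1, x)) < e"
      using \<xi> l x by (intro d(2)) (auto simp: dist_Pair_Pair dist_real_def)
    ultimately show "\<bar>(l ^ k * f (l *\<^sub>R x) - f x) / (l - 1) - (real k * f x + x \<bullet> G x)\<bar> \<le> e"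
      by (simp add: H_def dist_real_def)
  qed (use d in auto)
qed

text \<open>The function y is Z applied to V = M' \<open>rho\<close>^2 - u + \<open>biext\<close>.
  Formally its Laplacian is \<open>rho\<close> (w - M), which is nonpositive, and its boundary limit
  is 0 because u and \<open>biext\<close> share both data; so y is nonnegative. Then
  \<open>zop_minimum_principle\<close> passes from Z V = y to V itself.\<close>

theorem biharmonic_upper_estimate:
  fixes u :: "real^'n \<Rightarrow> real"
  assumes R: "R > 1" and glu: "glap (ball 0 R) u G L" and glL: "glap (ball 0 R) L G' w"
    and w: "\<And>x. norm x < 1 \<Longrightarrow> w x \<le> M" and x0: "norm x0 < 1"
  shows "u x0 - biext u (\<lambda>\<zeta>. - (\<zeta> \<bullet> G \<zeta>)) x0
    \<le> M / (8 * real CARD('n) * (real CARD('n) + 2)) * (rho x0)\<^sup>2"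
proof -
  let ?N = "real CARD('n)"
  have N: "?N > 0" by simp
  have inner_x: "x \<bullet> x = 1 - rho x" for x :: "real^'n" by (simp add: dot_square_norm)
  define M' where "M' = M / (8 * ?N * (?N + 2))"
  have M': "M' * (8 * ?N * (?N + 2)) = M" using N by (simp add: M'_def)
  have sub: "cball 0 1 \<subseteq> ball (0::real^'n) R" "ball 0 1 \<subseteq> ball (0::real^'n) R" "sphere 0 1 \<subseteq> cball (0::real^'n) 1"
    using R by auto
  note glu1 = glap_subset[OF glu sub(2)] and glL1 = glap_subset[OF glL sub(2)]
  define \<phi>2 where "\<phi>2 \<zeta> = - (\<zeta> \<bullet> G \<zeta>)" for \<zeta>
  define \<tau> where "\<tau> \<zeta> = (8 - 2 * ?N) * u \<zeta> + 4 * \<phi>2 \<zeta>" for \<zeta>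
  have cu: "continuous_on (cball 0 1) u" and cG: "continuous_on (cball 0 1) G" and cL: "continuous_on (cball 0 1) L"
    using glap_continuous[OF glu] glap_continuous[OF glL] sub continuous_on_subset by blast+
  have c1: "continuous_on (sphere 0 1) u" and c2: "continuous_on (sphere 0 1) \<phi>2"
    unfolding \<phi>2_def using cu cG sub by (auto intro!: continuous_intros intro: continuous_on_subset)
  have c\<tau>: "continuous_on (sphere 0 1) \<tau>" unfolding \<tau>_def by (intro continuous_intros c1 c2)
  define zu where "zu = zop u G L"
  have czu: "continuous_on (cball 0 1) zu"
    unfolding zu_def zop_def[abs_def] by (intro continuous_intros cu cG cL)
  have zu\<tau>: "zu \<zeta> = \<tau> \<zeta>" if "norm \<zeta> = 1" for \<zeta>
    using that by (simp add: zu_def zop_def \<tau>_def \<phi>2_def)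
  \<comment> \<open>The first summand is Z of M' \<open>rho\<close>^2, the second Z of
    \<open>biext\<close>.\<close>
  define A where "A x = M' * (2 * ?N * (rho x)\<^sup>2 + 8 * rho x) + rho x * pot CARD('n) \<tau> x" for x :: "real^'n"
  define y where "y x = A x - zu x" for x
  have ylim: "(y \<longlongrightarrow> 0) bdry"
  proof (rule Lim_transform_eventually)
    have "((\<lambda>x. M' * (2 * ?N * (rho x)\<^sup>2 + 8 * rho x) + (rho x * pot CARD('n) \<tau> x - \<tau> (sgn x)) - (zu x - zu (sgn x)))
      \<longlongrightarrow> M' * (2 * ?N * 0\<^sup>2 + 8 * 0) + 0 - 0) bdry"
      by (intro tendsto_intros rho_bdry poisson_boundary_limit[OF c\<tau>] uniform_boundary_limit[OF czu])
    then show "((\<lambda>x. M' * (2 * ?N * (rho x)\<^sup>2 + 8 * rho x) + (rho x * pot CARD('n) \<tau> x - \<tau> (sgn x)) - (zu x - zu (sgn x)))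
      \<longlongrightarrow> 0) bdry" by simp
    show "\<forall>\<^sub>F x in bdry. M' * (2 * ?N * (rho x)\<^sup>2 + 8 * rho x) + (rho x * pot CARD('n) \<tau> x - \<tau> (sgn x)) - (zu x - zu (sgn x)) = y x"
      unfolding eventually_bdry by (intro exI[of _ "1/2"]) (auto simp: y_def A_def norm_sgn intro!: zu\<tau>)
  qed
  have y_nonneg: "y x1 \<ge> 0" if x1: "norm x1 < 1" for x1
  proof (rule field_le_epsilon)
    fix e' :: real assume "e' > 0"
    \<comment> \<open>The errors add up to 13 e: on the boundary sphere e for y and 4 e for the
      passage to \<open>yl\<close>, then 4 e for the Laplacian, then 4 e for the return to
      y.\<close>
    define e where "e = e' / 13"
    have e: "e > 0" using \<open>e' > 0\<close> by (simp add: e_def)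
    have "\<forall>\<^sub>F l in at_left (1::real). (\<forall>x\<in>cball 0 1. \<bar>(l ^ 0 * u (l *\<^sub>R x) - u x) / (l - 1) - (real 0 * u x + x \<bullet> G x)\<bar> \<le> e)
        \<and> (\<forall>x\<in>cball 0 1. \<bar>(l ^ 2 * L (l *\<^sub>R x) - L x) / (l - 1) - (real 2 * L x + x \<bullet> G' x)\<bar> \<le> e) \<and> 0 < l \<and> l < 1"
      using dilation_quotient_limit[OF glu R e, of 0] dilation_quotient_limit[OF glL R e, of 2]
      by (intro eventually_conj) (auto simp: eventually_at_left_field intro: exI[of _ 0])
    from eventually_happens[OF this] obtain l where l: "0 < l" "l < 1"
      and qu: "\<And>x. x \<in> cball 0 1 \<Longrightarrow> \<bar>(u (l *\<^sub>R x) - u x) / (l - 1) - x \<bullet> G x\<bar> \<le> e"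
      and qL: "\<And>x. x \<in> cball 0 1 \<Longrightarrow> \<bar>(l\<^sup>2 * L (l *\<^sub>R x) - L x) / (l - 1) - (2 * L x + x \<bullet> G' x)\<bar> \<le> e"
      by (auto simp: trivial_limit_at_left_real)
    define c where "c = 1 / (l - 1)"
    \<comment> \<open>\<open>zop u\<close> contains first derivatives of \<open>u\<close>, and \<open>u\<close> need not be \<open>C\<^sup>3\<close>: replacing \<open>x \<bullet> \<nabla>u\<close> by the difference
        quotient of a dilation makes the Laplacian classical.\<close>
    define yl where "yl x = A x - ((8 - 2 * ?N) * u x - 4 * (c * (u (l *\<^sub>R x) - u x)) - rho x * L x)" for x
    define Ll where "Ll x = M' * (2 * ?N * (8 - (4 * ?N + 8) * rho x) + 8 * (- 2 * ?N)) + 0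
        - ((8 - 2 * ?N) * L x - 4 * (c * (l\<^sup>2 * L (l *\<^sub>R x) - L x))
           - (rho x * w x + L x * (- 2 * ?N) + 2 * ((-2) *\<^sub>R x \<bullet> G' x)))" for x
    have glul: "glap (ball 0 1) (\<lambda>x. u (l *\<^sub>R x)) (\<lambda>x. l *\<^sub>R G (l *\<^sub>R x)) (\<lambda>x. l\<^sup>2 * L (l *\<^sub>R x))"
    proof (rule glap_compose_scaleR[OF glu])
      fix x :: "real^'n" assume "x \<in> ball 0 1"
      then have "l * norm x < 1" using l mult_strict_mono[of l 1 "norm x" 1] by simp
      then show "l *\<^sub>R x \<in> ball 0 R" using l R by simp
    qed
    note glA = glap_add[OF glap_cmult[where c=M', OF glap_add[OF glap_cmult[where c="2 * ?N", OF glap_rho2]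
          glap_cmult[where c=8, OF glap_rho]]] glap_poisson[OF c\<tau>]]
    note glB = glap_diff[OF glap_diff[OF glap_cmult[where c="8 - 2 * ?N", OF glu1]
          glap_cmult[where c=4, OF glap_cmult[where c=c, OF glap_diff[OF glul glu1]]]] glap_mult[OF glap_rho glL1]]
    obtain Gl where gl: "glap (ball 0 1) yl Gl Ll"
      using glap_diff[OF glA glB] unfolding yl_def[abs_def] Ll_def[abs_def] A_def[abs_def] by blast
    have Ll: "Ll x \<le> 4 * e" if "norm x < 1" for x
    proof -
      \<comment> \<open>The cancellation that determines the coefficients of Z, with the difference
        quotient in place of 2 L + x . grad L.\<close>
      have h1: "Ll x = rho x * (w x - M' * (8 * ?N * (?N + 2))) + 4 * (c * (l\<^sup>2 * L (l *\<^sub>R x) - L x) - (2 * L x + x \<bullet> G' x))"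
        by (simp add: Ll_def algebra_simps)
      have h2: "rho x * (w x - M' * (8 * ?N * (?N + 2))) \<le> 0"
        unfolding M' using w[OF that] that by (intro mult_nonneg_nonpos) (auto simp: power_le_one)
      have h3: "c * (l\<^sup>2 * L (l *\<^sub>R x) - L x) - (2 * L x + x \<bullet> G' x) \<le> e"
        using qL[of x] that by (simp add: c_def)
      show ?thesis unfolding h1 using add_mono[OF h2 mult_left_mono[OF h3, of 4]] by simp
    qed
    have yly: "\<bar>yl x - y x\<bar> \<le> 4 * e" if "norm x < 1" for x
    proof -
      have eq: "yl x - y x = 4 * (c * (u (l *\<^sub>R x) - u x) - x \<bullet> G x)"
        by (simp add: yl_def y_def zu_def zop_def algebra_simps)
      have "\<bar>c * (u (l *\<^sub>R x) - u x) - x \<bullet> G x\<bar> \<le> e" using qu[of x] that by (simp add: c_def)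
      then show ?thesis unfolding eq abs_mult by simp
    qed
    have "\<forall>\<^sub>F x in bdry. \<bar>y x\<bar> < e" using tendstoD[OF ylim e] by (simp add: dist_real_def)
    then obtain s0 where s0: "s0 < 1" "\<And>x. s0 < norm x \<Longrightarrow> norm x < 1 \<Longrightarrow> \<bar>y x\<bar> < e"
      unfolding eventually_bdry by blast
    define s where "s = (1 + max s0 (norm x1)) / 2"
    have s: "s0 < s" "norm x1 < s" "s < 1" using s0 x1 by (auto simp: s_def)
    have "yl x1 \<ge> - 5 * e - 4 * e"
    proof (rule superharmonic_min[OF glap_subset[OF gl], of s])
      show "continuous_on (cball 0 s) yl"
        using glap_continuous(1)[OF gl] by (rule continuous_on_subset) (use s in auto)
      show "- 5 * e \<le> yl x" if "norm x = s" for x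
        using s0(2)[of x] yly[of x] s that by (simp add: abs_le_iff abs_less_iff)
      show "0 \<le> s" using s norm_ge_zero[of x1] by linarith
    qed (use s e Ll in auto)
    moreover have "yl x1 - y x1 \<le> 4 * e" using yly[OF x1] by linarith
    moreover have "13 * e = e'" by (simp add: e_def)
    ultimately show "0 \<le> y x1 + e'" by linarith
  qed
  obtain Gb Lb where glb: "glap (ball 0 1) (biext u \<phi>2) Gb Lb"
    and zb: "\<And>x. norm x < 1 \<Longrightarrow> zop (biext u \<phi>2) Gb Lb x = rho x * pot CARD('n) \<tau> x"
    using glap_biext[OF c1 c2] unfolding \<tau>_def[abs_def] by blast
  define V where "V x = M' * (rho x)\<^sup>2 - 1 * u x + 1 * biext u \<phi>2 x" for x
  have "V x0 \<ge> 0"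
  proof (rule zop_minimum_principle[OF _ _ _ x0])
    show "glap (ball 0 1) V (\<lambda>x. M' *\<^sub>R (- 4 * rho x) *\<^sub>R x - 1 *\<^sub>R G x + 1 *\<^sub>R Gb x)
       (\<lambda>x. M' * (8 - (4 * ?N + 8) * rho x) - 1 * L x + 1 * Lb x)"
      unfolding V_def[abs_def]
      by (intro glap_diff glap_add glap_cmult glap_rho2 glu1 glb)
    fix x :: "real^'n" assume x: "norm x < 1"
    have "zop (\<lambda>x. (rho x)\<^sup>2) (\<lambda>x. (- 4 * rho x) *\<^sub>R x) (\<lambda>x. 8 - (4 * ?N + 8) * rho x) x
       = 2 * ?N * (rho x)\<^sup>2 + 8 * rho x"
      unfolding zop_def inner_scaleR_right inner_x by algebra
    then have "zop V (\<lambda>x. M' *\<^sub>R (- 4 * rho x) *\<^sub>R x - 1 *\<^sub>R G x + 1 *\<^sub>R Gb x)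
       (\<lambda>x. M' * (8 - (4 * ?N + 8) * rho x) - 1 * L x + 1 * Lb x) x = y x"
      unfolding V_def[abs_def] zop_linear zb[OF x] by (simp add: y_def A_def zu_def)
    then show "zop V (\<lambda>x. M' *\<^sub>R (- 4 * rho x) *\<^sub>R x - 1 *\<^sub>R G x + 1 *\<^sub>R Gb x)
       (\<lambda>x. M' * (8 - (4 * ?N + 8) * rho x) - 1 * L x + 1 * Lb x) x \<ge> 0" using y_nonneg[OF x] by simp
  next
    have "((\<lambda>x. M' * (rho x)\<^sup>2 - (u x - u (sgn x)) + (biext u \<phi>2 x - u (sgn x))) \<longlongrightarrow> M' * 0\<^sup>2 - 0 + 0) bdry"
      by (intro tendsto_intros rho_bdry uniform_boundary_limit[OF cu] biext_boundary_limit c1 c2)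
    then show "(V \<longlongrightarrow> 0) bdry" by (simp add: V_def[abs_def] algebra_simps)
  qed
  then show ?thesis by (simp add: V_def M'_def \<phi>2_def[abs_def])
qed

lemma biext_uminus:
  fixes \<phi>1 \<phi>2 :: "real^'n \<Rightarrow> real"
  shows "biext (\<lambda>\<zeta>. - \<phi>1 \<zeta>) (\<lambda>\<zeta>. - \<phi>2 \<zeta>) x = - biext \<phi>1 \<phi>2 x"
  by (simp add: biext_def pot_def)

theorem biharmonic_estimate:
  fixes u :: "real^'n \<Rightarrow> real"
  assumes R: "R > 1" and glu: "glap (ball 0 R) u G L" and glL: "glap (ball 0 R) L G' w"
    and w: "\<And>x. norm x < 1 \<Longrightarrow> \<bar>w x\<bar> \<le> M" and x: "norm x < 1"
  shows "\<bar>u x - biext u (\<lambda>\<zeta>. - (\<zeta> \<bullet> G \<zeta>)) x\<bar>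
    \<le> M / (8 * real CARD('n) * (real CARD('n) + 2)) * (rho x)\<^sup>2"
proof -
  have "u x - biext u (\<lambda>\<zeta>. - (\<zeta> \<bullet> G \<zeta>)) x
    \<le> M / (8 * real CARD('n) * (real CARD('n) + 2)) * (rho x)\<^sup>2"
    using w by (intro biharmonic_upper_estimate[OF R glu glL _ x]) (auto simp: abs_le_iff)
  moreover have "(- 1 * u x) - biext (\<lambda>\<zeta>. - 1 * u \<zeta>) (\<lambda>\<zeta>. - (\<zeta> \<bullet> (- 1 *\<^sub>R G \<zeta>))) x
    \<le> M / (8 * real CARD('n) * (real CARD('n) + 2)) * (rho x)\<^sup>2"
    using w by (intro biharmonic_upper_estimate[OF R glap_cmult[OF glu] glap_cmult[OF glL] _ x]) (auto simp: abs_le_iff)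
  moreover have "biext (\<lambda>\<zeta>. - 1 * u \<zeta>) (\<lambda>\<zeta>. - (\<zeta> \<bullet> (- 1 *\<^sub>R G \<zeta>))) x = - biext u (\<lambda>\<zeta>. - (\<zeta> \<bullet> G \<zeta>)) x"
    using biext_uminus[of u "\<lambda>\<zeta>. - (\<zeta> \<bullet> G \<zeta>)" x] by simp
  ultimately show ?thesis by linarith
qed

subsection \<open>Functions of class $C^k$\<close>

lemma partial_eq:
  assumes "(f has_derivative D) (at x)"
  shows "partial j f x = D (axis j 1)"
proof -
  have path: "((\<lambda>t. x + t *\<^sub>R axis j 1) has_derivative (\<lambda>t. t *\<^sub>R axis j 1)) (at 0)"
    by (auto intro!: derivative_eq_intros)
  have "((\<lambda>t. f (x + t *\<^sub>R axis j 1)) has_derivative (\<lambda>t. D (t *\<^sub>R axis j 1))) (at 0)"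
    using has_derivative_compose[OF path, of f D] assms by simp
  then have "((\<lambda>t. f (x + t *\<^sub>R axis j 1)) has_vector_derivative D (axis j 1)) (at 0)"
    by (simp add: has_vector_derivative_def linear_scale[OF has_derivative_linear[OF assms]])
  then show ?thesis unfolding partial_def by (rule vector_derivative_at)
qed

lemma has_derivative_partial:
  fixes f :: "real^'n \<Rightarrow> 'b::real_normed_vector"
  assumes "f differentiable (at x)"
  shows "(f has_derivative (\<lambda>h. \<Sum>j\<in>UNIV. (h $ j) *\<^sub>R partial j f x)) (at x)"
proof -
  obtain D where D: "(f has_derivative D) (at x)" using assms by (auto simp: differentiable_def)
  have lin: "linear D" using D by (rule has_derivative_linear)
  have "D = (\<lambda>h. \<Sum>j\<in>UNIV. (h $ j) *\<^sub>R partial j f x)"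
  proof (rule ext)
    fix h :: "real^'n"
    have "h = (\<Sum>j\<in>UNIV. (h $ j) *\<^sub>R axis j 1)"
      using basis_expansion[of h] by (simp add: scalar_mult_eq_scaleR)
    then have "D h = D (\<Sum>j\<in>UNIV. (h $ j) *\<^sub>R axis j 1)" by simp
    then show "D h = (\<Sum>j\<in>UNIV. (h $ j) *\<^sub>R partial j f x)"
      by (simp add: linear_sum[OF lin] linear_scale[OF lin] partial_eq[OF D])
  qed
  then show ?thesis using D by simp
qed

lemma partial_cong:
  assumes "open S" "x \<in> S" "\<And>y. y \<in> S \<Longrightarrow> f y = g y"
  shows "partial j f x = partial j g x"
proof -
  have "((\<lambda>t. x + t *\<^sub>R axis j 1) \<longlongrightarrow> x + 0 *\<^sub>R axis j 1) (nhds 0)"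
    by (intro tendsto_intros filterlim_ident)
  then have "\<forall>\<^sub>F t in nhds 0. x + t *\<^sub>R axis j 1 \<in> S"
    using assms(1,2) by (intro topological_tendstoD) auto
  then have "\<forall>\<^sub>F t in nhds 0. f (x + t *\<^sub>R axis j 1) = g (x + t *\<^sub>R axis j 1)"
    by eventually_elim (use assms(3) in auto)
  then show ?thesis unfolding partial_def by (intro vector_derivative_cong_eq) (auto simp: eventually_nhds_conv_at)
qed

lemma differentiable_cong_open:
  assumes "open S" "x \<in> S" "\<And>y. y \<in> S \<Longrightarrow> f y = g y" "f differentiable (at x)"
  shows "g differentiable (at x)"
  using assms has_derivative_transform_within_open unfolding differentiable_def by metis

lemma Ck_on_congI:
  assumes "open S" "\<And>x. x \<in> S \<Longrightarrow> f x = g x" "Ck_on k S f"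
  shows "Ck_on k S g"
  using assms(2,3)
proof (induction k arbitrary: f g)
  case 0
  then show ?case by (simp cong: continuous_on_cong)
next
  case (Suc k)
  show ?case
    unfolding Ck_on.simps
  proof (intro conjI ballI allI)
    fix x assume "x \<in> S"
    moreover from this have "f differentiable at x" using Suc.prems(2) by simp
    ultimately show "g differentiable at x"
      using differentiable_cong_open[OF assms(1)] Suc.prems(1) by blast
  next
    fix j
    have "Ck_on k S (partial j f)" using Suc.prems(2) by simp
    then show "Ck_on k S (partial j g)"
    proof (rule Suc.IH[rotated])
      show "partial j f x = partial j g x" if "x \<in> S" for x
        by (rule partial_cong[OF assms(1) that Suc.prems(1)])
    qed
  qed
qed

lemma Ck_on_continuous: "Ck_on k S f \<Longrightarrow> continuous_on S f"
  by (cases k) (auto intro: continuous_at_imp_continuous_on differentiable_imp_continuous_within)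

lemma Ck_on_SucD: "Ck_on (Suc k) S f \<Longrightarrow> Ck_on k S f"
proof (induction k arbitrary: f)
  case 0
  then show ?case by (simp only: Ck_on.simps(1)) (rule Ck_on_continuous)
qed (simp add: Ck_on.simps(2))

lemma Ck_on_const: "Ck_on k S (\<lambda>x::real^'n. c)"
proof (induction k arbitrary: c)
  case (Suc k)
  have "partial j (\<lambda>x::real^'n. c) = (\<lambda>x. 0)" for j by (rule ext) (simp add: partial_def)
  then show ?case by (simp add: Suc)
qed simp

lemma Ck_on_component: "Ck_on k S (\<lambda>x::real^'n. x $ i)"
proof (cases k)
  case 0
  then show ?thesis by (auto intro!: continuous_intros)
next
  case (Suc k')
  have d: "((\<lambda>x::real^'n. x $ i) has_derivative (\<lambda>h. h $ i)) (at x)" for x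
    by (rule bounded_linear_imp_has_derivative[OF bounded_linear_vec_nth])
  then have "partial j (\<lambda>x::real^'n. x $ i) = (\<lambda>x. axis j 1 $ i)" for j
    by (intro ext) (rule partial_eq)
  then show ?thesis using d Ck_on_const by (auto simp: Suc differentiable_def)
qed

lemma Ck_on_add:
  assumes "open S" "Ck_on k S f" "Ck_on k S g"
  shows "Ck_on k S (\<lambda>x. f x + g x)"
  using assms(2,3)
proof (induction k arbitrary: f g)
  case 0
  then show ?case by (auto intro!: continuous_intros)
next
  case (Suc k)
  have "Ck_on k S (partial j (\<lambda>x. f x + g x))" for j
  proof (rule Ck_on_congI[OF assms(1)])
    show "Ck_on k S (\<lambda>x. partial j f x + partial j g x)" using Suc by simp
    show "partial j f x + partial j g x = partial j (\<lambda>x. f x + g x) x" if x: "x \<in> S" for x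
    proof -
      obtain D E where "(f has_derivative D) (at x)" "(g has_derivative E) (at x)"
        using Suc.prems x unfolding Ck_on.simps differentiable_def by blast
      then have DE: "(f has_derivative D) (at x)" "(g has_derivative E) (at x)" by auto
      show ?thesis unfolding partial_eq[OF DE(1)] partial_eq[OF DE(2)] partial_eq[OF has_derivative_add[OF DE]] ..
    qed
  qed
  then show ?case using Suc.prems by (auto intro!: derivative_intros)
qed

lemma Ck_on_mult:
  fixes f g :: "real^'n \<Rightarrow> real"
  assumes "open S" "Ck_on k S f" "Ck_on k S g"
  shows "Ck_on k S (\<lambda>x. f x * g x)"
  using assms(2,3)
proof (induction k arbitrary: f g)
  case 0
  then show ?case by (auto intro!: continuous_intros)
next
  case (Suc k)
  have "Ck_on k S (partial j (\<lambda>x. f x * g x))" for j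
  proof (rule Ck_on_congI[OF assms(1)])
    show "Ck_on k S (\<lambda>x. f x * partial j g x + partial j f x * g x)"
      using Suc Ck_on_SucD[OF Suc.prems(1)] Ck_on_SucD[OF Suc.prems(2)]
      by (intro Ck_on_add[OF assms(1)] Suc.IH) auto
    show "f x * partial j g x + partial j f x * g x = partial j (\<lambda>x. f x * g x) x" if x: "x \<in> S" for x
    proof -
      obtain D E where DE: "(f has_derivative D) (at x)" "(g has_derivative E) (at x)"
        using Suc.prems x unfolding Ck_on.simps differentiable_def by blast
      show ?thesis unfolding partial_eq[OF DE(1)] partial_eq[OF DE(2)] partial_eq[OF has_derivative_mult[OF DE]] ..
    qed
  qed
  then show ?case using Suc.prems by (auto intro!: derivative_intros)
qed

lemma Ck_on_scaleR_const:
  assumes "open S" "Ck_on k S f"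
  shows "Ck_on k S (\<lambda>x. f x *\<^sub>R c)"
  using assms(2)
proof (induction k arbitrary: f)
  case 0
  then show ?case by (auto intro!: continuous_intros)
next
  case (Suc k)
  have "Ck_on k S (partial j (\<lambda>x. f x *\<^sub>R c))" for j
  proof (rule Ck_on_congI[OF assms(1)])
    show "Ck_on k S (\<lambda>x. partial j f x *\<^sub>R c)" using Suc by simp
    show "partial j f x *\<^sub>R c = partial j (\<lambda>x. f x *\<^sub>R c) x" if x: "x \<in> S" for x
    proof -
      obtain D where D: "(f has_derivative D) (at x)"
        using Suc.prems x unfolding Ck_on.simps differentiable_def by blast
      show ?thesis unfolding partial_eq[OF D] partial_eq[OF has_derivative_scaleR_left[OF D]] ..
    qed
  qed
  then show ?case using Suc.prems by (auto intro!: derivative_intros)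
qed

section \<open>The kernels as test functions, and reduction to scalar functions\<close>

lemma Ck_on_norm_power: "Ck_on k (- {x :: real^'n}) (\<lambda>\<zeta>. c / norm (\<zeta> - x) ^ p)"
proof (induction k arbitrary: c p)
  case 0
  show ?case by (auto intro!: continuous_intros)
next
  case (Suc k)
  have op: "open (- {x})" by (simp add: open_Compl)
  have "Ck_on k (- {x}) (partial j (\<lambda>\<zeta>. c / norm (\<zeta> - x) ^ p))" for j
  proof (rule Ck_on_congI[OF op])
    show "Ck_on k (- {x}) (\<lambda>\<zeta>. (- real p * c / norm (\<zeta> - x) ^ (p + 2)) * (\<zeta> $ j + - (x $ j)))"
      by (intro Ck_on_mult Ck_on_add Ck_on_component Ck_on_const op Suc.IH)
    show "(- real p * c / norm (\<zeta> - x) ^ (p + 2)) * (\<zeta> $ j + - (x $ j)) = partial j (\<lambda>\<zeta>. c / norm (\<zeta> - x) ^ p) \<zeta>"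
      if "\<zeta> \<in> - {x}" for \<zeta>
      using that by (subst partial_eq[OF has_derivative_norm_diff_power]) (auto simp: inner_axis)
  qed
  then show ?case
    using has_derivative_norm_diff_power unfolding Ck_on.simps by (metis ComplD differentiable_def singletonI)
qed

lemma K_kernel_eq:
  fixes x \<zeta> :: "real^'n"
  assumes "x \<noteq> \<zeta>"
  shows "K_kernel x \<zeta> = real CARD('n) / 4 * (rho x ^ 3 / norm (x - \<zeta>) ^ (CARD('n) + 2))
    - (real CARD('n) - 4) / 4 * ((rho x)\<^sup>2 / norm (x - \<zeta>) ^ CARD('n))"
proof -
  define d N where "d = norm (x - \<zeta>)" and "N = real CARD('n)"
  have d: "d > 0" using assms by (simp add: d_def)
  have "1/4 * (r\<^sup>2 / d ^ (CARD('n) + 2)) * (N * r - (N - 4) * d\<^sup>2)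
    = N / 4 * (r ^ 3 / d ^ (CARD('n) + 2)) - (N - 4) / 4 * (r\<^sup>2 / d ^ CARD('n))" for r
    using d by (simp add: field_simps power2_eq_square power3_eq_cube)
  then show ?thesis unfolding K_kernel_def d_def N_def .
qed

lemma smooth_on_sphere_kernels:
  fixes x :: "real^'n"
  assumes x: "norm x < 1"
  shows "smooth_on_sphere (K_kernel x)" "smooth_on_sphere (H_kernel x)"
proof -
  have op: "open (- {x})" and sub: "sphere 0 1 \<subseteq> - {x}" using x by auto
  have "Ck_on k (- {x}) (K_kernel x)" for k
  proof (rule Ck_on_congI[OF op])
    show "Ck_on k (- {x}) (\<lambda>\<zeta>. real CARD('n) / 4 * rho x ^ 3 / norm (\<zeta> - x) ^ (CARD('n) + 2)
      + (- ((real CARD('n) - 4) / 4 * (rho x)\<^sup>2)) / norm (\<zeta> - x) ^ CARD('n))"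
      by (intro Ck_on_add Ck_on_norm_power op)
  qed (simp add: K_kernel_eq norm_minus_commute)
  then show "smooth_on_sphere (K_kernel x)" unfolding smooth_on_sphere_def using op sub by blast
  have "Ck_on k (- {x}) (H_kernel x)" for k
  proof (rule Ck_on_congI[OF op])
    show "Ck_on k (- {x}) (\<lambda>\<zeta>. (1 / 2 * (rho x)\<^sup>2) / norm (\<zeta> - x) ^ CARD('n))"
      by (intro Ck_on_norm_power)
  qed (simp add: H_kernel_def norm_minus_commute)
  then show "smooth_on_sphere (H_kernel x)" unfolding smooth_on_sphere_def using op sub by blast
qed

lemma smooth_on_sphere_continuous: "smooth_on_sphere \<psi> \<Longrightarrow> continuous_on (sphere 0 1) \<psi>"
  unfolding smooth_on_sphere_def by (meson Ck_on_continuous continuous_on_subset)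

text \<open>Pairing with a fixed vector e makes the problem scalar. Pairing with a vector along the
  error itself recovers its Euclidean norm without the loss that a coordinatewise estimate would
  bring.\<close>

lemma biext_inner:
  fixes \<phi>1 \<phi>2 :: "real^'n \<Rightarrow> real^'m" and x :: "real^'n"
  assumes c: "continuous_on (sphere 0 1) \<phi>1" "continuous_on (sphere 0 1) \<phi>2" and x: "norm x < 1"
  shows "biext (\<lambda>\<zeta>. \<phi>1 \<zeta> \<bullet> e) (\<lambda>\<zeta>. \<phi>2 \<zeta> \<bullet> e) x = (K_op \<phi>1 x + H_op \<phi>2 x) \<bullet> e"
proof -
  let ?N = "real CARD('n)"
  have i: "integrable sphere_measure (\<lambda>\<zeta>. (\<phi> \<zeta> \<bullet> e) / norm (x - \<zeta>) ^ p)"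
    if "continuous_on (sphere 0 1) \<phi>" for \<phi> :: "real^'n \<Rightarrow> real^'m" and p
    using that x by (intro integrable_sphere_measure_continuous pot_integrand_continuous continuous_intros)
  have iK: "integrable sphere_measure (\<lambda>\<zeta>. K_kernel x \<zeta> *\<^sub>R \<phi>1 \<zeta>)"
    and iH: "integrable sphere_measure (\<lambda>\<zeta>. H_kernel x \<zeta> *\<^sub>R \<phi>2 \<zeta>)"
    using c smooth_on_sphere_kernels[OF x, THEN smooth_on_sphere_continuous]
    by (auto intro!: integrable_sphere_measure_continuous continuous_intros)
  have "K_op \<phi>1 x \<bullet> e = (\<integral>\<zeta>. (K_kernel x \<zeta> *\<^sub>R \<phi>1 \<zeta>) \<bullet> e \<partial>sphere_measure)"
    unfolding K_op_def using iK by (simp del: inner_scaleR_left)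
  also have "\<dots> = (\<integral>\<zeta>. ?N / 4 * (rho x ^ 3 * ((\<phi>1 \<zeta> \<bullet> e) / norm (x - \<zeta>) ^ (CARD('n) + 2)))
      - (?N - 4) / 4 * ((rho x)\<^sup>2 * ((\<phi>1 \<zeta> \<bullet> e) / norm (x - \<zeta>) ^ CARD('n))) \<partial>sphere_measure)"
  proof (rule Bochner_Integration.integral_cong)
    fix \<zeta> :: "real^'n" assume "\<zeta> \<in> space sphere_measure"
    then have "x \<noteq> \<zeta>" using x by auto
    then show "(K_kernel x \<zeta> *\<^sub>R \<phi>1 \<zeta>) \<bullet> e = ?N / 4 * (rho x ^ 3 * ((\<phi>1 \<zeta> \<bullet> e) / norm (x - \<zeta>) ^ (CARD('n) + 2)))
      - (?N - 4) / 4 * ((rho x)\<^sup>2 * ((\<phi>1 \<zeta> \<bullet> e) / norm (x - \<zeta>) ^ CARD('n)))"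
      by (simp add: K_kernel_eq left_diff_distrib right_diff_distrib mult_ac)
  qed simp
  also have "\<dots> = ?N / 4 * (rho x ^ 3 * pot (CARD('n) + 2) (\<lambda>\<zeta>. \<phi>1 \<zeta> \<bullet> e) x)
      - (?N - 4) / 4 * ((rho x)\<^sup>2 * pot CARD('n) (\<lambda>\<zeta>. \<phi>1 \<zeta> \<bullet> e) x)"
    using i[OF c(1), of "CARD('n)"] i[OF c(1), of "CARD('n) + 2"]
    unfolding pot_def by (simp del: times_divide_eq_right add_2_eq_Suc')
  finally have K: "K_op \<phi>1 x \<bullet> e = ?N / 4 * (rho x ^ 3 * pot (CARD('n) + 2) (\<lambda>\<zeta>. \<phi>1 \<zeta> \<bullet> e) x)
      - (?N - 4) / 4 * ((rho x)\<^sup>2 * pot CARD('n) (\<lambda>\<zeta>. \<phi>1 \<zeta> \<bullet> e) x)" .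
  have "H_op \<phi>2 x \<bullet> e = (\<integral>\<zeta>. (H_kernel x \<zeta> *\<^sub>R \<phi>2 \<zeta>) \<bullet> e \<partial>sphere_measure)"
    unfolding H_op_def using iH by (simp del: inner_scaleR_left)
  also have "\<dots> = (\<integral>\<zeta>. 1 / 2 * ((rho x)\<^sup>2 * ((\<phi>2 \<zeta> \<bullet> e) / norm (x - \<zeta>) ^ CARD('n))) \<partial>sphere_measure)"
    by (rule Bochner_Integration.integral_cong) (simp_all add: H_kernel_def mult_ac)
  also have "\<dots> = 1 / 2 * ((rho x)\<^sup>2 * pot CARD('n) (\<lambda>\<zeta>. \<phi>2 \<zeta> \<bullet> e) x)"
    using i[OF c(2)] unfolding pot_def by (simp del: times_divide_eq_right)
  finally show ?thesis unfolding biext_def inner_add_left K by simp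
qed

lemma glap_inner:
  fixes f :: "real^'n \<Rightarrow> real^'m"
  assumes "Ck_on 2 S f"
  shows "glap S (\<lambda>x. f x \<bullet> e) (\<lambda>x. \<chi> j. partial j f x \<bullet> e) (\<lambda>x. laplacian f x \<bullet> e)"
proof (rule glapI[where D="\<lambda>x h. \<chi> j. (\<Sum>i\<in>UNIV. (h $ i) *\<^sub>R partial i (partial j f) x) \<bullet> e"])
  fix x assume x: "x \<in> S"
  have d: "f differentiable (at x)" "\<And>j. partial j f differentiable (at x)"
    using assms x by (auto simp: numeral_2_eq_2)
  have "((\<lambda>x. f x \<bullet> e) has_derivative (\<lambda>h. (\<Sum>j\<in>UNIV. (h $ j) *\<^sub>R partial j f x) \<bullet> e)) (at x)"
    by (rule has_derivative_inner_left[OF has_derivative_partial[OF d(1)]])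
  then show "((\<lambda>x. f x \<bullet> e) has_derivative (\<bullet>) (\<chi> j. partial j f x \<bullet> e)) (at x)"
    unfolding inner_vec_def[of "\<chi> j. partial j f x \<bullet> e"] by (simp add: inner_sum_left mult.commute)
  show "((\<lambda>x. \<chi> j. partial j f x \<bullet> e) has_derivative (\<lambda>h. \<chi> j. (\<Sum>i\<in>UNIV. (h $ i) *\<^sub>R partial i (partial j f) x) \<bullet> e)) (at x)"
  proof (rule iffD2[OF has_derivative_componentwise_within], rule ballI)
    fix b :: "real^'n" assume "b \<in> Basis"
    then obtain j where b: "b = axis j 1" by (auto simp: Basis_vec_def)
    show "((\<lambda>x. (\<chi> j. partial j f x \<bullet> e) \<bullet> b) has_derivative
       (\<lambda>h. (\<chi> j. (\<Sum>i\<in>UNIV. (h $ i) *\<^sub>R partial i (partial j f) x) \<bullet> e) \<bullet> b)) (at x)"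
      using has_derivative_inner_left[OF has_derivative_partial[OF d(2)[of j]], of e]
      by (simp add: b inner_axis)
  qed
  have "(\<Sum>i\<in>UNIV. (axis j 1 $ i) *\<^sub>R partial i (partial j f) x) = partial j (partial j f) x" for j
    by (simp add: axis_def if_distrib[of "\<lambda>t. t *\<^sub>R _"] cong: if_cong)
  then have "((\<chi> j'. (\<Sum>i\<in>UNIV. (axis j 1 $ i) *\<^sub>R partial i (partial j' f) x) \<bullet> e) :: real^'n) $ j = partial j (partial j f) x \<bullet> e" for j
    by (simp only: vec_lambda_beta)
  then show "(\<Sum>j\<in>UNIV. ((\<chi> j'. (\<Sum>i\<in>UNIV. (axis j 1 $ i) *\<^sub>R partial i (partial j' f) x) \<bullet> e) :: real^'n) $ j) = laplacian f x \<bullet> e"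
    unfolding laplacian_def inner_sum_left by simp
qed

lemma laplacian_eq_glap:
  assumes "glap S f G L" "open S" "x \<in> S"
  shows "laplacian f x = L x"
proof -
  obtain D where D: "(G has_derivative D) (at x)" "(\<Sum>j\<in>UNIV. D (axis j 1) $ j) = L x"
    using glapD[OF assms(1,3)] by metis
  have "partial j (partial j f) x = D (axis j 1) $ j" for j
  proof -
    have "partial j (partial j f) x = partial j (\<lambda>y. G y $ j) x"
    proof (rule partial_cong[OF assms(2,3)])
      fix y assume "y \<in> S"
      from partial_eq[OF glap_deriv[OF assms(1) this]] show "partial j f y = G y $ j"
        by (simp add: inner_axis)
    qed
    also have "\<dots> = D (axis j 1) $ j"
      by (rule partial_eq[OF bounded_linear.has_derivative[OF bounded_linear_vec_nth D(1)]])
    finally show ?thesis .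
  qed
  then show ?thesis unfolding laplacian_def using D(2) by simp
qed

subsection \<open>Passage to distributional boundary values\<close>

lemma inward_normal_derivative_scaled:
  fixes f :: "real^'n \<Rightarrow> real^'m"
  assumes "f differentiable (at (r *\<^sub>R \<zeta>))"
  shows "inward_normal_derivative (\<lambda>x. f (r *\<^sub>R x)) \<zeta> = - (r *\<^sub>R (\<Sum>j\<in>UNIV. (\<zeta> $ j) *\<^sub>R partial j f (r *\<^sub>R \<zeta>)))"
proof -
  have path: "((\<lambda>t. r *\<^sub>R t *\<^sub>R \<zeta>) has_derivative (\<lambda>t. r *\<^sub>R t *\<^sub>R \<zeta>)) (at (1::real))"
    by (auto intro!: derivative_eq_intros)
  have "((\<lambda>t. f (r *\<^sub>R t *\<^sub>R \<zeta>)) has_derivative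
      (\<lambda>t. \<Sum>j\<in>UNIV. ((r *\<^sub>R t *\<^sub>R \<zeta>) $ j) *\<^sub>R partial j f (r *\<^sub>R \<zeta>))) (at 1)"
    using has_derivative_compose[OF path, of f "\<lambda>h. \<Sum>j\<in>UNIV. (h $ j) *\<^sub>R partial j f (r *\<^sub>R \<zeta>)"]
      has_derivative_partial[OF assms] by simp
  then have "((\<lambda>t. f (r *\<^sub>R t *\<^sub>R \<zeta>)) has_vector_derivative
      (r *\<^sub>R (\<Sum>j\<in>UNIV. (\<zeta> $ j) *\<^sub>R partial j f (r *\<^sub>R \<zeta>)))) (at 1)"
    by (simp add: has_vector_derivative_def scaleR_sum_right mult_ac)
  then show ?thesis
    unfolding inward_normal_derivative_def by (simp add: vector_derivative_at)
qed

text \<open>The dilation f(r x) is regular on the ball of radius 1 / r > 1, so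
  \<open>biharmonic_estimate\<close> applies with the boundary data read off from f(r x) itself. Its
  bilaplacian is r^4 g(r x), still bounded by M.\<close>

lemma scaled_estimate:
  fixes f g :: "real^'n \<Rightarrow> real^'m"
  assumes f: "Ck_on 2 (ball 0 1) f" and Lf: "Ck_on 2 (ball 0 1) (laplacian f)"
    and g: "\<And>x. norm x < 1 \<Longrightarrow> laplacian (laplacian f) x = g x"
    and M: "\<And>x. norm x < 1 \<Longrightarrow> norm (g x) \<le> M"
    and r: "0 < r" "r < 1" and e: "norm e \<le> 1" and x: "norm x < 1"
  shows "\<bar>(f (r *\<^sub>R x) - K_op (\<lambda>\<zeta>. f (r *\<^sub>R \<zeta>)) x - H_op (inward_normal_derivative (\<lambda>x. f (r *\<^sub>R x))) x) \<bullet> e\<bar>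
    \<le> M / (8 * real CARD('n) * (real CARD('n) + 2)) * (rho x)\<^sup>2"
proof -
  let ?I = "inward_normal_derivative (\<lambda>x. f (r *\<^sub>R x))"
  have in1: "r *\<^sub>R y \<in> ball 0 1" if "y \<in> ball 0 (1 / r)" for y :: "real^'n"
    using that r by (simp add: field_simps)
  have sph: "r *\<^sub>R y \<in> ball 0 1" if "y \<in> sphere 0 1" for y :: "real^'n" using that r by simp
  define G where "G y = (\<chi> j. partial j f y \<bullet> e)" for y
  define G' where "G' y = (\<chi> j. partial j (laplacian f) y \<bullet> e)" for y
  have glu: "glap (ball 0 (1 / r)) (\<lambda>y. f (r *\<^sub>R y) \<bullet> e) (\<lambda>y. r *\<^sub>R G (r *\<^sub>R y)) (\<lambda>y. r\<^sup>2 * (laplacian f (r *\<^sub>R y) \<bullet> e))"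
    unfolding G_def[abs_def] by (rule glap_compose_scaleR[OF glap_inner[OF f] in1])
  have "glap (ball 0 (1 / r)) (\<lambda>y. laplacian f (r *\<^sub>R y) \<bullet> e) (\<lambda>y. r *\<^sub>R G' (r *\<^sub>R y)) (\<lambda>y. r\<^sup>2 * (laplacian (laplacian f) (r *\<^sub>R y) \<bullet> e))"
    unfolding G'_def[abs_def] by (rule glap_compose_scaleR[OF glap_inner[OF Lf] in1])
  \<comment> \<open>The second factor r^2: the Laplacian of f(r y) is r^2 times the dilated
    Laplacian of f, and that product is differentiated here.\<close>
  note glL = glap_cmult[OF this, of "r\<^sup>2"]
  have d: "f differentiable (at y)" "continuous_on (ball 0 1) (partial j f)" if "y \<in> ball 0 1" for y j
  proof -
    have "Ck_on (Suc (Suc 0)) (ball 0 1) f" using f by (simp only: numeral_2_eq_2)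
    then have "\<forall>y\<in>ball 0 1. f differentiable (at y)" "Ck_on (Suc 0) (ball 0 1) (partial j f)"
      unfolding Ck_on.simps(2)[of "Suc 0"] by auto
    then show "f differentiable (at y)" "continuous_on (ball 0 1) (partial j f)"
      using that Ck_on_continuous by blast+
  qed
  have inw: "?I \<zeta> = - (r *\<^sub>R (\<Sum>j\<in>UNIV. (\<zeta> $ j) *\<^sub>R partial j f (r *\<^sub>R \<zeta>)))" if "\<zeta> \<in> sphere 0 1" for \<zeta>
    by (rule inward_normal_derivative_scaled[OF d(1)[OF sph[OF that]]])
  have c1: "continuous_on (sphere 0 1) (\<lambda>\<zeta>. f (r *\<^sub>R \<zeta>))"
    by (intro continuous_on_compose2[OF Ck_on_continuous[OF f]] continuous_intros) (use sph in auto)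
  have "continuous_on (sphere 0 1) (\<lambda>\<zeta>. - (r *\<^sub>R (\<Sum>j\<in>UNIV. (\<zeta> $ j) *\<^sub>R partial j f (r *\<^sub>R \<zeta>))))"
    by (intro continuous_intros continuous_on_compose2[OF d(2)[of 0]]) (use sph in auto)
  then have c2: "continuous_on (sphere 0 1) ?I"
    by (rule continuous_on_eq) (use inw in simp)
  have eqI: "- (\<zeta> \<bullet> (r *\<^sub>R G (r *\<^sub>R \<zeta>))) = ?I \<zeta> \<bullet> e" if "\<zeta> \<in> sphere 0 1" for \<zeta>
    unfolding inw[OF that] G_def by (simp add: inner_vec_def[of \<zeta>] inner_sum_left sum_distrib_left)
  have "biext (\<lambda>y. f (r *\<^sub>R y) \<bullet> e) (\<lambda>\<zeta>. - (\<zeta> \<bullet> (r *\<^sub>R G (r *\<^sub>R \<zeta>)))) x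
      = biext (\<lambda>y. f (r *\<^sub>R y) \<bullet> e) (\<lambda>\<zeta>. ?I \<zeta> \<bullet> e) x"
  proof -
    have "pot p (\<lambda>\<zeta>. - (\<zeta> \<bullet> (r *\<^sub>R G (r *\<^sub>R \<zeta>)))) x = pot p (\<lambda>\<zeta>. ?I \<zeta> \<bullet> e) x" for p
      unfolding pot_def by (rule Bochner_Integration.integral_cong) (use eqI in auto)
    then show ?thesis by (simp add: biext_def)
  qed
  also have "\<dots> = (K_op (\<lambda>\<zeta>. f (r *\<^sub>R \<zeta>)) x + H_op ?I x) \<bullet> e"
    by (rule biext_inner[OF c1 c2 x])
  finally have b: "biext (\<lambda>y. f (r *\<^sub>R y) \<bullet> e) (\<lambda>\<zeta>. - (\<zeta> \<bullet> (r *\<^sub>R G (r *\<^sub>R \<zeta>)))) x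
      = (K_op (\<lambda>\<zeta>. f (r *\<^sub>R \<zeta>)) x + H_op ?I x) \<bullet> e" .
  have "\<bar>r\<^sup>2 * (r\<^sup>2 * (laplacian (laplacian f) (r *\<^sub>R y) \<bullet> e))\<bar> \<le> M" if "norm y < 1" for y
  proof -
    have ry: "norm (r *\<^sub>R y) < 1" using that r mult_strict_mono[of r 1 "norm y" 1] by simp
    have "\<bar>g (r *\<^sub>R y) \<bullet> e\<bar> \<le> norm (g (r *\<^sub>R y)) * norm e" by (rule Cauchy_Schwarz_ineq2)
    also have "\<dots> \<le> M * 1" using M[OF ry] e order_trans[OF norm_ge_zero M[OF ry]] by (intro mult_mono) auto
    finally have ge: "\<bar>g (r *\<^sub>R y) \<bullet> e\<bar> \<le> M" by simp
    have "r\<^sup>2 * r\<^sup>2 \<le> 1" using r by (simp add: power_le_one mult_le_one)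
    then have "(r\<^sup>2 * r\<^sup>2) * \<bar>g (r *\<^sub>R y) \<bullet> e\<bar> \<le> 1 * M" using ge by (intro mult_mono) auto
    then show ?thesis by (simp add: g[OF ry] abs_mult)
  qed
  from biharmonic_estimate[OF _ glu glL this x] r show ?thesis
    unfolding b by (simp add: inner_diff_left inner_add_left diff_diff_eq)
qed

theorem biharmonic_solution_estimate:
  fixes f g \<phi>1 \<phi>2 :: "real^'n \<Rightarrow> real^'m"
  assumes sol: "biharmonic_dirichlet_solution g \<phi>1 \<phi>2 f"
    and M: "\<And>x. norm x < 1 \<Longrightarrow> norm (g x) \<le> M" and x: "norm x < 1"
  shows "norm (f x - K_op \<phi>1 x - H_op \<phi>2 x) \<le> M / (8 * real CARD('n) * (real CARD('n) + 2)) * (rho x)\<^sup>2"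
proof -
  have f: "Ck_on 2 (ball 0 1) f" and Lf: "Ck_on 2 (ball 0 1) (laplacian f)"
    and g: "\<And>x. norm x < 1 \<Longrightarrow> laplacian (laplacian f) x = g x"
    and t1: "tendsto_distr_sphere (\<lambda>r \<zeta>. f (r *\<^sub>R \<zeta>)) \<phi>1 (at_left 1)"
    and t2: "tendsto_distr_sphere (\<lambda>r. inward_normal_derivative (\<lambda>x. f (r *\<^sub>R x))) \<phi>2 (at_left 1)"
    using sol unfolding biharmonic_dirichlet_solution_def by auto
  define v where "v = f x - K_op \<phi>1 x - H_op \<phi>2 x"
  \<comment> \<open>The direction is that of the limiting error, hence independent of r. For v = 0
    it is the zero vector, so only norm at most 1 is available.\<close>
  define e where "e = sgn v"
  have e: "norm e \<le> 1" by (simp add: e_def norm_sgn)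
  have ve: "v \<bullet> e = norm v"
    by (cases "v = 0") (simp_all add: e_def sgn_div_norm dot_square_norm power2_eq_square)
  have lim1: "((\<lambda>r. K_op (\<lambda>\<zeta>. f (r *\<^sub>R \<zeta>)) x) \<longlongrightarrow> K_op \<phi>1 x) (at_left 1)"
    using t1 smooth_on_sphere_kernels(1)[OF x] unfolding tendsto_distr_sphere_def K_op_def by blast
  have lim2: "((\<lambda>r. H_op (inward_normal_derivative (\<lambda>x. f (r *\<^sub>R x))) x) \<longlongrightarrow> H_op \<phi>2 x) (at_left 1)"
    using t2 smooth_on_sphere_kernels(2)[OF x] unfolding tendsto_distr_sphere_def H_op_def by blast
  have "isCont f x"
    using Ck_on_continuous[OF f] x by (simp add: continuous_on_eq_continuous_at)
  moreover have "((\<lambda>r. r *\<^sub>R x) \<longlongrightarrow> 1 *\<^sub>R x) (at_left (1::real))"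
    by (intro tendsto_intros)
  ultimately have lim0: "((\<lambda>r. f (r *\<^sub>R x)) \<longlongrightarrow> f x) (at_left 1)"
    using isCont_tendsto_compose[of x f] by simp
  have lim: "((\<lambda>r. \<bar>(f (r *\<^sub>R x) - K_op (\<lambda>\<zeta>. f (r *\<^sub>R \<zeta>)) x - H_op (inward_normal_derivative (\<lambda>x. f (r *\<^sub>R x))) x) \<bullet> e\<bar>)
      \<longlongrightarrow> \<bar>v \<bullet> e\<bar>) (at_left 1)"
    unfolding v_def by (intro tendsto_intros lim0 lim1 lim2)
  have "\<forall>\<^sub>F r in at_left (1::real). 0 < r \<and> r < 1"
    unfolding eventually_at_left_field by (intro exI[of _ 0]) auto
  then have "\<forall>\<^sub>F r in at_left 1. \<bar>(f (r *\<^sub>R x) - K_op (\<lambda>\<zeta>. f (r *\<^sub>R \<zeta>)) x - H_op (inward_normal_derivative (\<lambda>x. f (r *\<^sub>R x))) x) \<bullet> e\<bar>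
      \<le> M / (8 * real CARD('n) * (real CARD('n) + 2)) * (rho x)\<^sup>2"
    by eventually_elim (use scaled_estimate[OF f Lf g M _ _ e x] in auto)
  from tendsto_upperbound[OF lim this] have "\<bar>v \<bullet> e\<bar> \<le> M / (8 * real CARD('n) * (real CARD('n) + 2)) * (rho x)\<^sup>2"
    by (simp add: trivial_limit_at_left_real)
  then show ?thesis unfolding ve by (simp add: v_def)
qed

subsection \<open>Comparison with the extremal functions\<close>

text \<open>On the equator both closed hemispheres count and their indicators cancel, in agreement
  with \<open>sgn 0 = 0\<close>.\<close>

lemma hemisphere_sign_eq:
  "\<zeta> \<in> sphere 0 1 \<Longrightarrow> hemisphere_sign k \<zeta> = sgn (\<zeta> $ k)"
  by (auto simp: hemisphere_sign_def indicator_def sgn_if)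

lemma hemisphere_sign_measurable: "hemisphere_sign k \<in> borel_measurable (sphere_measure :: (real^'n) measure)"
proof -
  have "{x \<in> sphere 0 1. x $ k \<ge> 0} = sphere 0 1 \<inter> {x::real^'n. x $ k \<ge> 0}"
    and "{x \<in> sphere 0 1. x $ k \<le> 0} = sphere 0 1 \<inter> {x::real^'n. x $ k \<le> 0}" by auto
  then have "{x \<in> sphere 0 1. x $ k \<ge> 0} \<in> sets (borel :: (real^'n) measure)"
    and "{x \<in> sphere 0 1. x $ k \<le> 0} \<in> sets (borel :: (real^'n) measure)"
    by (auto intro!: borel_closed closed_Int closed_halfspace_component_ge_cart closed_halfspace_component_le_cart)
  then have "hemisphere_sign k \<in> borel_measurable borel"
    unfolding hemisphere_sign_def[abs_def] by (intro borel_measurable_diff borel_measurable_indicator)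
  then have "hemisphere_sign k \<in> borel_measurable (restrict_space borel (sphere (0::real^'n) 1))"
    by (rule measurable_restrict_space1)
  then show ?thesis using measurable_cong_sets[OF sets_sphere_measure refl] by blast
qed

lemma integrable_mult_hemisphere_sign:
  assumes c: "continuous_on (sphere 0 1) h"
  shows "integrable sphere_measure (\<lambda>\<zeta> :: real^'n. h \<zeta> * hemisphere_sign k \<zeta>)"
proof -
  obtain B where "B > 0" "\<And>\<zeta>. \<zeta> \<in> sphere 0 1 \<Longrightarrow> norm (h \<zeta>) \<le> B"
    using continuous_on_sphere_bounded[OF c] by blast
  then show ?thesis
    by (intro integrable_sphere_measure_bounded[of _ B] borel_measurable_times measurable_sphere_measureI[OF c]
        hemisphere_sign_measurable) (auto simp: hemisphere_sign_eq abs_mult sgn_if)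
qed

text \<open>The antipodal map preserves the measure and reverses the sign.\<close>

lemma integral_hemisphere_sign: "(\<integral>\<zeta>. hemisphere_sign k \<zeta> \<partial>(sphere_measure :: (real^'n) measure)) = 0"
proof -
  have "orthogonal_transformation (uminus :: real^'n \<Rightarrow> real^'n)"
    by (simp add: orthogonal_transformation_def linear_iff)
  from integral_sphere_measure_orthogonal[OF this hemisphere_sign_measurable, of k]
  have "(\<integral>\<zeta>. hemisphere_sign k (- \<zeta>) \<partial>(sphere_measure :: (real^'n) measure)) = (\<integral>\<zeta>. hemisphere_sign k \<zeta> \<partial>(sphere_measure :: (real^'n) measure))" .
  moreover have "(\<integral>\<zeta>. hemisphere_sign k (- \<zeta>) \<partial>(sphere_measure :: (real^'n) measure)) = (\<integral>\<zeta>. - hemisphere_sign k \<zeta> \<partial>(sphere_measure :: (real^'n) measure))"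
    by (rule Bochner_Integration.integral_cong) (auto simp: hemisphere_sign_eq sgn_minus)
  ultimately show ?thesis by simp
qed

lemma norm_axis_diff_power2:
  fixes \<zeta> :: "real^'n"
  assumes "norm \<zeta> = 1"
  shows "(norm (s *\<^sub>R axis k 1 - \<zeta>))\<^sup>2 = 1 + s\<^sup>2 - 2 * s * \<zeta> $ k"
  unfolding power2_norm_eq_inner using assms dot_square_norm[of \<zeta>]
  by (simp add: inner_diff_left inner_diff_right inner_axis inner_axis' power2_eq_square algebra_simps)

text \<open>A rotation takes x to |x| times the k-th unit vector. There the deviation has the sign
  of \<open>\<zeta> $ k\<close>, so the hemisphere sign removes the absolute value, and the
  subtracted constant integrates to 0 against that sign. These constants are the source of
  \<open>delta1\<close> and \<open>delta2\<close>.\<close>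

lemma kernel_deviation:
  fixes x :: "real^'n" and k :: 'n
  assumes x: "norm x < 1" and A: "A \<ge> 0"
  shows "(\<integral>\<zeta>. \<bar>A / norm (x - \<zeta>) ^ p - A / (1 + (norm x)\<^sup>2) powr (real p / 2)\<bar> \<partial>sphere_measure)
    = (\<integral>\<zeta>. A / norm (norm x *\<^sub>R axis k 1 - \<zeta>) ^ p * hemisphere_sign k \<zeta> \<partial>sphere_measure)"
proof -
  define s where "s = norm x"
  have s: "0 \<le> s" "s < 1" using x by (auto simp: s_def)
  define D where "D = sqrt (1 + s\<^sup>2)"
  have D: "D > 0" by (simp add: D_def add_pos_nonneg)
  have Dp: "(1 + s\<^sup>2) powr (real p / 2) = D ^ p"
  proof -
    have pos: "1 + s\<^sup>2 > 0" by (simp add: add_pos_nonneg)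
    have "(1 + s\<^sup>2) powr (real p / 2) = ((1 + s\<^sup>2) powr (1 / 2)) powr real p" by (simp add: powr_powr)
    also have "\<dots> = D powr real p" using pos by (simp add: powr_half_sqrt D_def)
    finally show ?thesis using D by (simp add: powr_realpow)
  qed
  define c where "c = A / D ^ p"
  let ?e = "s *\<^sub>R axis k 1 :: real^'n"
  have ne: "norm ?e < 1" using s by simp
  have ck: "continuous_on (sphere 0 1) (\<lambda>\<zeta>. A / norm (?e - \<zeta>) ^ p)"
    using ne by (intro pot_integrand_continuous) auto
  obtain T where T: "orthogonal_transformation T" "T x = ?e"
    by (rule orthogonal_transformation_exists[of x ?e]) (auto simp: s_def)
  have d: "norm (?e - T \<zeta>) = norm (x - \<zeta>)" for \<zeta>
    unfolding T(2)[symmetric]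
    by (metis T(1) linear_diff orthogonal_transformation_linear orthogonal_transformation_norm)
  have m: "(\<lambda>\<zeta>. \<bar>A / norm (?e - \<zeta>) ^ p - c\<bar>) \<in> borel_measurable sphere_measure"
    by (intro measurable_sphere_measureI continuous_intros ck)
  have "(\<integral>\<zeta>. \<bar>A / norm (x - \<zeta>) ^ p - c\<bar> \<partial>sphere_measure) = (\<integral>\<zeta>. \<bar>A / norm (?e - \<zeta>) ^ p - c\<bar> \<partial>sphere_measure)"
    using integral_sphere_measure_orthogonal[OF T(1) m] by (simp add: d)
  also have "\<dots> = (\<integral>\<zeta>. A / norm (?e - \<zeta>) ^ p * hemisphere_sign k \<zeta> - c * hemisphere_sign k \<zeta> \<partial>sphere_measure)"
  proof (rule Bochner_Integration.integral_cong)
    fix \<zeta> :: "real^'n" assume "\<zeta> \<in> space sphere_measure"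
    then have \<zeta>: "norm \<zeta> = 1" "?e \<noteq> \<zeta>" using ne by auto
    let ?d = "norm (?e - \<zeta>)"
    have d0: "?d > 0" using \<zeta> by simp
    have d2: "?d\<^sup>2 = D\<^sup>2 - 2 * s * \<zeta> $ k"
      unfolding norm_axis_diff_power2[OF \<zeta>(1)] D_def by (simp add: add_nonneg_nonneg)
    have "\<bar>A / ?d ^ p - c\<bar> = (A / ?d ^ p - c) * sgn (\<zeta> $ k)"
    proof (cases "\<zeta> $ k" "0 :: real" rule: linorder_cases)
      case less
      then have "?d\<^sup>2 \<ge> D\<^sup>2" using d2 s by (simp add: mult_nonneg_nonpos)
      then have "D \<le> ?d" by (rule power2_le_imp_le) simp
      then have "A / ?d ^ p \<le> c" unfolding c_def
        by (intro divide_left_mono power_mono mult_pos_pos zero_less_power D d0 A less_imp_le[OF D] \<open>D \<le> ?d\<close>)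
      then show ?thesis using less by simp
    next
      case equal
      then have "?d = D" using d2 d0 D by (simp add: power2_eq_iff_nonneg)
      then show ?thesis using equal by (simp add: c_def)
    next
      case greater
      then have "?d\<^sup>2 \<le> D\<^sup>2" using d2 s by simp
      then have "?d \<le> D" by (rule power2_le_imp_le) (use D in simp)
      then have "c \<le> A / ?d ^ p" unfolding c_def
        by (intro divide_left_mono power_mono mult_pos_pos zero_less_power D d0 A norm_ge_zero \<open>?d \<le> D\<close>)
      then show ?thesis using greater by simp
    qed
    then show "\<bar>A / ?d ^ p - c\<bar> = A / ?d ^ p * hemisphere_sign k \<zeta> - c * hemisphere_sign k \<zeta>"
      using \<zeta> by (simp add: hemisphere_sign_eq left_diff_distrib)
  qed simp
  also have "\<dots> = (\<integral>\<zeta>. A / norm (?e - \<zeta>) ^ p * hemisphere_sign k \<zeta> \<partial>sphere_measure)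
      - (\<integral>\<zeta>. c * hemisphere_sign k \<zeta> \<partial>(sphere_measure :: (real^'n) measure))"
    by (intro Bochner_Integration.integral_diff integrable_mult_hemisphere_sign ck continuous_on_const)
  also have "(\<integral>\<zeta>. c * hemisphere_sign k \<zeta> \<partial>(sphere_measure :: (real^'n) measure)) = 0"
    by (simp add: integral_hemisphere_sign)
  finally show ?thesis by (simp add: c_def Dp[unfolded s_def] s_def)
qed

lemma norm_scaleR_integral_diff_le:
  fixes \<phi> :: "real^'n \<Rightarrow> real^'m"
  assumes c: "continuous_on (sphere 0 1) \<phi>" and h: "continuous_on (sphere 0 1) h"
    and S: "\<And>\<zeta>. \<zeta> \<in> sphere 0 1 \<Longrightarrow> norm (\<phi> \<zeta>) \<le> S"
  shows "norm ((\<integral>\<zeta>. h \<zeta> *\<^sub>R \<phi> \<zeta> \<partial>sphere_measure) - a *\<^sub>R (\<integral>\<zeta>. \<phi> \<zeta> \<partial>sphere_measure))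
    \<le> S * (\<integral>\<zeta>. \<bar>h \<zeta> - a\<bar> \<partial>sphere_measure)"
proof -
  have i1: "integrable sphere_measure \<phi>" "integrable sphere_measure (\<lambda>\<zeta>. h \<zeta> *\<^sub>R \<phi> \<zeta>)"
    "integrable sphere_measure (\<lambda>\<zeta>. norm ((h \<zeta> - a) *\<^sub>R \<phi> \<zeta>))" "integrable sphere_measure (\<lambda>\<zeta>. S * \<bar>h \<zeta> - a\<bar>)"
    by (intro integrable_sphere_measure_continuous continuous_intros c h)+
  have "(\<integral>\<zeta>. h \<zeta> *\<^sub>R \<phi> \<zeta> \<partial>sphere_measure) - a *\<^sub>R (\<integral>\<zeta>. \<phi> \<zeta> \<partial>sphere_measure)
      = (\<integral>\<zeta>. (h \<zeta> - a) *\<^sub>R \<phi> \<zeta> \<partial>sphere_measure)"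
    using i1 by (simp add: scaleR_left_diff_distrib)
  also have "norm \<dots> \<le> (\<integral>\<zeta>. norm ((h \<zeta> - a) *\<^sub>R \<phi> \<zeta>) \<partial>sphere_measure)"
    by (rule integral_norm_bound)
  also have "\<dots> \<le> (\<integral>\<zeta>. S * \<bar>h \<zeta> - a\<bar> \<partial>sphere_measure)"
    using i1 S by (intro integral_mono) (auto simp: mult.commute[of S] intro!: mult_left_mono)
  finally show ?thesis by simp
qed

text \<open>At the centre the kernel is (n - (n - 4)) / 4 = 1, so K[phi](0) is the mean of phi. Away
  from it the kernel minus \<open>delta1\<close> is n / 4 times the deviation of order n + 2 minus
  (n - 4) / 4 times that of order n; the sign of n - 4 varies, and the triangle inequality produces
  |n - 4|.\<close>

lemma K_op_deviation:
  fixes \<phi> :: "real^'n \<Rightarrow> real^'m" and k :: 'n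
  assumes c: "continuous_on (sphere 0 1) \<phi>" and x: "norm x < 1"
    and S: "\<And>\<zeta>. \<zeta> \<in> sphere 0 1 \<Longrightarrow> norm (\<phi> \<zeta>) \<le> S" and S0: "S \<ge> 0"
  shows "norm (K_op \<phi> x - delta1 CARD('n) (norm x) *\<^sub>R K_op \<phi> 0)
    \<le> \<bar>real CARD('n) - 4\<bar> / 4 * S * rho x * U k (norm x *\<^sub>R axis k 1)
      + real CARD('n) / 4 * S * U_star k (norm x *\<^sub>R axis k 1)"
proof -
  let ?N = "real CARD('n)" and ?s = "norm x"
  define c1 where "c1 = rho x / (1 + ?s\<^sup>2) powr (real CARD('n) / 2)"
  define c3 where "c3 = rho x ^ 3 / (1 + ?s\<^sup>2) powr (real (CARD('n) + 2) / 2)"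
  define k1 where "k1 \<zeta> = rho x / norm (x - \<zeta>) ^ CARD('n)" for \<zeta>
  define k3 where "k3 \<zeta> = rho x ^ 3 / norm (x - \<zeta>) ^ (CARD('n) + 2)" for \<zeta>
  have r0: "rho x \<ge> 0" using x by (simp add: power_le_one)
  have ck: "continuous_on (sphere 0 1) k1" "continuous_on (sphere 0 1) k3"
    unfolding k1_def k3_def using x by (intro pot_integrand_continuous; auto)+
  have i: "integrable sphere_measure (\<lambda>\<zeta>. \<bar>k1 \<zeta> - c1\<bar>)" "integrable sphere_measure (\<lambda>\<zeta>. \<bar>k3 \<zeta> - c3\<bar>)"
    by (intro integrable_sphere_measure_continuous continuous_intros ck)+
  have cK: "continuous_on (sphere 0 1) (K_kernel x)"
    using smooth_on_sphere_kernels(1)[OF x] by (rule smooth_on_sphere_continuous)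
  have K0: "K_op \<phi> 0 = (\<integral>\<zeta>. \<phi> \<zeta> \<partial>sphere_measure)"
    unfolding K_op_def by (rule Bochner_Integration.integral_cong) (auto simp: K_kernel_def)
  have d1: "delta1 CARD('n) ?s = ?N / 4 * c3 - (?N - 4) / 4 * (rho x * c1)"
    by (simp add: delta1_def c1_def c3_def power2_eq_square add.commute)
  have keq: "K_kernel x \<zeta> = ?N / 4 * k3 \<zeta> - (?N - 4) / 4 * (rho x * k1 \<zeta>)" if "\<zeta> \<in> sphere 0 1" for \<zeta>
  proof -
    have "x \<noteq> \<zeta>" using that x by auto
    then show ?thesis by (simp add: K_kernel_eq k1_def k3_def power2_eq_square)
  qed
  have dev: "\<bar>K_kernel x \<zeta> - delta1 CARD('n) ?s\<bar> \<le> ?N / 4 * \<bar>k3 \<zeta> - c3\<bar> + \<bar>?N - 4\<bar> / 4 * rho x * \<bar>k1 \<zeta> - c1\<bar>"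
    if "\<zeta> \<in> sphere 0 1" for \<zeta>
  proof -
    have "K_kernel x \<zeta> - delta1 CARD('n) ?s = ?N / 4 * (k3 \<zeta> - c3) - (?N - 4) / 4 * rho x * (k1 \<zeta> - c1)"
    proof -
      have "(a * u - b * (r * v)) - (a * c - b * (r * d)) = a * (u - c) - b * r * (v - d)" for a b c d r u v :: real
        by (simp add: algebra_simps)
      then show ?thesis unfolding keq[OF that] d1 .
    qed
    also have "\<bar>\<dots>\<bar> \<le> \<bar>?N / 4 * (k3 \<zeta> - c3)\<bar> + \<bar>(?N - 4) / 4 * rho x * (k1 \<zeta> - c1)\<bar>"
      by (rule abs_triangle_ineq4)
    finally show ?thesis using r0 by (simp add: abs_mult)
  qed
  have U3: "(\<integral>\<zeta>. \<bar>k3 \<zeta> - c3\<bar> \<partial>sphere_measure) = U_star k (?s *\<^sub>R axis k 1)"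
    unfolding U_star_def k3_def c3_def using kernel_deviation[OF x, of "rho x ^ 3" "CARD('n) + 2" k] r0 by simp
  have U1: "(\<integral>\<zeta>. \<bar>k1 \<zeta> - c1\<bar> \<partial>sphere_measure) = U k (?s *\<^sub>R axis k 1)"
    unfolding U_def k1_def c1_def using kernel_deviation[OF x, of "rho x" "CARD('n)" k] r0 by simp
  have "norm (K_op \<phi> x - delta1 CARD('n) ?s *\<^sub>R K_op \<phi> 0) \<le> S * (\<integral>\<zeta>. \<bar>K_kernel x \<zeta> - delta1 CARD('n) ?s\<bar> \<partial>sphere_measure)"
    unfolding K0 unfolding K_op_def by (rule norm_scaleR_integral_diff_le[OF c cK S])
  also have "\<dots> \<le> S * (\<integral>\<zeta>. ?N / 4 * \<bar>k3 \<zeta> - c3\<bar> + \<bar>?N - 4\<bar> / 4 * rho x * \<bar>k1 \<zeta> - c1\<bar> \<partial>sphere_measure)"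
    using dev S0 by (intro mult_left_mono integral_mono integrable_sphere_measure_continuous continuous_intros ck cK) auto
  also have "\<dots> = S * (?N / 4 * U_star k (?s *\<^sub>R axis k 1) + \<bar>?N - 4\<bar> / 4 * rho x * U k (?s *\<^sub>R axis k 1))"
    using i by (simp add: U1 U3)
  also have "\<dots> = \<bar>?N - 4\<bar> / 4 * S * rho x * U k (?s *\<^sub>R axis k 1) + ?N / 4 * S * U_star k (?s *\<^sub>R axis k 1)"
    by (simp add: algebra_simps)
  finally show ?thesis .
qed

lemma H_op_deviation:
  fixes \<phi> :: "real^'n \<Rightarrow> real^'m" and k :: 'n
  assumes c: "continuous_on (sphere 0 1) \<phi>" and x: "norm x < 1"
    and S: "\<And>\<zeta>. \<zeta> \<in> sphere 0 1 \<Longrightarrow> norm (\<phi> \<zeta>) \<le> S"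
  shows "norm (H_op \<phi> x - delta2 CARD('n) (norm x) *\<^sub>R H_op \<phi> 0) \<le> S / 2 * rho x * U k (norm x *\<^sub>R axis k 1)"
proof -
  let ?s = "norm x"
  define c1 where "c1 = rho x / (1 + ?s\<^sup>2) powr (real CARD('n) / 2)"
  define k1 where "k1 \<zeta> = rho x / norm (x - \<zeta>) ^ CARD('n)" for \<zeta>
  have r0: "rho x \<ge> 0" using x by (simp add: power_le_one)
  have cH: "continuous_on (sphere 0 1) (H_kernel x)"
    using smooth_on_sphere_kernels(2)[OF x] by (rule smooth_on_sphere_continuous)
  \<comment> \<open>The kernel H equals 1 / 2 at the centre, which is why the reference constant
    below is half of \<open>delta2\<close>.\<close>
  have "H_op \<phi> 0 = (\<integral>\<zeta>. (1 / 2) *\<^sub>R \<phi> \<zeta> \<partial>sphere_measure)"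
    unfolding H_op_def by (rule Bochner_Integration.integral_cong) (auto simp: H_kernel_def)
  then have H0: "delta2 CARD('n) ?s *\<^sub>R H_op \<phi> 0 = (rho x / 2 * c1) *\<^sub>R (\<integral>\<zeta>. \<phi> \<zeta> \<partial>sphere_measure)"
    by (simp add: delta2_def c1_def power2_eq_square)
  have U1: "(\<integral>\<zeta>. \<bar>k1 \<zeta> - c1\<bar> \<partial>sphere_measure) = U k (?s *\<^sub>R axis k 1)"
    unfolding U_def k1_def c1_def using kernel_deviation[OF x, of "rho x" "CARD('n)" k] r0 by simp
  have "norm (H_op \<phi> x - delta2 CARD('n) ?s *\<^sub>R H_op \<phi> 0) \<le> S * (\<integral>\<zeta>. \<bar>H_kernel x \<zeta> - rho x / 2 * c1\<bar> \<partial>sphere_measure)"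
    unfolding H0 unfolding H_op_def by (rule norm_scaleR_integral_diff_le[OF c cH S])
  also have "(\<integral>\<zeta>. \<bar>H_kernel x \<zeta> - rho x / 2 * c1\<bar> \<partial>sphere_measure) = (\<integral>\<zeta>. rho x / 2 * \<bar>k1 \<zeta> - c1\<bar> \<partial>sphere_measure)"
  proof (rule Bochner_Integration.integral_cong)
    fix \<zeta> :: "real^'n"
    have "H_kernel x \<zeta> - rho x / 2 * c1 = rho x / 2 * (k1 \<zeta> - c1)"
      by (simp add: H_kernel_def k1_def power2_eq_square right_diff_distrib)
    then show "\<bar>H_kernel x \<zeta> - rho x / 2 * c1\<bar> = rho x / 2 * \<bar>k1 \<zeta> - c1\<bar>"
      unfolding abs_mult using r0 by (simp only: abs_mult) simp
  qed simp
  also have "S * \<dots> = S / 2 * rho x * U k (?s *\<^sub>R axis k 1)"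
    by (simp add: U1)
  finally show ?thesis .
qed

text \<open>As r tends to 1 the kernel concentrates where the hemisphere sign is 1, so the limit is
  that of its mass, 4 / n. The discrepancy comes only from points with
  \<open>\<zeta> $ k \<le> 0\<close>, whose distance to r e_k is at least 1; hence the bound 2 (1 -
  r^2)^3. On the sphere this makes the factor n / 4 in the estimate come out as 1.\<close>

lemma U_star_radial_limit: "radial_value k (U_star k) 1 = 4 / real CARD('n)"
  for k :: "'n::finite"
proof -
  let ?N = "real CARD('n)"
  let ?e = "\<lambda>r::real. r *\<^sub>R axis k 1 :: real^'n"
  have rho_e: "rho (?e r) = 1 - r\<^sup>2" for r by simp
  have bound: "\<bar>U_star k (?e r) - (4 / ?N + (1 - 4 / ?N) * (1 - r\<^sup>2))\<bar> \<le> 2 * (1 - r\<^sup>2) ^ 3" if r: "0 < r" "r < 1" for r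
  proof -
    have ne: "norm (?e r) < 1" using r by simp
    have r2: "0 \<le> 1 - r\<^sup>2" using r by (simp add: power_le_one)
    have ck: "continuous_on (sphere 0 1) (\<lambda>\<zeta>. (1 - r\<^sup>2) ^ 3 / norm (?e r - \<zeta>) ^ (CARD('n) + 2))"
      using ne by (intro pot_integrand_continuous) auto
    have "4 / ?N + (1 - 4 / ?N) * (1 - r\<^sup>2) = (1 - r\<^sup>2) ^ 3 * pot (CARD('n) + 2) (\<lambda>_. 1) (?e r)"
      using cubic_mass[OF ne] unfolding rho_e by simp
    also have "\<dots> = (\<integral>\<zeta>. (1 - r\<^sup>2) ^ 3 / norm (?e r - \<zeta>) ^ (CARD('n) + 2) \<partial>sphere_measure)"
      unfolding pot_def by (simp flip: integral_mult_right_zero)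
    finally have "U_star k (?e r) - (4 / ?N + (1 - 4 / ?N) * (1 - r\<^sup>2))
      = (\<integral>\<zeta>. (1 - r\<^sup>2) ^ 3 / norm (?e r - \<zeta>) ^ (CARD('n) + 2) * hemisphere_sign k \<zeta>
          - (1 - r\<^sup>2) ^ 3 / norm (?e r - \<zeta>) ^ (CARD('n) + 2) \<partial>sphere_measure)"
      unfolding U_star_def rho_e
      using integrable_mult_hemisphere_sign[OF ck] integrable_sphere_measure_continuous[OF ck] by simp
    also have "norm \<dots> \<le> 2 * (1 - r\<^sup>2) ^ 3"
    proof (rule integral_sphere_measure_norm_le)
      fix \<zeta> :: "real^'n" assume "\<zeta> \<in> sphere 0 1"
      then have \<zeta>: "norm \<zeta> = 1" by simp
      let ?d = "norm (?e r - \<zeta>)"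
      show "norm ((1 - r\<^sup>2) ^ 3 / ?d ^ (CARD('n) + 2) * hemisphere_sign k \<zeta> - (1 - r\<^sup>2) ^ 3 / ?d ^ (CARD('n) + 2)) \<le> 2 * (1 - r\<^sup>2) ^ 3"
      proof (cases "\<zeta> $ k > 0")
        case True
        then show ?thesis using \<zeta> r2 by (simp add: hemisphere_sign_eq)
      next
        case False
        then have "r * \<zeta> $ k \<le> 0" using r by (simp add: mult_nonneg_nonpos)
        then have "1\<^sup>2 \<le> ?d\<^sup>2"
          unfolding norm_axis_diff_power2[OF \<zeta>] using zero_le_power2[of r] by (simp only: mult.assoc one_power2)
        then have "1 \<le> ?d" by (rule power2_le_imp_le) simp
        then have "1 \<le> ?d ^ (CARD('n) + 2)" by (rule one_le_power)
        then have le: "(1 - r\<^sup>2) ^ 3 / ?d ^ (CARD('n) + 2) \<le> (1 - r\<^sup>2) ^ 3" and ge: "0 \<le> (1 - r\<^sup>2) ^ 3 / ?d ^ (CARD('n) + 2)"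
          using r2 by (auto simp: divide_le_eq mult_le_cancel_left1 simp del: add_2_eq_Suc')
        have "\<bar>sgn (\<zeta> $ k) - 1\<bar> \<le> 2" by (simp add: sgn_if)
        then have "(1 - r\<^sup>2) ^ 3 / ?d ^ (CARD('n) + 2) * \<bar>sgn (\<zeta> $ k) - 1\<bar> \<le> (1 - r\<^sup>2) ^ 3 * 2"
          using le ge zero_le_power[OF r2, of 3] by (intro mult_mono) (auto simp del: add_2_eq_Suc')
        moreover have "(1 - r\<^sup>2) ^ 3 / ?d ^ (CARD('n) + 2) * hemisphere_sign k \<zeta> - (1 - r\<^sup>2) ^ 3 / ?d ^ (CARD('n) + 2)
          = (1 - r\<^sup>2) ^ 3 / ?d ^ (CARD('n) + 2) * (sgn (\<zeta> $ k) - 1)"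
          using \<zeta> by (simp add: hemisphere_sign_eq right_diff_distrib del: add_2_eq_Suc')
        ultimately show ?thesis using ge by (simp only: real_norm_def abs_mult abs_of_nonneg[OF ge] mult.commute[of 2])
      qed
    qed (use r2 in simp)
    finally show ?thesis by simp
  qed
  have lim: "((\<lambda>r::real. 2 * (1 - r\<^sup>2) ^ 3) \<longlongrightarrow> 2 * (1 - 1\<^sup>2) ^ 3) (at_left 1)"
    "((\<lambda>r::real. 4 / ?N + (1 - 4 / ?N) * (1 - r\<^sup>2)) \<longlongrightarrow> 4 / ?N + (1 - 4 / ?N) * (1 - 1\<^sup>2)) (at_left 1)"
    by (intro tendsto_intros)+
  have ev: "\<forall>\<^sub>F r in at_left (1::real). norm (U_star k (?e r) - (4 / ?N + (1 - 4 / ?N) * (1 - r\<^sup>2))) \<le> 2 * (1 - r\<^sup>2) ^ 3"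
    unfolding eventually_at_left_field using bound by (intro exI[of _ 0]) auto
  have "((\<lambda>r. U_star k (?e r) - (4 / ?N + (1 - 4 / ?N) * (1 - r\<^sup>2))) \<longlongrightarrow> 0) (at_left 1)"
    by (rule Lim_null_comparison[OF ev]) (use lim(1) in simp)
  from tendsto_add[OF this lim(2)] have "((\<lambda>r. U_star k (?e r)) \<longlongrightarrow> 4 / ?N) (at_left 1)" by simp
  then show ?thesis unfolding radial_value_def
    by (simp add: tendsto_Lim trivial_limit_at_left_real)
qed

section \<open>The estimate on the closed ball\<close>

lemma le_sup_norm_on:
  assumes "bounded (h ` S)" "x \<in> S"
  shows "norm (h x) \<le> sup_norm_on S h"
proof -
  have "bdd_above ((\<lambda>x. norm (h x)) ` S)"
    using assms(1) by (auto simp: bounded_iff bdd_above_def)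
  then show ?thesis unfolding sup_norm_on_def by (rule cSUP_upper[OF assms(2)])
qed

theorem biharmonic_schwarz_estimate:
  fixes \<phi>1 \<phi>2 g f :: "real^'n \<Rightarrow> real^'m"
  assumes c1: "continuous_on (sphere 0 1) \<phi>1" and c2: "continuous_on (sphere 0 1) \<phi>2"
    and cg: "continuous_on (cball 0 1) g" and sol: "biharmonic_dirichlet_solution g \<phi>1 \<phi>2 f"
    and x: "x \<in> cball 0 1"
  shows "estimate_lhs \<phi>1 \<phi>2 f x \<le> estimate_rhs k g \<phi>1 \<phi>2 x"
proof -
  let ?N = "real CARD('n)"
  define S1 S2 M where "S1 = sup_norm_on (sphere 0 1) \<phi>1" and "S2 = sup_norm_on (sphere 0 1) \<phi>2"
    and "M = sup_norm_on (ball 0 1) g"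
  have S1: "norm (\<phi>1 \<zeta>) \<le> S1" if "\<zeta> \<in> sphere 0 1" for \<zeta>
    unfolding S1_def using that by (intro le_sup_norm_on compact_imp_bounded compact_continuous_image c1 compact_sphere)
  have S2: "norm (\<phi>2 \<zeta>) \<le> S2" if "\<zeta> \<in> sphere 0 1" for \<zeta>
    unfolding S2_def using that by (intro le_sup_norm_on compact_imp_bounded compact_continuous_image c2 compact_sphere)
  have "bounded (g ` cball 0 1)" by (intro compact_imp_bounded compact_continuous_image cg compact_cball)
  then have "bounded (g ` ball 0 1)" by (rule bounded_subset) auto
  then have M: "norm (g y) \<le> M" if "norm y < 1" for y
    unfolding M_def using that by (intro le_sup_norm_on) auto
  have S10: "S1 \<ge> 0" using order_trans[OF norm_ge_zero S1[of "axis k 1"]] by simp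
  show ?thesis
  proof (cases "norm x = 1")
    case True
    \<comment> \<open>On the sphere \<open>rho\<close>, \<open>delta1\<close> and
      \<open>delta2\<close> vanish: the left side is |phi1(x)| and the right side collapses to
      \<open>S1\<close>.\<close>
    then have "estimate_lhs \<phi>1 \<phi>2 f x = norm (\<phi>1 x)"
      by (simp add: estimate_lhs_def extended_value_def delta1_def delta2_def)
    also have "\<dots> \<le> S1" using S1 True by simp
    also have "\<dots> = estimate_rhs k g \<phi>1 \<phi>2 x"
      using True by (simp add: estimate_rhs_def U_star_radial_limit S1_def)
    finally show ?thesis .
  next
    case False
    then have x: "norm x < 1" using x by simp
    let ?K = "delta1 CARD('n) (norm x) *\<^sub>R K_op \<phi>1 0" and ?H = "delta2 CARD('n) (norm x) *\<^sub>R H_op \<phi>2 0"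
    have "estimate_lhs \<phi>1 \<phi>2 f x
      = norm ((f x - K_op \<phi>1 x - H_op \<phi>2 x) + (K_op \<phi>1 x - ?K) + (H_op \<phi>2 x - ?H))"
      using False by (simp add: estimate_lhs_def extended_value_def algebra_simps)
    also have "\<dots> \<le> norm (f x - K_op \<phi>1 x - H_op \<phi>2 x) + norm (K_op \<phi>1 x - ?K) + norm (H_op \<phi>2 x - ?H)"
      by (intro norm_triangle_le add_mono order_refl norm_triangle_ineq)
    also have "\<dots> \<le> M / (8 * ?N * (?N + 2)) * (rho x)\<^sup>2
        + (\<bar>?N - 4\<bar> / 4 * S1 * rho x * U k (norm x *\<^sub>R axis k 1) + ?N / 4 * S1 * U_star k (norm x *\<^sub>R axis k 1))
        + S2 / 2 * rho x * U k (norm x *\<^sub>R axis k 1)"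
      by (intro add_mono biharmonic_solution_estimate[OF sol M x] K_op_deviation[OF c1 x S1 S10] H_op_deviation[OF c2 x S2])
    also have "\<dots> = estimate_rhs k g \<phi>1 \<phi>2 x"
      using False by (simp add: estimate_rhs_def radial_value_def S1_def S2_def M_def)
    finally show ?thesis .
  qed
qed

subsection \<open>The extremal solution\<close>

text \<open>The norm is not differentiable at the origin, so \<open>rho\<close> is treated as the
  polynomial 1 - (sum of the squared coordinates).\<close>

lemma Ck_on_rho: "open S \<Longrightarrow> Ck_on k S (rho :: real^'n \<Rightarrow> real)"
proof -
  assume S: "open S"
  have "Ck_on k S (\<lambda>x. 1 + (-1) * (\<Sum>i\<in>I. x $ i * x $ i))" if "finite I" for I :: "'n set"
    by (intro Ck_on_add Ck_on_mult Ck_on_const S) (use that in \<open>induction I rule: finite_induct\<close>,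
        simp_all add: Ck_on_const Ck_on_add Ck_on_mult Ck_on_component S)
  from this[of UNIV] show ?thesis
    by (simp add: power2_norm_eq_inner inner_vec_def)
qed

lemma laplacian_scaleR_const:
  fixes h :: "real^'n \<Rightarrow> real"
  assumes "open S" "Ck_on 2 S h" "x \<in> S"
  shows "laplacian (\<lambda>x. h x *\<^sub>R c) x = laplacian h x *\<^sub>R c"
proof -
  have p: "partial j (\<lambda>x. u x *\<^sub>R c) y = partial j u y *\<^sub>R c" if "u differentiable (at y)" for j y and u :: "real^'n \<Rightarrow> real"
  proof -
    obtain D where D: "(u has_derivative D) (at y)" using \<open>u differentiable (at y)\<close> by (auto simp: differentiable_def)
    show ?thesis unfolding partial_eq[OF D] partial_eq[OF has_derivative_scaleR_left[OF D]] ..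
  qed
  have d: "\<forall>y\<in>S. h differentiable (at y)" "\<forall>j. \<forall>y\<in>S. partial j h differentiable (at y)"
    using assms(2) by (auto simp: numeral_2_eq_2)
  have "partial j (partial j (\<lambda>x. h x *\<^sub>R c)) x = partial j (partial j h) x *\<^sub>R c" for j
  proof -
    have "partial j (partial j (\<lambda>x. h x *\<^sub>R c)) x = partial j (\<lambda>x. partial j h x *\<^sub>R c) x"
      by (rule partial_cong[OF assms(1,3)]) (use p d in blast)
    then show ?thesis using p d assms(3) by simp
  qed
  then show ?thesis by (simp add: laplacian_def scaleR_sum_left)
qed

text \<open>The bilaplacian of \<open>rho\<close>^2 is the constant 8 n (n + 2). On each sphere |x|
  = r the function is constant, with value M (1 - r^2)^2, and so is the scaled normal derivative,
  with value 4 M r^2 (1 - r^2); distributional convergence thus reduces to two scalar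
  limits.\<close>

lemma extremal_solution:
  fixes j :: "'m::finite" and M :: real
  defines "f \<equiv> (\<lambda>x :: real^'n. axis j (M * (1 - (norm x)\<^sup>2)\<^sup>2) :: real^'m)"
  shows "biharmonic_dirichlet_solution
    (\<lambda>x. axis j (8 * real CARD('n) * (real CARD('n) + 2) * M)) (\<lambda>\<zeta>. 0) (\<lambda>\<zeta>. 0) f"
proof -
  let ?N = "real CARD('n)" and ?B = "ball (0 :: real^'n) 1"
  define c where "c = (axis j 1 :: real^'m)"
  have ax: "axis j t = t *\<^sub>R c" for t by (simp add: c_def vec_eq_iff axis_def)
  define h where "h x = M * (rho x)\<^sup>2" for x :: "real^'n"
  define l where "l x = M * (8 - (4 * ?N + 8) * rho x)" for x :: "real^'n"
  have fh: "f = (\<lambda>x. h x *\<^sub>R c)" by (simp add: f_def h_def ax)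
  have op: "open ?B" by simp
  have "Ck_on k ?B (\<lambda>x. M * (rho x * rho x))" for k
    by (intro Ck_on_mult Ck_on_const Ck_on_rho op)
  then have Ch: "Ck_on k ?B h" for k by (simp add: h_def[abs_def] power2_eq_square)
  have "Ck_on k ?B (\<lambda>x. M * (8 + (- (4 * ?N + 8)) * rho x))" for k
    by (intro Ck_on_mult Ck_on_add Ck_on_const Ck_on_rho op)
  then have Cl: "Ck_on k ?B l" for k
    by (rule Ck_on_congI[OF op, rotated]) (simp add: l_def algebra_simps)
  have glh: "glap ?B h (\<lambda>x. M *\<^sub>R ((-4 * rho x) *\<^sub>R x)) l"
    unfolding h_def[abs_def] l_def[abs_def] by (rule glap_cmult[OF glap_rho2])
  have gll: "glap ?B l (\<lambda>x. M *\<^sub>R (0 - (4 * ?N + 8) *\<^sub>R (-2) *\<^sub>R x)) (\<lambda>x. M * (0 - (4 * ?N + 8) * (- 2 * ?N)))"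
    unfolding l_def[abs_def] by (intro glap_cmult glap_diff glap_const glap_rho)
  have L1: "laplacian f x = l x *\<^sub>R c" if "x \<in> ?B" for x
    unfolding fh laplacian_scaleR_const[OF op Ch that] laplacian_eq_glap[OF glh op that] ..
  have L2: "laplacian (laplacian f) x = axis j (8 * ?N * (?N + 2) * M)" if x: "x \<in> ?B" for x
  proof -
    have "partial i (partial i (laplacian f)) x = partial i (partial i (\<lambda>x. l x *\<^sub>R c)) x" for i
      by (intro partial_cong[OF op]) (use L1 x in auto)
    then have "laplacian (laplacian f) x = laplacian (\<lambda>x. l x *\<^sub>R c) x"
      by (simp add: laplacian_def[of "laplacian f"] laplacian_def[of "\<lambda>x. l x *\<^sub>R c"])
    also have "\<dots> = (M * (0 - (4 * ?N + 8) * (- 2 * ?N))) *\<^sub>R c"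
      unfolding laplacian_scaleR_const[OF op Cl x] laplacian_eq_glap[OF gll op x] ..
    also have "\<dots> = axis j (8 * ?N * (?N + 2) * M)" unfolding ax by (simp add: algebra_simps)
    finally show ?thesis .
  qed
  have d: "f differentiable (at x)" for x
  proof -
    have "h differentiable (at x)"
      using glap_deriv[OF glap_cmult[OF glap_rho2[of UNIV]], of x M] by (auto simp: h_def[abs_def] differentiable_def)
    then show ?thesis unfolding fh by (auto intro!: derivative_intros)
  qed
  have inw: "inward_normal_derivative (\<lambda>x. f (r *\<^sub>R x)) \<zeta> = (4 * M * r\<^sup>2 * (1 - r\<^sup>2)) *\<^sub>R c" if "norm \<zeta> = 1" for r \<zeta>
  proof -
    have "((\<lambda>t. f (r *\<^sub>R t *\<^sub>R \<zeta>)) has_vector_derivative (- (4 * M * r\<^sup>2 * (1 - r\<^sup>2))) *\<^sub>R c) (at 1)"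
    proof -
      have "((\<lambda>t. M * (1 - r\<^sup>2 * t\<^sup>2)\<^sup>2) has_real_derivative - (4 * M * r\<^sup>2 * (1 - r\<^sup>2))) (at 1)"
        by (auto intro!: derivative_eq_intros simp: algebra_simps)
      then have "((\<lambda>t. (M * (1 - r\<^sup>2 * t\<^sup>2)\<^sup>2) *\<^sub>R c) has_vector_derivative - (4 * M * r\<^sup>2 * (1 - r\<^sup>2)) *\<^sub>R c) (at 1)"
        using has_vector_derivative_scaleR[OF _ has_vector_derivative_const[of c]] by force
      moreover have "f (r *\<^sub>R t *\<^sub>R \<zeta>) = (M * (1 - r\<^sup>2 * t\<^sup>2)\<^sup>2) *\<^sub>R c" for t
        using that by (simp add: fh h_def power_mult_distrib)
      ultimately show ?thesis by simp
    qed
    then show ?thesis unfolding inward_normal_derivative_def by (simp add: vector_derivative_at)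
  qed
  have dist0: "tendsto_distr_sphere H (\<lambda>\<zeta>. 0) (at_left 1)"
    if H: "\<And>r \<zeta>. \<zeta> \<in> sphere 0 1 \<Longrightarrow> H r \<zeta> = a r *\<^sub>R c" and a: "(a \<longlongrightarrow> 0) (at_left 1)"
    for H :: "real \<Rightarrow> real^'n \<Rightarrow> real^'m" and a
    unfolding tendsto_distr_sphere_def
  proof (intro allI impI)
    fix \<psi> :: "real^'n \<Rightarrow> real" assume "smooth_on_sphere \<psi>"
    then have c\<psi>: "continuous_on (sphere 0 1) \<psi>" by (rule smooth_on_sphere_continuous)
    have "(\<integral>\<zeta>. \<psi> \<zeta> *\<^sub>R H r \<zeta> \<partial>sphere_measure) = a r *\<^sub>R (\<integral>\<zeta>. \<psi> \<zeta> *\<^sub>R c \<partial>sphere_measure)" for r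
    proof -
      have "(\<integral>\<zeta>. \<psi> \<zeta> *\<^sub>R H r \<zeta> \<partial>sphere_measure) = (\<integral>\<zeta>. a r *\<^sub>R (\<psi> \<zeta> *\<^sub>R c) \<partial>sphere_measure)"
        by (rule Bochner_Integration.integral_cong) (use H in \<open>simp_all add: mult.commute\<close>)
      then show ?thesis by (simp del: scaleR_scaleR)
    qed
    then show "((\<lambda>r. \<integral>\<zeta>. \<psi> \<zeta> *\<^sub>R H r \<zeta> \<partial>sphere_measure) \<longlongrightarrow> (\<integral>\<zeta>. \<psi> \<zeta> *\<^sub>R (0 :: real^'m) \<partial>sphere_measure)) (at_left 1)"
      using tendsto_scaleR[OF a tendsto_const[of "\<integral>\<zeta>. \<psi> \<zeta> *\<^sub>R c \<partial>sphere_measure"]] by simp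
  qed
  show ?thesis
    unfolding biharmonic_dirichlet_solution_def
  proof (intro conjI ballI)
    show "Ck_on 2 ?B f" unfolding fh by (rule Ck_on_scaleR_const[OF op Ch])
    show "Ck_on 2 ?B (laplacian f)"
      by (rule Ck_on_congI[OF op _ Ck_on_scaleR_const[OF op Cl]]) (use L1 in auto)
    have "((\<lambda>r::real. M * (1 - r\<^sup>2)\<^sup>2) \<longlongrightarrow> M * (1 - 1\<^sup>2)\<^sup>2) (at_left 1)" by (intro tendsto_intros)
    then show "tendsto_distr_sphere (\<lambda>r \<zeta>. f (r *\<^sub>R \<zeta>)) (\<lambda>\<zeta>. 0) (at_left 1)"
      by (intro dist0[where a="\<lambda>r. M * (1 - r\<^sup>2)\<^sup>2"]) (auto simp: fh h_def power_mult_distrib)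
    have "((\<lambda>r::real. 4 * M * r\<^sup>2 * (1 - r\<^sup>2)) \<longlongrightarrow> 4 * M * 1\<^sup>2 * (1 - 1\<^sup>2)) (at_left 1)" by (intro tendsto_intros)
    then show "tendsto_distr_sphere (\<lambda>r. inward_normal_derivative (\<lambda>x. f (r *\<^sub>R x))) (\<lambda>\<zeta>. 0) (at_left 1)"
      by (intro dist0[where a="\<lambda>r. 4 * M * r\<^sup>2 * (1 - r\<^sup>2)"]) (auto simp: inw)
  qed (use L2 in auto)
qed

text \<open>With zero boundary data only the term in g survives, and both sides are |M|
  \<open>rho\<close>^2. This covers negative M, and the sphere, where the extended value is the
  boundary datum 0.\<close>

lemma extremal_equality:
  fixes j :: "'m::finite" and k :: "'n::finite" and M :: real and x :: "real^'n"
  assumes x: "x \<in> cball 0 1"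
  shows "estimate_lhs (\<lambda>\<zeta>. 0) (\<lambda>\<zeta>. 0) (\<lambda>x. axis j (M * (1 - (norm x)\<^sup>2)\<^sup>2) :: real^'m) x
    = estimate_rhs k (\<lambda>x. axis j (8 * real CARD('n) * (real CARD('n) + 2) * M) :: real^'m) (\<lambda>\<zeta>. 0) (\<lambda>\<zeta>. 0) x"
proof -
  let ?N = "real CARD('n)"
  have nax: "norm (axis j t :: real^'m) = \<bar>t\<bar>" for t
  proof -
    have "axis j t = t *\<^sub>R (axis j 1 :: real^'m)" by (simp add: vec_eq_iff axis_def)
    then show ?thesis by simp
  qed
  have "axis k 1 \<in> sphere (0 :: real^'n) 1" by simp
  then have s0: "sup_norm_on (sphere (0 :: real^'n) 1) (\<lambda>\<zeta>. 0 :: real^'m) = 0"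
    unfolding sup_norm_on_def by (subst cSUP_const) auto
  have sg: "sup_norm_on (ball (0 :: real^'n) 1) (\<lambda>x. axis j (8 * ?N * (?N + 2) * M) :: real^'m) = 8 * ?N * (?N + 2) * \<bar>M\<bar>"
    unfolding sup_norm_on_def by (subst cSUP_const) (auto simp: nax abs_mult)
  have "estimate_lhs (\<lambda>\<zeta>. 0) (\<lambda>\<zeta>. 0) (\<lambda>x. axis j (M * (1 - (norm x)\<^sup>2)\<^sup>2) :: real^'m) x = \<bar>M\<bar> * (1 - (norm x)\<^sup>2)\<^sup>2"
    by (simp add: estimate_lhs_def extended_value_def K_op_def H_op_def nax abs_mult)
  moreover have "8 * ?N * (?N + 2) * \<bar>M\<bar> / (8 * ?N * (?N + 2)) = \<bar>M\<bar>"
    by (simp add: add_nonneg_eq_0_iff)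
  ultimately show ?thesis unfolding estimate_rhs_def s0 sg by simp
qed

theorem theorem1p1:
  fixes k :: "'n::finite" and j :: "'m::finite"
  assumes "CARD('n) \<ge> 2"
  shows
    "(\<forall>(\<phi>1 :: real^'n \<Rightarrow> real^'m) \<phi>2 g f.
        continuous_on (sphere 0 1) \<phi>1 \<longrightarrow> continuous_on (sphere 0 1) \<phi>2 \<longrightarrow>
        continuous_on (cball 0 1) g \<longrightarrow> biharmonic_dirichlet_solution g \<phi>1 \<phi>2 f \<longrightarrow>
        (\<forall>x\<in>cball 0 1. estimate_lhs \<phi>1 \<phi>2 f x \<le> estimate_rhs k g \<phi>1 \<phi>2 x)) \<and>
     (\<forall>M::real.
        let n = real CARD('n);
            g = (\<lambda>x::real^'n. axis j (8 * n * (n + 2) * M) :: real^'m);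
            \<phi>1 = (\<lambda>\<zeta>. 0); \<phi>2 = (\<lambda>\<zeta>. 0);
            f = (\<lambda>x. axis j (M * (1 - (norm x)\<^sup>2)\<^sup>2))
        in biharmonic_dirichlet_solution g \<phi>1 \<phi>2 f \<and>
           (\<forall>x\<in>cball 0 1. estimate_lhs \<phi>1 \<phi>2 f x = estimate_rhs k g \<phi>1 \<phi>2 x))"
  unfolding Let_def
  using biharmonic_schwarz_estimate extremal_solution extremal_equality by blast

end
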